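(* Let $(M,g)$ be a compact pseudo-Kähler manifold of real dimension four, with complex structure $J$. Then every Killing vector field $v$ of $(M,g)$ is real holomorphic, that is, $\mathcal{L}_v J=0$.
   Context: All manifolds, mappings, tensor fields and connections are assumed smooth. A pseudo-Kähler manifold is a pseudo-Riemannian manifold $(M,g)$ (with $g$ of any signature) endowed with an almost-complex structure $J$ which is parallel, $\nabla J=0$, for the Levi-Civita connection $\nabla$ of $g$, and such that at every point $x\in M$ the operator $J_x:T_xM\to T_xM$ is a linear $g_x$-isometry (equivalently, is $g_x$-skew-adjoint). These conditions imply that $J$ is integrable, so $M$ is a complex manifold. A Killing vector field is a vector field $v$ with $\mathcal{L}_v g=0$, where $\mathcal{L}_v$ is the Lie derivative. A vector field $v$ is called real holomorphic if $\mathcal{L}_vJ=0$. *)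

theory Defs
  imports "HOL-Analysis.Analysis"
begin

text \<open>Only used for open \<open>S\<close>, where the derivative of \<open>f\<close> at a point of \<open>S\<close> depends only on
  the values of \<open>f\<close> on \<open>S\<close>.\<close>

primrec Ck_on :: "nat \<Rightarrow> 'e::euclidean_space set \<Rightarrow> ('e \<Rightarrow> 'b::real_normed_vector) \<Rightarrow> bool" where
  "Ck_on 0 S f \<longleftrightarrow> continuous_on S f"
| "Ck_on (Suc k) S f \<longleftrightarrow>
     (\<forall>x\<in>S. f differentiable (at x)) \<and>
     (\<forall>i\<in>Basis. Ck_on k S (\<lambda>x. frechet_derivative f (at x) i))"

definition smooth_on :: "'e::euclidean_space set \<Rightarrow> ('e \<Rightarrow> 'b::real_normed_vector) \<Rightarrow> bool" where
  "smooth_on S f \<longleftrightarrow> (\<forall>k. Ck_on k S f)"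

text \<open>The underlying space of a manifold is a whole type, Hausdorff and second countable by its
  type class. The smooth structure is given by an atlas, not necessarily maximal. A chart is a
  pair of its domain and its coordinate map, whose values outside the domain are irrelevant. The
  dimension is that of the model space \<open>'e\<close>. Connectedness is not required.\<close>

type_synonym ('a, 'e) chart = "'a set \<times> ('a \<Rightarrow> 'e)"

definition smooth_atlas ::
  "('a::{t2_space,second_countable_topology}, 'e::euclidean_space) chart set \<Rightarrow> bool" where
  "smooth_atlas A \<longleftrightarrow>
     (\<Union>(U, \<phi>)\<in>A. U) = UNIV \<and>
     (\<forall>(U, \<phi>)\<in>A. open U \<and> open (\<phi> ` U) \<and> homeomorphism U (\<phi> ` U) \<phi> (inv_into U \<phi>)) \<and>
     (\<forall>(U, \<phi>)\<in>A. \<forall>(V, \<psi>)\<in>A. smooth_on (\<phi> ` (U \<inter> V)) (\<psi> \<circ> inv_into U \<phi>))"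

definition smooth_functions ::
  "('a::{t2_space,second_countable_topology}, 'e::euclidean_space) chart set \<Rightarrow> ('a \<Rightarrow> real) set" where
  "smooth_functions A = {f. \<forall>(U, \<phi>)\<in>A. smooth_on (\<phi> ` U) (f \<circ> inv_into U \<phi>)}"

text \<open>Tangent vectors at \<open>p\<close> are the derivations at \<open>p\<close> of the algebra of smooth functions. They
  are extended by \<open>0\<close> to non-smooth functions, so that a tangent vector is determined by its action
  on smooth functions. The vector space operations on the tangent space are pointwise.\<close>

type_synonym 'a tvec = "('a \<Rightarrow> real) \<Rightarrow> real"

definition tangent_space ::
  "('a::{t2_space,second_countable_topology}, 'e::euclidean_space) chart set \<Rightarrow> 'a \<Rightarrow> 'a tvec set" where
  "tangent_space A p = {D.
     (\<forall>f. f \<notin> smooth_functions A \<longrightarrow> D f = 0) \<and>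
     (\<forall>f\<in>smooth_functions A. \<forall>h\<in>smooth_functions A. \<forall>a b.
        D (\<lambda>x. a * f x + b * h x) = a * D f + b * D h) \<and>
     (\<forall>f\<in>smooth_functions A. \<forall>h\<in>smooth_functions A.
        D (\<lambda>x. f x * h x) = f p * D h + h p * D f)}"

type_synonym 'a vfield = "'a \<Rightarrow> 'a tvec"

definition vector_fields ::
  "('a::{t2_space,second_countable_topology}, 'e::euclidean_space) chart set \<Rightarrow> 'a vfield set" where
  "vector_fields A = {X.
     (\<forall>p. X p \<in> tangent_space A p) \<and>
     (\<forall>f\<in>smooth_functions A. (\<lambda>p. X p f) \<in> smooth_functions A)}"

text \<open>If \<open>f\<close> is not smooth then \<open>Y q f = 0\<close> for all \<open>q\<close>, so the bracket vanishes on \<open>f\<close>, as the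
  convention for tangent vectors demands.\<close>

definition lie_bracket :: "'a vfield \<Rightarrow> 'a vfield \<Rightarrow> 'a vfield" where
  "lie_bracket X Y = (\<lambda>p f. X p (\<lambda>q. Y q f) - Y p (\<lambda>q. X q f))"

text \<open>Smoothness of a tensor field means that it yields smooth functions, respectively smooth
  vector fields, when evaluated on smooth vector fields.\<close>

type_synonym 'a metric_tensor = "'a \<Rightarrow> 'a tvec \<Rightarrow> 'a tvec \<Rightarrow> real"

text \<open>Linearity in the second argument follows from symmetry. The signature is arbitrary.\<close>

definition pseudo_riemannian_metric ::
  "('a::{t2_space,second_countable_topology}, 'e::euclidean_space) chart set
     \<Rightarrow> 'a metric_tensor \<Rightarrow> bool" where
  "pseudo_riemannian_metric A g \<longleftrightarrow>
     (\<forall>p. \<forall>u\<in>tangent_space A p. \<forall>v\<in>tangent_space A p. \<forall>w\<in>tangent_space A p. \<forall>a b.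
        g p (\<lambda>f. a * u f + b * v f) w = a * g p u w + b * g p v w) \<and>
     (\<forall>p. \<forall>u\<in>tangent_space A p. \<forall>v\<in>tangent_space A p. g p u v = g p v u) \<and>
     (\<forall>p. \<forall>u\<in>tangent_space A p. (\<forall>w\<in>tangent_space A p. g p u w = 0) \<longrightarrow> u = (\<lambda>f. 0)) \<and>
     (\<forall>X\<in>vector_fields A. \<forall>Y\<in>vector_fields A. (\<lambda>p. g p (X p) (Y p)) \<in> smooth_functions A)"

type_synonym 'a endo_tensor = "'a \<Rightarrow> 'a tvec \<Rightarrow> 'a tvec"

definition almost_complex_structure ::
  "('a::{t2_space,second_countable_topology}, 'e::euclidean_space) chart set
     \<Rightarrow> 'a endo_tensor \<Rightarrow> bool" where
  "almost_complex_structure A J \<longleftrightarrow>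
     (\<forall>p. \<forall>u\<in>tangent_space A p. J p u \<in> tangent_space A p) \<and>
     (\<forall>p. \<forall>u\<in>tangent_space A p. \<forall>v\<in>tangent_space A p. \<forall>a b.
        J p (\<lambda>f. a * u f + b * v f) = (\<lambda>f. a * J p u f + b * J p v f)) \<and>
     (\<forall>p. \<forall>u\<in>tangent_space A p. J p (J p u) = (\<lambda>f. - u f)) \<and>
     (\<forall>X\<in>vector_fields A. (\<lambda>p. J p (X p)) \<in> vector_fields A)"

type_synonym 'a conn = "'a vfield \<Rightarrow> 'a vfield \<Rightarrow> 'a vfield"

definition affine_connection ::
  "('a::{t2_space,second_countable_topology}, 'e::euclidean_space) chart set
     \<Rightarrow> 'a conn \<Rightarrow> bool" where
  "affine_connection A nabla \<longleftrightarrow>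
     (\<forall>X\<in>vector_fields A. \<forall>Y\<in>vector_fields A. nabla X Y \<in> vector_fields A) \<and>
     (\<forall>X\<in>vector_fields A. \<forall>Y\<in>vector_fields A. \<forall>Z\<in>vector_fields A.
        nabla (\<lambda>p f. X p f + Y p f) Z = (\<lambda>p f. nabla X Z p f + nabla Y Z p f)) \<and>
     (\<forall>X\<in>vector_fields A. \<forall>Y\<in>vector_fields A. \<forall>Z\<in>vector_fields A.
        nabla X (\<lambda>p f. Y p f + Z p f) = (\<lambda>p f. nabla X Y p f + nabla X Z p f)) \<and>
     (\<forall>h\<in>smooth_functions A. \<forall>X\<in>vector_fields A. \<forall>Y\<in>vector_fields A.
        nabla (\<lambda>p f. h p * X p f) Y = (\<lambda>p f. h p * nabla X Y p f)) \<and>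
     (\<forall>h\<in>smooth_functions A. \<forall>X\<in>vector_fields A. \<forall>Y\<in>vector_fields A.
        nabla X (\<lambda>p f. h p * Y p f) = (\<lambda>p f. h p * nabla X Y p f + X p h * Y p f))"

definition levi_civita_connection ::
  "('a::{t2_space,second_countable_topology}, 'e::euclidean_space) chart set
     \<Rightarrow> 'a metric_tensor \<Rightarrow> 'a conn \<Rightarrow> bool" where
  "levi_civita_connection A g nabla \<longleftrightarrow>
     affine_connection A nabla \<and>
     (\<forall>X\<in>vector_fields A. \<forall>Y\<in>vector_fields A.
        (\<lambda>p f. nabla X Y p f - nabla Y X p f) = lie_bracket X Y) \<and>
     (\<forall>X\<in>vector_fields A. \<forall>Y\<in>vector_fields A. \<forall>Z\<in>vector_fields A. \<forall>p.
        X p (\<lambda>q. g q (Y q) (Z q)) = g p (nabla X Y p) (Z p) + g p (Y p) (nabla X Z p))"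

definition cov_derivative_endo :: "'a conn \<Rightarrow> 'a endo_tensor \<Rightarrow> 'a vfield \<Rightarrow> 'a vfield \<Rightarrow> 'a vfield" where
  "cov_derivative_endo nabla J X Y =
     (\<lambda>p f. nabla X (\<lambda>q. J q (Y q)) p f - J p (nabla X Y p) f)"

text \<open>The Levi-Civita connection exists and is unique, so quantifying it existentially in the last
  conjunct says that \<open>J\<close> is parallel for the Levi-Civita connection.\<close>

definition pseudo_kaehler ::
  "('a::{t2_space,second_countable_topology}, 'e::euclidean_space) chart set
     \<Rightarrow> 'a metric_tensor \<Rightarrow> 'a endo_tensor \<Rightarrow> bool" where
  "pseudo_kaehler A g J \<longleftrightarrow>
     pseudo_riemannian_metric A g \<and>
     almost_complex_structure A J \<and>
     (\<forall>p. \<forall>u\<in>tangent_space A p. \<forall>w\<in>tangent_space A p. g p (J p u) (J p w) = g p u w) \<and>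
     (\<exists>nabla. levi_civita_connection A g nabla \<and>
        (\<forall>X\<in>vector_fields A. \<forall>Y\<in>vector_fields A. cov_derivative_endo nabla J X Y = (\<lambda>p f. 0)))"

text \<open>The Lie derivatives of tensor fields of types \<open>(0,2)\<close> and \<open>(1,1)\<close>, evaluated on vector
  fields by the Leibniz rule.\<close>

definition lie_derivative_metric ::
  "'a vfield \<Rightarrow> 'a metric_tensor \<Rightarrow> 'a vfield \<Rightarrow> 'a vfield \<Rightarrow> 'a \<Rightarrow> real" where
  "lie_derivative_metric v g X Y =
     (\<lambda>p. v p (\<lambda>q. g q (X q) (Y q))
        - g p (lie_bracket v X p) (Y p) - g p (X p) (lie_bracket v Y p))"

definition lie_derivative_endo ::
  "'a vfield \<Rightarrow> 'a endo_tensor \<Rightarrow> 'a vfield \<Rightarrow> 'a vfield" where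
  "lie_derivative_endo v J X =
     (\<lambda>p f. lie_bracket v (\<lambda>q. J q (X q)) p f - J p (lie_bracket v X p) f)"

definition killing_field ::
  "('a::{t2_space,second_countable_topology}, 'e::euclidean_space) chart set
     \<Rightarrow> 'a metric_tensor \<Rightarrow> 'a vfield \<Rightarrow> bool" where
  "killing_field A g v \<longleftrightarrow>
     v \<in> vector_fields A \<and>
     (\<forall>X\<in>vector_fields A. \<forall>Y\<in>vector_fields A. lie_derivative_metric v g X Y = (\<lambda>p. 0))"

definition real_holomorphic_field ::
  "('a::{t2_space,second_countable_topology}, 'e::euclidean_space) chart set
     \<Rightarrow> 'a endo_tensor \<Rightarrow> 'a vfield \<Rightarrow> bool" where
  "real_holomorphic_field A J v \<longleftrightarrow>
     v \<in> vector_fields A \<and>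
     (\<forall>X\<in>vector_fields A. lie_derivative_endo v J X = (\<lambda>p f. 0))"

end

theory Submission
  imports Defs
begin

text \<open>Let \<open>\<theta> = g(Jv, \<cdot>)\<close> be the contraction of the Kaehler form with the Killing field \<open>v\<close>, and let
  \<open>\<alpha> = d\<theta>\<close>. Since \<open>J\<close> is parallel and \<open>v\<close> is Killing, \<open>\<alpha>(X, Y) = g((L\<^sub>v J) X, Y)\<close>
  (lemma \<open>LJ_exact\<close>). Differentiating \<open>J\<^sup>2 = -1\<close> shows that \<open>L\<^sub>v J\<close> anticommutes with \<open>J\<close>, so
  \<open>\<alpha>(JX, JY) = -\<alpha>(X, Y)\<close>: the form \<open>\<alpha>\<close> is the real part of a form of type \<open>(2,0)\<close>.
  In real dimension four \<open>\<alpha> \<and> \<alpha>\<close> takes the value \<open>2 (\<alpha>(u, w)\<^sup>2 + \<alpha>(u, Jw)\<^sup>2)\<close> on a basis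
  \<open>u, Ju, w, Jw\<close>. Hence \<open>\<alpha> \<and> \<alpha>\<close> is nonnegative for the orientation given by \<open>J\<close> and vanishes only
  where \<open>\<alpha>\<close> does (lemma \<open>complex_orientation_pfaffian\<close>). But \<open>\<alpha> \<and> \<alpha> = d(\<theta> \<and> \<alpha>)\<close> is exact, so on a
  compact manifold its integral is \<open>0\<close>. Therefore \<open>\<alpha> = 0\<close> (theorem \<open>form_vanishes\<close>), and
  \<open>L\<^sub>v J = 0\<close> because \<open>g\<close> is nondegenerate.

  Stokes' theorem is used only in charts. For a partition of unity \<open>\<eta>\<^sub>i\<close> with supports in chart
  domains, integrating \<open>d(\<eta>\<^sub>i \<theta> \<and> \<alpha>)\<close> in the \<open>i\<close>-th chart expresses the integral of
  \<open>\<eta>\<^sub>i \<alpha> \<and> \<alpha>\<close> as minus that of \<open>d\<eta>\<^sub>i \<and> \<theta> \<and> \<alpha>\<close>. To see that the latter integrals add up to \<open>0\<close>,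
  insert \<open>1 = \<Sum>\<^sub>j \<eta>\<^sub>j\<close> and move the term \<open>\<eta>\<^sub>j d\<eta>\<^sub>i \<and> \<theta> \<and> \<alpha>\<close> to the \<open>j\<close>-th chart, where
  \<open>\<Sum>\<^sub>i d\<eta>\<^sub>i = 0\<close>. In a chart, forms are given by the arrays of their components, and four-forms by
  their coefficient, multiplied by the sign that compares the chart with the orientation of \<open>J\<close>.
  The products become densities, which change by the absolute value of the Jacobian determinant.

  Tangent vectors are derivations of the algebra of globally defined smooth functions. Bump
  functions make derivations local, and Hadamard's lemma shows that they are linear combinations
  of partial derivatives (lemma \<open>tangent_vector_in_coordinates\<close>). It follows that every
  tangent vector extends to a vector field, so that identities between vector fields give identities
  at a point and in coordinates.\<close>

section \<open>Calculus of smooth functions on open sets\<close>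

abbreviation Df :: "('e::real_normed_vector \<Rightarrow> 'b::real_normed_vector) \<Rightarrow> 'e \<Rightarrow> 'e \<Rightarrow> 'b" where
  "Df f x \<equiv> frechet_derivative f (at x)"

lemma Ck_on_Suc_imp_Ck_on: "Ck_on (Suc k) S f \<Longrightarrow> Ck_on k S f"
proof (induction k arbitrary: f)
  case 0
  then show ?case
    by (auto intro!: continuous_at_imp_continuous_on differentiable_imp_continuous_within)
qed auto

lemma Ck_on_imp_continuous_on: "Ck_on k S f \<Longrightarrow> continuous_on S f"
  by (induction k) (auto simp del: Ck_on.simps(2) dest: Ck_on_Suc_imp_Ck_on)

lemma Ck_on_subset: "Ck_on k S f \<Longrightarrow> T \<subseteq> S \<Longrightarrow> Ck_on k T f"
  by (induction k arbitrary: f) (auto intro: continuous_on_subset)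

text \<open>Openness of \<open>S\<close> matters: the derivative at a point of \<open>S\<close> is the one in the whole space.\<close>

lemma Ck_on_cong:
  assumes "open S" "Ck_on k S f" "\<And>x. x \<in> S \<Longrightarrow> f x = g x"
  shows "Ck_on k S g"
  using assms(2,3)
proof (induction k arbitrary: f g)
  case 0
  then show ?case by (simp add: continuous_on_cong[of S S f g])
next
  case (Suc k)
  have eq: "Df f x = Df g x" if "x \<in> S" for x
    using frechet_derivative_transform_within_open[of f x S g] Suc.prems that assms(1) by auto
  have "g differentiable (at x)" if "x \<in> S" for x
    using Suc.prems that assms(1)
    by (metis Ck_on.simps(2) differentiable_def has_derivative_transform_within_open)
  moreover have "Ck_on k S (\<lambda>x. Df g x i)" if "i \<in> Basis" for i
    by (rule Suc.IH[of "\<lambda>x. Df f x i"]) (use Suc.prems that eq in auto)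
  ultimately show ?case by simp
qed

lemma Ck_on_local:
  assumes "\<And>x. x \<in> S \<Longrightarrow> \<exists>T. open T \<and> x \<in> T \<and> Ck_on k T f"
  shows "Ck_on k S f"
  using assms
proof (induction k arbitrary: f)
  case 0
  have "isCont f x" if x: "x \<in> S" for x
  proof -
    obtain T where "open T" "x \<in> T" "continuous_on T f"
      using "0.prems"[OF x] unfolding Ck_on.simps by blast
    then show ?thesis by (simp add: continuous_on_eq_continuous_at)
  qed
  then show ?case unfolding Ck_on.simps by (blast intro: continuous_at_imp_continuous_on)
next
  case (Suc k)
  have "f differentiable (at x)" if "x \<in> S" for x
    using Suc.prems[OF that] by auto
  moreover have "Ck_on k S (\<lambda>x. Df f x i)" if i: "i \<in> Basis" for i
  proof (rule Suc.IH)
    fix x assume "x \<in> S"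
    then obtain T where "open T" "x \<in> T" "Ck_on (Suc k) T f" using Suc.prems by blast
    with i show "\<exists>T. open T \<and> x \<in> T \<and> Ck_on k T (\<lambda>x. Df f x i)"
      by auto
  qed
  ultimately show ?case by simp
qed

lemma Ck_on_const: "Ck_on k S (\<lambda>x. c)"
proof (induction k arbitrary: c)
  case 0 then show ?case by simp
next
  case (Suc k)
  then show ?case by simp
qed

lemma Ck_on_bounded_linear_compose:
  assumes L: "bounded_linear L" and "open S" "Ck_on k S f"
  shows "Ck_on k S (\<lambda>x. L (f x))"
  using assms(3)
proof (induction k arbitrary: f)
  case 0
  then show ?case using bounded_linear.continuous_on[OF L] by simp
next
  case (Suc k)
  have D: "((\<lambda>x. L (f x)) has_derivative (\<lambda>h. L (Df f x h))) (at x)" if "x \<in> S" for x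
    using Suc.prems that by (intro bounded_linear.has_derivative[OF L]) (simp add: frechet_derivative_works[symmetric])
  have eq: "Df (\<lambda>x. L (f x)) x = (\<lambda>h. L (Df f x h))" if "x \<in> S" for x
    using frechet_derivative_at[OF D[OF that]] by simp
  have "Ck_on k S (\<lambda>x. Df (\<lambda>x. L (f x)) x i)" if "i \<in> Basis" for i
    by (rule Ck_on_cong[OF assms(2) Suc.IH[of "\<lambda>x. Df f x i"]])
      (use Suc.prems that eq in auto)
  with D show ?case by (auto simp: differentiable_def)
qed

lemma Ck_on_ident: "Ck_on k S (\<lambda>x. x)"
proof (cases k)
  case (Suc m)
  then show ?thesis by (simp add: Ck_on_const)
qed simp

lemma Ck_on_add:
  assumes "open S" "Ck_on k S f" "Ck_on k S g"
  shows "Ck_on k S (\<lambda>x. f x + g x)"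
  using assms(2,3)
proof (induction k arbitrary: f g)
  case 0
  then show ?case by (simp add: continuous_on_add)
next
  case (Suc k)
  have D: "((\<lambda>x. f x + g x) has_derivative
      (\<lambda>h. Df f x h + Df g x h)) (at x)" if "x \<in> S" for x
    using Suc.prems that by (intro has_derivative_add) (simp_all add: frechet_derivative_works[symmetric])
  have eq: "Df (\<lambda>x. f x + g x) x =
      (\<lambda>h. Df f x h + Df g x h)" if "x \<in> S" for x
    using frechet_derivative_at[OF D[OF that]] by simp
  have "Ck_on k S (\<lambda>x. Df (\<lambda>x. f x + g x) x i)" if "i \<in> Basis" for i
    by (rule Ck_on_cong[OF assms(1) Suc.IH[of "\<lambda>x. Df f x i" "\<lambda>x. Df g x i"]])
      (use Suc.prems that eq in auto)
  with D show ?case by (auto simp: differentiable_def)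
qed

lemma Ck_on_scaleR:
  fixes f :: "'e::euclidean_space \<Rightarrow> real"
  assumes "open S" "Ck_on k S f" "Ck_on k S g"
  shows "Ck_on k S (\<lambda>x. f x *\<^sub>R g x)"
  using assms(2,3)
proof (induction k arbitrary: f g)
  case 0
  then show ?case by (simp add: continuous_on_scaleR)
next
  case (Suc k)
  have D: "((\<lambda>x. f x *\<^sub>R g x) has_derivative
      (\<lambda>h. f x *\<^sub>R Df g x h + Df f x h *\<^sub>R g x)) (at x)" if "x \<in> S" for x
    using Suc.prems that by (intro has_derivative_scaleR) (simp_all add: frechet_derivative_works[symmetric])
  have eq: "Df (\<lambda>x. f x *\<^sub>R g x) x =
      (\<lambda>h. f x *\<^sub>R Df g x h + Df f x h *\<^sub>R g x)" if "x \<in> S" for x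
    using frechet_derivative_at[OF D[OF that]] by simp
  have "Ck_on k S (\<lambda>x. Df (\<lambda>x. f x *\<^sub>R g x) x i)" if "i \<in> Basis" for i
    by (rule Ck_on_cong[OF assms(1) Ck_on_add[OF assms(1)
          Suc.IH[of f "\<lambda>x. Df g x i"]
          Suc.IH[of "\<lambda>x. Df f x i" g]]])
      (use Suc.prems that eq Ck_on_Suc_imp_Ck_on[OF Suc.prems(1)] Ck_on_Suc_imp_Ck_on[OF Suc.prems(2)] in auto)
  with D show ?case by (auto simp: differentiable_def)
qed

lemma Ck_on_sum:
  assumes "open S" "\<And>i. i \<in> I \<Longrightarrow> Ck_on k S (f i)"
  shows "Ck_on k S (\<lambda>x. \<Sum>i\<in>I. f i x)"
proof (cases "finite I")
  case True
  then show ?thesis using assms(2)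
    by (induction I) (auto simp: Ck_on_const intro!: Ck_on_add assms(1))
qed (simp add: Ck_on_const)

lemma frechet_derivative_eq_sum_Basis:
  fixes f :: "'e::euclidean_space \<Rightarrow> 'b::real_normed_vector"
  assumes "f differentiable (at x)"
  shows "Df f x h = (\<Sum>j\<in>Basis. (h \<bullet> j) *\<^sub>R Df f x j)"
proof -
  have L: "linear (Df f x)" using linear_frechet_derivative[OF assms] .
  have "Df f x h = Df f x (\<Sum>j\<in>Basis. (h \<bullet> j) *\<^sub>R j)"
    by (simp add: euclidean_representation)
  also have "\<dots> = (\<Sum>j\<in>Basis. (h \<bullet> j) *\<^sub>R Df f x j)"
    by (simp add: linear_sum[OF L] linear_scale[OF L])
  finally show ?thesis .
qed

lemma chain_rule_Basis:
  fixes f :: "'e::euclidean_space \<Rightarrow> 'f::euclidean_space" and g :: "'f \<Rightarrow> 'b::real_normed_vector"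
  assumes "f differentiable (at x)" "g differentiable (at (f x))"
  shows "Df (\<lambda>x. g (f x)) x i =
    (\<Sum>j\<in>Basis. (Df f x i \<bullet> j) *\<^sub>R Df g (f x) j)"
proof -
  have "Df (\<lambda>x. g (f x)) x i
      = Df g (f x) (Df f x i)"
    using frechet_derivative_compose[OF assms] by (simp add: o_def)
  also note frechet_derivative_eq_sum_Basis[OF assms(2)]
  finally show ?thesis .
qed

text \<open>By the chain rule each derivative of the composition is a sum of products of a derivative of \<open>f\<close>
  and a derivative of \<open>g\<close> composed with \<open>f\<close>, so the induction has to vary \<open>g\<close> but not \<open>f\<close>.\<close>

lemma Ck_on_compose:
  fixes f :: "'e::euclidean_space \<Rightarrow> 'f::euclidean_space" and g :: "'f \<Rightarrow> 'b::real_normed_vector"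
  assumes "open S" "open T" "\<And>x. x \<in> S \<Longrightarrow> f x \<in> T" "Ck_on k S f" "Ck_on k T g"
  shows "Ck_on k S (\<lambda>x. g (f x))"
  using assms(4,5)
proof (induction k arbitrary: g)
  case 0
  then show ?case using assms(3) by (auto intro: continuous_on_compose2)
next
  case (Suc k)
  have df: "f differentiable (at x)" and dg: "g differentiable (at (f x))" if "x \<in> S" for x
    using Suc.prems assms(3) that by auto
  have D: "(\<lambda>x. g (f x)) differentiable (at x)" if "x \<in> S" for x
    using differentiable_chain_at[OF df[OF that] dg[OF that]] by (simp add: o_def)
  have "Ck_on k S (\<lambda>x. Df (\<lambda>x. g (f x)) x i)" if i: "i \<in> Basis" for i
  proof (rule Ck_on_cong[OF assms(1) Ck_on_sum[OF assms(1) Ck_on_scaleR[OF assms(1)]]])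
    fix j :: 'f assume j: "j \<in> Basis"
    show "Ck_on k S (\<lambda>x. Df f x i \<bullet> j)"
      by (rule Ck_on_bounded_linear_compose[OF bounded_linear_inner_left assms(1)]) (use Suc.prems i in auto)
    show "Ck_on k S (\<lambda>x. Df g (f x) j)"
      by (rule Suc.IH[of "\<lambda>y. Df g y j"]) (use Suc.prems j Ck_on_Suc_imp_Ck_on[OF Suc.prems(1)] in auto)
  qed (simp add: chain_rule_Basis df dg)
  with D show ?case by auto
qed

lemma Ck_on_inverse:
  fixes f :: "'e::euclidean_space \<Rightarrow> real"
  assumes "open S" "Ck_on k S f" "\<And>x. x \<in> S \<Longrightarrow> f x \<noteq> 0"
  shows "Ck_on k S (\<lambda>x. inverse (f x))"
  using assms(2)
proof (induction k)
  case 0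
  then show ?case using assms(3) by (auto intro: continuous_on_inverse)
next
  case (Suc k)
  have D: "((\<lambda>x. inverse (f x)) has_derivative
      (\<lambda>h. - (inverse (f x) * Df f x h * inverse (f x)))) (at x)" if "x \<in> S" for x
    using Suc.prems that assms(3)[OF that]
    by (intro Deriv.has_derivative_inverse) (auto simp: frechet_derivative_works[symmetric])
  have eq: "Df (\<lambda>x. inverse (f x)) x =
      (\<lambda>h. - (inverse (f x) * Df f x h * inverse (f x)))" if "x \<in> S" for x
    using frechet_derivative_at[OF D[OF that]] by simp
  have "Ck_on k S (\<lambda>x. Df (\<lambda>x. inverse (f x)) x i)" if i: "i \<in> Basis" for i
  proof -
    have 1: "Ck_on k S (\<lambda>x. inverse (f x))" using Suc.IH Ck_on_Suc_imp_Ck_on[OF Suc.prems] .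
    have 2: "Ck_on k S (\<lambda>x. Df f x i)" using Suc.prems i by auto
    have "Ck_on k S (\<lambda>x. - (inverse (f x) *\<^sub>R (inverse (f x) *\<^sub>R Df f x i)))"
      by (intro Ck_on_bounded_linear_compose[OF bounded_linear_minus[OF bounded_linear_ident]] Ck_on_scaleR assms(1) 1 2)
    then show ?thesis by (rule Ck_on_cong[OF assms(1)]) (simp add: eq mult.assoc)
  qed
  with D show ?case by (auto simp: differentiable_def)
qed

lemma smooth_on_subset: "smooth_on S f \<Longrightarrow> T \<subseteq> S \<Longrightarrow> smooth_on T f"
  unfolding smooth_on_def using Ck_on_subset by blast

lemma smooth_on_cong:
  "open S \<Longrightarrow> smooth_on S f \<Longrightarrow> (\<And>x. x \<in> S \<Longrightarrow> f x = g x) \<Longrightarrow> smooth_on S g"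
  unfolding smooth_on_def using Ck_on_cong by blast

lemma smooth_on_local:
  assumes "\<And>x. x \<in> S \<Longrightarrow> \<exists>T. open T \<and> x \<in> T \<and> smooth_on T f"
  shows "smooth_on S f"
  unfolding smooth_on_def
proof (intro allI Ck_on_local)
  fix k x assume "x \<in> S"
  from assms[OF this] obtain T where "open T" "x \<in> T" "smooth_on T f" by auto
  then show "\<exists>T. open T \<and> x \<in> T \<and> Ck_on k T f" unfolding smooth_on_def by auto
qed

lemma smooth_on_const: "smooth_on S (\<lambda>x. c)"
  by (simp add: smooth_on_def Ck_on_const)

lemma smooth_on_ident: "smooth_on S (\<lambda>x. x)"
  by (simp add: smooth_on_def Ck_on_ident)

lemma smooth_on_bounded_linear_compose:
  "bounded_linear L \<Longrightarrow> open S \<Longrightarrow> smooth_on S f \<Longrightarrow> smooth_on S (\<lambda>x. L (f x))"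
  by (simp add: smooth_on_def Ck_on_bounded_linear_compose)

lemma smooth_on_add: "open S \<Longrightarrow> smooth_on S f \<Longrightarrow> smooth_on S g \<Longrightarrow> smooth_on S (\<lambda>x. f x + g x)"
  by (simp add: smooth_on_def Ck_on_add)

lemma smooth_on_scaleR:
  "open S \<Longrightarrow> smooth_on S f \<Longrightarrow> smooth_on S g \<Longrightarrow> smooth_on S (\<lambda>x. f x *\<^sub>R g x)"
  by (simp add: smooth_on_def Ck_on_scaleR)

lemma smooth_on_mult:
  fixes f g :: "'e::euclidean_space \<Rightarrow> real"
  shows "open S \<Longrightarrow> smooth_on S f \<Longrightarrow> smooth_on S g \<Longrightarrow> smooth_on S (\<lambda>x. f x * g x)"
  using smooth_on_scaleR[of S f g] by simp

lemma smooth_on_uminus: "open S \<Longrightarrow> smooth_on S f \<Longrightarrow> smooth_on S (\<lambda>x. - f x)"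
  using smooth_on_bounded_linear_compose[OF bounded_linear_minus[OF bounded_linear_ident]] .

lemma smooth_on_diff:
  "open S \<Longrightarrow> smooth_on S f \<Longrightarrow> smooth_on S g \<Longrightarrow> smooth_on S (\<lambda>x. f x - g x)"
  using smooth_on_add[OF _ _ smooth_on_uminus, of S f g] by simp

lemma smooth_on_sum:
  "open S \<Longrightarrow> (\<And>i. i \<in> I \<Longrightarrow> smooth_on S (f i)) \<Longrightarrow> smooth_on S (\<lambda>x. \<Sum>i\<in>I. f i x)"
  by (simp add: smooth_on_def Ck_on_sum)

lemma smooth_on_inner_Basis: "open S \<Longrightarrow> smooth_on S f \<Longrightarrow> smooth_on S (\<lambda>x. f x \<bullet> i)"
  by (rule smooth_on_bounded_linear_compose[OF bounded_linear_inner_left])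

lemma smooth_on_inverse:
  fixes f :: "'e::euclidean_space \<Rightarrow> real"
  shows "open S \<Longrightarrow> smooth_on S f \<Longrightarrow> (\<And>x. x \<in> S \<Longrightarrow> f x \<noteq> 0) \<Longrightarrow> smooth_on S (\<lambda>x. inverse (f x))"
  by (simp add: smooth_on_def Ck_on_inverse)

lemma smooth_on_compose:
  fixes f :: "'e::euclidean_space \<Rightarrow> 'f::euclidean_space" and g :: "'f \<Rightarrow> 'b::real_normed_vector"
  shows "open S \<Longrightarrow> open T \<Longrightarrow> (\<And>x. x \<in> S \<Longrightarrow> f x \<in> T) \<Longrightarrow> smooth_on S f \<Longrightarrow> smooth_on T g
    \<Longrightarrow> smooth_on S (\<lambda>x. g (f x))"
  by (simp add: smooth_on_def Ck_on_compose)

lemma smooth_on_imp_differentiable: "smooth_on S f \<Longrightarrow> x \<in> S \<Longrightarrow> f differentiable (at x)"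
  by (metis Ck_on.simps(2) smooth_on_def)

lemma smooth_on_imp_continuous_on: "smooth_on S f \<Longrightarrow> continuous_on S f"
  unfolding smooth_on_def using Ck_on_imp_continuous_on by blast

lemma smooth_on_frechet_derivative:
  "smooth_on S f \<Longrightarrow> i \<in> Basis \<Longrightarrow> smooth_on S (\<lambda>x. Df f x i)"
  by (metis Ck_on.simps(2) smooth_on_def)

lemma frechet_derivative_mult_real:
  fixes f g :: "'e::euclidean_space \<Rightarrow> real"
  assumes "f differentiable (at x)" "g differentiable (at x)"
  shows "Df (\<lambda>x. f x * g x) x i =
    f x * Df g x i + Df f x i * g x"
  using fun_cong[OF frechet_derivative_at[OF has_derivative_mult[OF
        assms[unfolded frechet_derivative_works]]], of i] by simp

lemma frechet_derivative_add_at: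
  assumes "f differentiable (at x)" "g differentiable (at x)"
  shows "Df (\<lambda>x. f x + g x) x i =
    Df f x i + Df g x i"
  using fun_cong[OF frechet_derivative_at[OF has_derivative_add[OF
        assms[unfolded frechet_derivative_works]]], of i] by simp

lemma frechet_derivative_diff_at:
  assumes "f differentiable (at x)" "g differentiable (at x)"
  shows "Df (\<lambda>x. f x - g x) x i =
    Df f x i - Df g x i"
  using fun_cong[OF frechet_derivative_at[OF has_derivative_diff[OF
        assms[unfolded frechet_derivative_works]]], of i] by simp

lemma has_derivative_along_line:
  fixes f :: "'e::euclidean_space \<Rightarrow> real"
  assumes "f differentiable (at (x + t *\<^sub>R i))"
  shows "((\<lambda>t. f (x + t *\<^sub>R i)) has_real_derivative Df f (x + t *\<^sub>R i) i) (at t)"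
proof -
  let ?D = "Df f (x + t *\<^sub>R i)"
  have "((\<lambda>t. x + t *\<^sub>R i) has_derivative (\<lambda>h. h *\<^sub>R i)) (at t)"
    by (auto intro!: derivative_eq_intros)
  from has_derivative_compose[OF this assms[unfolded frechet_derivative_works]]
  have "((\<lambda>t. f (x + t *\<^sub>R i)) has_derivative (\<lambda>h. ?D (h *\<^sub>R i))) (at t)" .
  moreover have "(\<lambda>h. ?D (h *\<^sub>R i)) = (*) (?D i)"
    using linear_scale[OF linear_frechet_derivative[OF assms]] by (auto simp: fun_eq_iff)
  ultimately show ?thesis
    unfolding has_field_derivative_def by simp
qed

section \<open>Mixed derivatives, divergences and Hadamard's lemma\<close>

text \<open>The second difference is obtained by differencing first in direction \<open>j\<close> and then in direction
  \<open>i\<close>; apply the mean value theorem to each of the two steps.\<close>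

lemma second_difference_mean_value:
  fixes f :: "'e::euclidean_space \<Rightarrow> real"
  assumes f: "smooth_on S f" and i: "i \<in> Basis" and j: "j \<in> Basis" and h: "0 < h"
    and S: "\<And>s t. 0 \<le> s \<Longrightarrow> s \<le> h \<Longrightarrow> 0 \<le> t \<Longrightarrow> t \<le> h \<Longrightarrow> x + s *\<^sub>R i + t *\<^sub>R j \<in> S"
  obtains s t where "0 < s" "s < h" "0 < t" "t < h"
    "f (x + h *\<^sub>R i + h *\<^sub>R j) - f (x + h *\<^sub>R i) - f (x + h *\<^sub>R j) + f x
      = h * h * Df (\<lambda>y. Df f y i) (x + s *\<^sub>R i + t *\<^sub>R j) j"
proof -
  let ?Df = "\<lambda>y. Df f y i"
  define \<phi> where "\<phi> = (\<lambda>s. f ((x + h *\<^sub>R j) + s *\<^sub>R i) - f (x + s *\<^sub>R i))"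
  have d1: "(\<phi> has_real_derivative (?Df ((x + h *\<^sub>R j) + s *\<^sub>R i) - ?Df (x + s *\<^sub>R i))) (at s)"
    if "0 \<le> s" "s \<le> h" for s
    unfolding \<phi>_def
    using S[of s h] S[of s 0] h that
    by (intro DERIV_diff has_derivative_along_line smooth_on_imp_differentiable[OF f]) (auto simp: ac_simps)
  obtain s where s: "0 < s" "s < h"
    and \<phi>: "\<phi> h - \<phi> 0 = (h - 0) * (?Df ((x + h *\<^sub>R j) + s *\<^sub>R i) - ?Df (x + s *\<^sub>R i))"
    using MVT2[OF h, of \<phi> "\<lambda>s. ?Df ((x + h *\<^sub>R j) + s *\<^sub>R i) - ?Df (x + s *\<^sub>R i)"] d1 by auto
  define \<psi> where "\<psi> = (\<lambda>t. ?Df ((x + s *\<^sub>R i) + t *\<^sub>R j))"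
  have d2: "(\<psi> has_real_derivative Df ?Df ((x + s *\<^sub>R i) + t *\<^sub>R j) j) (at t)"
    if "0 \<le> t" "t \<le> h" for t
    unfolding \<psi>_def
    using S[of s t] s that
    by (intro has_derivative_along_line smooth_on_imp_differentiable[OF smooth_on_frechet_derivative[OF f i]]) auto
  obtain t where t: "0 < t" "t < h"
    and \<psi>: "\<psi> h - \<psi> 0 = (h - 0) * Df ?Df ((x + s *\<^sub>R i) + t *\<^sub>R j) j"
    using MVT2[OF h, of \<psi> "\<lambda>t. Df ?Df ((x + s *\<^sub>R i) + t *\<^sub>R j) j"] d2 by auto
  have "\<phi> h - \<phi> 0 = h * (\<psi> h - \<psi> 0)"
    using \<phi> by (simp add: \<psi>_def add.assoc add.commute[of "h *\<^sub>R j"])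
  then have "\<phi> h - \<phi> 0 = h * h * Df ?Df (x + s *\<^sub>R i + t *\<^sub>R j) j"
    using \<psi> by simp
  then show thesis
    using that[OF s t] by (simp add: \<phi>_def add.assoc add.commute[of "h *\<^sub>R j"] algebra_simps)
qed

text \<open>The second difference is symmetric in \<open>i\<close> and \<open>j\<close>, so both mixed derivatives take equal values at
  points arbitrarily close to \<open>x\<close>. Continuity then forces them to agree at \<open>x\<close>.\<close>

lemma mixed_partial_derivatives_commute:
  fixes f :: "'e::euclidean_space \<Rightarrow> real"
  assumes "open S" and f: "smooth_on S f" and i: "i \<in> Basis" and j: "j \<in> Basis" and x: "x \<in> S"
  shows "Df (\<lambda>y. Df f y i) x j
       = Df (\<lambda>y. Df f y j) x i"
proof (rule ccontr)
  let ?P = "\<lambda>y. Df (\<lambda>y. Df f y i) y j"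
  let ?Q = "\<lambda>y. Df (\<lambda>y. Df f y j) y i"
  assume ne: "?P x \<noteq> ?Q x"
  define e where "e = \<bar>?P x - ?Q x\<bar> / 2"
  have e: "e > 0" using ne by (simp add: e_def)
  have cont: "continuous_on S ?P" "continuous_on S ?Q"
    by (intro smooth_on_imp_continuous_on smooth_on_frechet_derivative f i j)+
  obtain d1 where d1: "d1 > 0" "\<And>y. y \<in> S \<Longrightarrow> dist y x < d1 \<Longrightarrow> dist (?P y) (?P x) < e"
    using cont(1) x e unfolding continuous_on_iff by meson
  obtain d2 where d2: "d2 > 0" "\<And>y. y \<in> S \<Longrightarrow> dist y x < d2 \<Longrightarrow> dist (?Q y) (?Q x) < e"
    using cont(2) x e unfolding continuous_on_iff by meson
  obtain d3 where d3: "d3 > 0" "ball x d3 \<subseteq> S" using assms(1) x openE by blast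
  \<comment> \<open>The points given by the mean value theorem have distance at most \<open>2 * h\<close> from \<open>x\<close>.\<close>
  define h where "h = Min {d1, d2, d3} / 3"
  have h: "h > 0" "2 * h < d1" "2 * h < d2" "2 * h < d3" using d1 d2 d3 by (auto simp: h_def)
  have near: "dist (x + s *\<^sub>R a + t *\<^sub>R b) x \<le> 2 * h"
    if "0 \<le> s" "s \<le> h" "0 \<le> t" "t \<le> h" "a \<in> Basis" "b \<in> Basis" for s t a b
  proof -
    have "dist (x + s *\<^sub>R a + t *\<^sub>R b) x = norm (s *\<^sub>R a + t *\<^sub>R b)" by (simp add: dist_norm add.assoc)
    also have "\<dots> \<le> norm (s *\<^sub>R a) + norm (t *\<^sub>R b)" by (rule norm_triangle_ineq)
    also have "\<dots> \<le> 2 * h" using that by simp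
    finally show ?thesis .
  qed
  have inS: "x + s *\<^sub>R a + t *\<^sub>R b \<in> S"
    if "0 \<le> s" "s \<le> h" "0 \<le> t" "t \<le> h" "a \<in> Basis" "b \<in> Basis" for s t a b
    using near[OF that] h d3 by (auto simp: subset_iff dist_commute)
  obtain s t where st: "0 < s" "s < h" "0 < t" "t < h" and
    1: "f (x + h *\<^sub>R i + h *\<^sub>R j) - f (x + h *\<^sub>R i) - f (x + h *\<^sub>R j) + f x = h * h * ?P (x + s *\<^sub>R i + t *\<^sub>R j)"
    by (rule second_difference_mean_value[OF f i j h(1), of x]) (use inS i j in auto)
  obtain s' t' where st': "0 < s'" "s' < h" "0 < t'" "t' < h" and
    2: "f (x + h *\<^sub>R j + h *\<^sub>R i) - f (x + h *\<^sub>R j) - f (x + h *\<^sub>R i) + f x = h * h * ?Q (x + s' *\<^sub>R j + t' *\<^sub>R i)"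
    by (rule second_difference_mean_value[OF f j i h(1), of x]) (use inS i j in auto)
  have "h * h * ?P (x + s *\<^sub>R i + t *\<^sub>R j) = h * h * ?Q (x + s' *\<^sub>R j + t' *\<^sub>R i)"
    unfolding 1[symmetric] 2[symmetric] by (simp add: add.assoc add.commute[of "h *\<^sub>R j"])
  then have eq: "?P (x + s *\<^sub>R i + t *\<^sub>R j) = ?Q (x + s' *\<^sub>R j + t' *\<^sub>R i)" using h by simp
  have "dist (?P (x + s *\<^sub>R i + t *\<^sub>R j)) (?P x) < e"
    using d1(2) inS[of s t i j] near[of s t i j] st h i j by auto
  moreover have "dist (?Q (x + s' *\<^sub>R j + t' *\<^sub>R i)) (?Q x) < e"
    using d2(2) inS[of s' t' j i] near[of s' t' j i] st' h i j by auto
  ultimately show False using eq by (simp add: e_def dist_real_def abs_if split: if_splits)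
qed

lemma frechet_derivative_eq_0_outside:
  fixes f :: "'e::euclidean_space \<Rightarrow> real"
  assumes "closed K" "\<And>x. x \<notin> K \<Longrightarrow> f x = 0" "x \<notin> K"
  shows "Df f x = (\<lambda>h. 0)"
proof -
  have "((\<lambda>x. 0) has_derivative (\<lambda>h. 0)) (at x)" by simp
  then have "(f has_derivative (\<lambda>h. 0)) (at x)"
    by (rule has_derivative_transform_within_open[where s = "- K"]) (use assms in auto)
  then show ?thesis using frechet_derivative_at by metis
qed

lemma integral_eq_on_supersets:
  fixes f :: "'e::euclidean_space \<Rightarrow> real"
  assumes "\<And>x. x \<notin> K \<Longrightarrow> f x = 0" "K \<subseteq> S"
  shows "integral S f = integral UNIV f"
proof -
  have "integral S f = integral UNIV (\<lambda>x. if x \<in> S then f x else 0)"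
    by (simp add: integral_restrict_UNIV)
  also have "(\<lambda>x. if x \<in> S then f x else 0) = f" using assms by (auto simp: fun_eq_iff)
  finally show ?thesis .
qed

text \<open>The integral of \<open>f (x + t i)\<close> over \<open>x\<close> does not depend on \<open>t\<close>. Differentiating at \<open>t = 0\<close> under the
  integral sign gives the claim.\<close>

lemma directional_derivative_has_integral_0:
  fixes f :: "'e::euclidean_space \<Rightarrow> real"
  assumes df: "\<And>x. f differentiable (at x)"
    and cont: "continuous_on UNIV (\<lambda>x. Df f x i)"
    and K: "compact K" "\<And>x. x \<notin> K \<Longrightarrow> f x = 0"
  shows "((\<lambda>x. Df f x i) has_integral 0) UNIV"
proof -
  \<comment> \<open>This set contains the supports of all translates with \<open>\<bar>t\<bar> \<le> 1\<close>.\<close>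
  let ?K = "(\<lambda>(x,t). x - t *\<^sub>R i) ` (K \<times> {-1..1::real})"
  have "compact ?K"
    by (intro compact_continuous_image compact_Times K) (auto simp: case_prod_unfold intro!: continuous_intros)
  then obtain c where c: "?K \<subseteq> cbox (-c) c"
    using bounded_subset_cbox_symmetric compact_imp_bounded by blast
  have shift: "x - t *\<^sub>R i \<in> cbox (-c) c" if "x \<in> K" "\<bar>t\<bar> \<le> 1" for x t
    using subsetD[OF c imageI[of "(x, t)"]] that by (simp add: abs_le_iff)
  then have Kc: "K \<subseteq> cbox (-c) c" using shift[of _ 0] by auto
  have Kt: "K \<subseteq> cbox (- c + t *\<^sub>R i) (c + t *\<^sub>R i)" if "\<bar>t\<bar> \<le> 1" for t
    using shift[OF _ that] by (fastforce simp: mem_box inner_diff_left inner_add_left)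
  have contf: "continuous_on UNIV f"
    using df by (simp add: continuous_at_imp_continuous_on differentiable_imp_continuous_within)
  define G where "G = (\<lambda>t. integral (cbox (-c) c) (\<lambda>x. f (x + t *\<^sub>R i)))"
  have G: "G t = integral UNIV f" if "\<bar>t\<bar> \<le> 1" for t
  proof -
    have "G t = integral (cbox (-c) c) (f \<circ> (+) (t *\<^sub>R i))" by (simp add: G_def o_def add.commute)
    also have "\<dots> = integral (cbox (- c + t *\<^sub>R i) (c + t *\<^sub>R i)) f" by (rule integral_shift_cbox_plus)
    also have "\<dots> = integral UNIV f" by (rule integral_eq_on_supersets[OF K(2) Kt[OF that]])
    finally show ?thesis .
  qed
  have "(G has_field_derivative integral (cbox (-c) c) (\<lambda>x. Df f (x + 0 *\<^sub>R i) i))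
      (at 0 within {-1<..<1})"
    unfolding G_def
  proof (rule leibniz_rule_field_derivative)
    show "((\<lambda>t. f (x + t *\<^sub>R i)) has_field_derivative Df f (x + t *\<^sub>R i) i) (at t within {-1<..<1})" for x t
      by (rule has_field_derivative_at_within[OF has_derivative_along_line[OF df]])
    show "(\<lambda>x. f (x + t *\<^sub>R i)) integrable_on cbox (-c) c" for t
      by (intro integrable_continuous continuous_on_compose2[OF contf] continuous_intros) auto
    show "continuous_on ({- 1<..<1} \<times> cbox (- c) c) (\<lambda>(t, x). Df f (x + t *\<^sub>R i) i)"
      unfolding case_prod_unfold
      by (intro continuous_on_compose2[OF cont] continuous_intros) auto
  qed auto
  then have 1: "(G has_field_derivative integral (cbox (-c) c) (\<lambda>x. Df f x i)) (at 0)"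
    using at_within_open[of 0 "{-1<..<1::real}"] by simp
  have "((\<lambda>t. integral UNIV f) has_field_derivative 0) (at 0)" by simp
  then have "(G has_field_derivative 0) (at 0)"
    by (rule has_field_derivative_transform_within_open[where S = "{-1<..<1}"]) (auto simp: G)
  with 1 have 0: "integral (cbox (-c) c) (\<lambda>x. Df f x i) = 0"
    using DERIV_unique by blast
  have "(\<lambda>x. Df f x i) integrable_on cbox (-c) c"
    by (intro integrable_continuous continuous_on_subset[OF cont]) auto
  then have "((\<lambda>x. Df f x i) has_integral 0) (cbox (-c) c)"
    using 0 by (metis integrable_integral)
  then show ?thesis
    by (rule has_integral_on_superset)
      (use frechet_derivative_eq_0_outside[of K f] compact_imp_closed[OF K(1)] K(2) Kc in fastforce)+
qed

text \<open>The factor \<open>t\<^sup>m\<close> is there because each differentiation in \<open>x\<close> produces one factor \<open>t\<close>: with it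
  the class of these integrals is closed under differentiation, and smoothness follows by induction.\<close>

lemma ray_integral_has_derivative:
  fixes F :: "'e::euclidean_space \<Rightarrow> real"
  assumes F: "smooth_on (ball a r) F" and x: "x \<in> ball a r"
  shows "((\<lambda>x. integral {0..1} (\<lambda>t. t ^ m * F (a + t *\<^sub>R (x - a)))) has_derivative
    (\<lambda>h. \<Sum>j\<in>Basis. (h \<bullet> j) * integral {0..1} (\<lambda>t. t ^ Suc m * Df F (a + t *\<^sub>R (x - a)) j))) (at x)"
proof -
  have inball: "a + t *\<^sub>R (y - a) \<in> ball a r" if "y \<in> ball a r" "t \<in> {0..1}" for y t
  proof -
    have "norm (t *\<^sub>R (y - a)) \<le> norm (y - a)" using that by (simp add: mult_left_le_one_le)
    then show ?thesis using that by (simp add: dist_norm norm_minus_commute)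
  qed
  define c where "c = (\<lambda>y t j. t ^ Suc m * Df F (a + t *\<^sub>R (y - a)) j)"
  define B where "B = (\<lambda>y t. \<Sum>j\<in>Basis. c y t j *\<^sub>R blinfun_inner_right j)"
  have contc: "continuous_on (ball a r \<times> {0..1}) (\<lambda>(y,t). c y t j)" if "j \<in> Basis" for j
    unfolding c_def case_prod_unfold
    by (intro continuous_intros
        continuous_on_compose2[OF smooth_on_imp_continuous_on[OF smooth_on_frechet_derivative[OF F that]]])
      (use inball in auto)
  have contc1: "continuous_on {0..1} (\<lambda>t. c x t j)" if "j \<in> Basis" for j
  proof -
    have "continuous_on {0..1} (\<lambda>t. (\<lambda>(y,t). c y t j) (x, t))"
      by (rule continuous_on_compose2[OF contc[OF that]]) (use x in \<open>auto intro!: continuous_intros\<close>)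
    then show ?thesis by simp
  qed
  have "((\<lambda>x. integral (cbox 0 1) (\<lambda>t. t ^ m * F (a + t *\<^sub>R (x - a)))) has_derivative
      blinfun_apply (integral (cbox 0 1) (B x))) (at x within ball a r)"
  proof (rule leibniz_rule)
    fix y and t :: real assume y: "y \<in> ball a r" and t: "t \<in> cbox 0 1"
    let ?y = "a + t *\<^sub>R (y - a)"
    have dF: "F differentiable (at ?y)"
      using inball[OF y] t by (intro smooth_on_imp_differentiable[OF F]) auto
    have "((\<lambda>y. a + t *\<^sub>R (y - a)) has_derivative (\<lambda>h. t *\<^sub>R h)) (at y)"
      by (auto intro!: derivative_eq_intros)
    from has_derivative_compose[OF this dF[unfolded frechet_derivative_works]]
    have "((\<lambda>y. F (a + t *\<^sub>R (y - a))) has_derivative (\<lambda>h. Df F ?y (t *\<^sub>R h))) (at y)" .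
    then have "((\<lambda>y. t ^ m * F (a + t *\<^sub>R (y - a))) has_derivative
        (\<lambda>h. t ^ m * Df F ?y (t *\<^sub>R h))) (at y)"
      by (rule has_derivative_mult_right)
    also have "(\<lambda>h. t ^ m * Df F ?y (t *\<^sub>R h)) = blinfun_apply (B y t)"
    proof
      fix h
      have "Df F ?y (t *\<^sub>R h) = (\<Sum>j\<in>Basis. (t * (h \<bullet> j)) * Df F ?y j)"
        by (subst frechet_derivative_eq_sum_Basis[OF dF]) simp
      then show "t ^ m * Df F ?y (t *\<^sub>R h) = blinfun_apply (B y t) h"
        by (simp add: B_def c_def blinfun.sum_left blinfun.scaleR_left sum_distrib_left inner_commute mult_ac)
    qed
    finally show "((\<lambda>y. t ^ m * F (a + t *\<^sub>R (y - a))) has_derivative blinfun_apply (B y t)) (at y within ball a r)"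
      by (rule has_derivative_at_withinI)
  next
    fix y assume y: "y \<in> ball a r"
    show "(\<lambda>t. t ^ m * F (a + t *\<^sub>R (y - a))) integrable_on cbox 0 1"
      by (intro integrable_continuous continuous_intros continuous_on_compose2[OF smooth_on_imp_continuous_on[OF F]])
        (use inball[OF y] in auto)
  next
    show "continuous_on (ball a r \<times> cbox 0 1) (\<lambda>(y, t). B y t)"
      unfolding B_def case_prod_unfold
      by (intro continuous_intros) (use contc in \<open>auto simp: case_prod_unfold\<close>)
  qed (use x in auto)
  moreover have "blinfun_apply (integral (cbox 0 1) (B x)) h = (\<Sum>j\<in>Basis. (h \<bullet> j) * integral {0..1} (\<lambda>t. c x t j))" for h
  proof -
    have ci: "(\<lambda>t. c x t j) integrable_on {0..1}" if "j \<in> Basis" for j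
      using integrable_continuous_interval[OF contc1[OF that]] .
    have "((\<lambda>t. B x t) has_integral (\<Sum>j\<in>Basis. integral {0..1} (\<lambda>t. c x t j) *\<^sub>R blinfun_inner_right j)) {0..1}"
      unfolding B_def
      by (intro has_integral_sum has_integral_scaleR_left integrable_integral ci) auto
    then have "integral (cbox 0 1) (B x) = (\<Sum>j\<in>Basis. integral {0..1} (\<lambda>t. c x t j) *\<^sub>R blinfun_inner_right j)"
      by (simp add: integral_unique)
    then show ?thesis
      by (simp add: blinfun.sum_left blinfun.scaleR_left inner_commute mult.commute)
  qed
  moreover have "at x within ball a r = at x" using x at_within_open[OF x open_ball] by simp
  ultimately have "((\<lambda>x. integral {0..1} (\<lambda>t. t ^ m * F (a + t *\<^sub>R (x - a)))) has_derivative
      (\<lambda>h. \<Sum>j\<in>Basis. (h \<bullet> j) * integral {0..1} (\<lambda>t. c x t j))) (at x)"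
    by (metis (no_types, lifting) ext box_real(2))
  then show ?thesis by (simp add: c_def)
qed

lemma Ck_on_ray_integral:
  fixes F :: "'e::euclidean_space \<Rightarrow> real"
  assumes "smooth_on (ball a r) F"
  shows "Ck_on k (ball a r) (\<lambda>x. integral {0..1} (\<lambda>t. t ^ m * F (a + t *\<^sub>R (x - a))))"
  using assms
proof (induction k arbitrary: F m)
  case 0
  then show ?case
    using ray_integral_has_derivative[OF 0]
    by (auto intro!: continuous_at_imp_continuous_on has_derivative_continuous)
next
  case (Suc k)
  let ?H = "\<lambda>x. integral {0..1} (\<lambda>t. t ^ m * F (a + t *\<^sub>R (x - a)))"
  let ?c = "\<lambda>j x. integral {0..1} (\<lambda>t. t ^ Suc m * Df F (a + t *\<^sub>R (x - a)) j)"
  have D: "(?H has_derivative (\<lambda>h. \<Sum>j\<in>Basis. (h \<bullet> j) * ?c j x)) (at x)" if "x \<in> ball a r" for x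
    by (rule ray_integral_has_derivative[OF Suc.prems that])
  have eq: "?c i x = Df ?H x i" if "i \<in> Basis" "x \<in> ball a r" for i x
  proof -
    have "Df ?H x i = (\<Sum>j\<in>Basis. (i \<bullet> j) * ?c j x)"
      using fun_cong[OF frechet_derivative_at[OF D[OF that(2)]], of i] by simp
    also have "\<dots> = (\<Sum>j\<in>Basis. if j = i then ?c j x else 0)"
      by (rule sum.cong) (use that in \<open>auto simp: inner_Basis\<close>)
    also have "\<dots> = ?c i x" using that by simp
    finally show ?thesis by simp
  qed
  have "Ck_on k (ball a r) (\<lambda>x. Df ?H x i)" if "i \<in> Basis" for i
    by (rule Ck_on_cong[OF open_ball Suc.IH[OF smooth_on_frechet_derivative[OF Suc.prems that], of "Suc m"]])
      (rule eq[OF that])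
  with D show ?case unfolding Ck_on.simps differentiable_def by blast
qed

text \<open>Integrate the derivative of \<open>f\<close> along the segment from \<open>a\<close> to \<open>x\<close>; \<open>H i\<close> is the mean value of the
  \<open>i\<close>-th partial derivative on that segment.\<close>

lemma Hadamard_lemma:
  fixes f :: "'e::euclidean_space \<Rightarrow> real"
  assumes f: "smooth_on (ball a r) f" and r: "r > 0"
  shows "\<exists>H. (\<forall>i\<in>Basis. smooth_on (ball a r) (H i) \<and> H i a = Df f a i) \<and>
    (\<forall>x\<in>ball a r. f x = f a + (\<Sum>i\<in>Basis. (x \<bullet> i - a \<bullet> i) * H i x))"
proof (intro exI conjI ballI)
  let ?H = "\<lambda>i x. integral {0..1} (\<lambda>t. t ^ 0 * Df f (a + t *\<^sub>R (x - a)) i)"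
  show "smooth_on (ball a r) (?H i)" if "i \<in> Basis" for i
    unfolding smooth_on_def by (intro allI Ck_on_ray_integral smooth_on_frechet_derivative f that)
  show "?H i a = Df f a i" for i by simp
  fix x assume x: "x \<in> ball a r"
  have inball: "a + t *\<^sub>R (x - a) \<in> ball a r" if "t \<in> {0..1}" for t
  proof -
    have "norm (t *\<^sub>R (x - a)) \<le> norm (x - a)" using that by (simp add: mult_left_le_one_le)
    then show ?thesis using x by (simp add: dist_norm norm_minus_commute)
  qed
  have df: "f differentiable (at (a + t *\<^sub>R (x - a)))" if "t \<in> {0..1}" for t
    by (rule smooth_on_imp_differentiable[OF f inball[OF that]])
  have "((\<lambda>t. Df f (a + t *\<^sub>R (x - a)) (x - a)) has_integral
      f (a + 1 *\<^sub>R (x - a)) - f (a + 0 *\<^sub>R (x - a))) {0..1}"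
    using has_derivative_along_line[OF df]
    by (intro fundamental_theorem_of_calculus)
      (auto simp: has_real_derivative_iff_has_vector_derivative[symmetric] intro: has_field_derivative_at_within)
  moreover have "((\<lambda>t. \<Sum>i\<in>Basis. ((x - a) \<bullet> i) * Df f (a + t *\<^sub>R (x - a)) i) has_integral
      (\<Sum>i\<in>Basis. ((x - a) \<bullet> i) * ?H i x)) {0..1}"
  proof (intro has_integral_sum has_integral_mult_right)
    fix i :: 'e assume i: "i \<in> Basis"
    have "continuous_on {0..1} (\<lambda>t. Df f (a + t *\<^sub>R (x - a)) i)"
      by (intro continuous_on_compose2[OF smooth_on_imp_continuous_on[OF smooth_on_frechet_derivative[OF f i]]]
          continuous_intros) (use inball in auto)
    then show "((\<lambda>t. Df f (a + t *\<^sub>R (x - a)) i) has_integral ?H i x) {0..1}"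
      using integrable_integral[OF integrable_continuous_interval] by simp
  qed auto
  then have "((\<lambda>t. Df f (a + t *\<^sub>R (x - a)) (x - a)) has_integral
      (\<Sum>i\<in>Basis. ((x - a) \<bullet> i) * ?H i x)) {0..1}"
    by (rule has_integral_eq[rotated]) (simp add: frechet_derivative_eq_sum_Basis[OF df, of _ "x - a"])
  ultimately have "f (a + 1 *\<^sub>R (x - a)) - f (a + 0 *\<^sub>R (x - a)) = (\<Sum>i\<in>Basis. ((x - a) \<bullet> i) * ?H i x)"
    by (rule has_integral_unique)
  then show "f x = f a + (\<Sum>i\<in>Basis. (x \<bullet> i - a \<bullet> i) * ?H i x)" by (simp add: inner_diff_left)
qed

subsection \<open>Bump functions\<close>

text \<open>For \<open>m = 0\<close> this is the standard function that is flat at \<open>0\<close>. Its derivatives are linear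
  combinations of the functions with larger \<open>m\<close>.\<close>

definition flat_exp :: "nat \<Rightarrow> real \<Rightarrow> real" where
  "flat_exp m t = (if t \<le> 0 then 0 else inverse t ^ m * exp (- inverse t))"

lemma flat_exp_has_derivative:
  "(flat_exp m has_real_derivative (flat_exp (m + 2) t - real m * flat_exp (m + 1) t)) (at t)"
proof -
  consider "t < 0" | "t > 0" | "t = 0" by linarith
  then show ?thesis
  proof cases
    case 1
    have "((\<lambda>t. 0) has_real_derivative 0) (at t)" by simp
    then have "(flat_exp m has_real_derivative 0) (at t)"
      by (rule has_field_derivative_transform_within_open[where S = "{..<0}"]) (use 1 in \<open>auto simp: flat_exp_def\<close>)
    then show ?thesis using 1 by (simp add: flat_exp_def)
  next
    case 2
    have i: "(inverse has_real_derivative - (inverse t ^ 2)) (at t)"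
      using DERIV_inverse[of t] 2 by (simp add: numeral_2_eq_2)
    have "((\<lambda>t. inverse t ^ m) has_real_derivative - (real m * inverse t ^ (m + 1))) (at t)"
      using DERIV_power[OF i, of m] by (cases m) (simp_all add: power2_eq_square mult_ac)
    moreover have "((\<lambda>t. exp (- inverse t)) has_real_derivative exp (- inverse t) * inverse t ^ 2) (at t)"
      using DERIV_fun_exp[OF DERIV_minus[OF i]] by simp
    ultimately have "((\<lambda>t. inverse t ^ m * exp (- inverse t)) has_real_derivative
        - (real m * inverse t ^ (m + 1)) * exp (- inverse t) + exp (- inverse t) * inverse t ^ 2 * inverse t ^ m) (at t)"
      by (rule DERIV_mult)
    then have "((\<lambda>t. inverse t ^ m * exp (- inverse t)) has_real_derivative
        (inverse t ^ (m + 2) * exp (- inverse t) - real m * (inverse t ^ (m + 1) * exp (- inverse t)))) (at t)"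
      by (simp add: power_add power2_eq_square mult_ac)
    then have "(flat_exp m has_real_derivative
        (inverse t ^ (m + 2) * exp (- inverse t) - real m * (inverse t ^ (m + 1) * exp (- inverse t)))) (at t)"
      by (rule has_field_derivative_transform_within_open[where S = "{0<..}"]) (use 2 in \<open>auto simp: flat_exp_def\<close>)
    then show ?thesis using 2 by (simp add: flat_exp_def)
  next
    case 3
    have "((\<lambda>x::real. x ^ (m + 1) / exp x) \<longlongrightarrow> 0) at_top" by (rule tendsto_power_div_exp_0)
    from filterlim_compose[OF this filterlim_inverse_at_top_right]
    have "((\<lambda>h::real. inverse h ^ (m + 1) / exp (inverse h)) \<longlongrightarrow> 0) (at_right 0)" .
    then have r: "((\<lambda>h. (flat_exp m h - flat_exp m 0) / (h - 0)) \<longlongrightarrow> 0) (at_right 0)"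
      by (rule Lim_transform_eventually)
        (auto simp: eventually_at_filter flat_exp_def exp_minus field_simps)
    have l: "((\<lambda>h. (flat_exp m h - flat_exp m 0) / (h - 0)) \<longlongrightarrow> 0) (at_left 0)"
      by (rule Lim_transform_eventually[OF tendsto_const])
        (auto simp: eventually_at_filter flat_exp_def)
    have "((\<lambda>h. (flat_exp m h - flat_exp m 0) / (h - 0)) \<longlongrightarrow> 0) (at 0)"
      using l r filterlim_split_at by blast
    then show ?thesis using 3 by (simp add: has_field_derivative_iff flat_exp_def)
  qed
qed

lemma Ck_on_flat_exp: "Ck_on k UNIV (flat_exp m)"
proof (induction k arbitrary: m)
  case 0
  show ?case using flat_exp_has_derivative by (auto intro!: DERIV_continuous_on)
next
  case (Suc k)
  have "Df (flat_exp m) t = (\<lambda>h. (flat_exp (m + 2) t - real m * flat_exp (m + 1) t) * h)" for t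
    using frechet_derivative_at[OF flat_exp_has_derivative[of m t, unfolded has_field_derivative_def]] by simp
  moreover have "Ck_on k UNIV (\<lambda>t. flat_exp (m + 2) t + (- real m) *\<^sub>R flat_exp (m + 1) t)"
    by (intro Ck_on_add Ck_on_scaleR Ck_on_const Suc open_UNIV)
  ultimately show ?case using flat_exp_has_derivative by (auto simp: differentiable_def has_field_derivative_def)
qed

lemma exists_smooth_bump:
  fixes a :: "'e::euclidean_space"
  assumes "0 < r" "r < R"
  obtains B :: "'e \<Rightarrow> real" where "smooth_on UNIV B" "\<And>x. 0 \<le> B x" "\<And>x. x \<in> cball a r \<Longrightarrow> B x = 1"
    "\<And>x. x \<notin> ball a R \<Longrightarrow> B x = 0"
proof
  define s where "s = (\<lambda>x. (x - a) \<bullet> (x - a))"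
  have s_norm: "s x = (dist a x)\<^sup>2" for x
    by (metis dist_commute dist_norm power2_norm_eq_inner s_def)
  have f: "smooth_on UNIV (flat_exp 0)" by (simp add: smooth_on_def Ck_on_flat_exp)
  have s: "smooth_on UNIV s"
  proof -
    have "smooth_on UNIV (\<lambda>x. \<Sum>i\<in>Basis. ((x - a) \<bullet> i) * ((x - a) \<bullet> i))"
      by (intro smooth_on_sum smooth_on_mult smooth_on_inner_Basis smooth_on_diff smooth_on_ident smooth_on_const open_UNIV)
    then show ?thesis by (simp add: s_def euclidean_inner[symmetric])
  qed
  define u where "u = (\<lambda>x. flat_exp 0 (R\<^sup>2 - s x))"
  define w where "w = (\<lambda>x. flat_exp 0 (s x - r\<^sup>2))"
  have u: "smooth_on UNIV u" and w: "smooth_on UNIV w"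
    unfolding u_def w_def
    by (intro smooth_on_compose[OF _ _ _ _ f] smooth_on_diff smooth_on_const s open_UNIV UNIV_I)+
  have rR: "r\<^sup>2 < R\<^sup>2" using assms by (simp add: power_strict_mono)
  have nonneg: "u x \<ge> 0" "w x \<ge> 0" for x by (auto simp: u_def w_def flat_exp_def)
  have pos: "u x + w x > 0" for x
    using rR by (cases "s x < R\<^sup>2") (auto simp: u_def w_def flat_exp_def add_pos_nonneg)
  show "smooth_on UNIV (\<lambda>x. u x * inverse (u x + w x))"
    using pos by (intro smooth_on_mult smooth_on_inverse smooth_on_add u w open_UNIV) (metis less_irrefl)
  show "0 \<le> u x * inverse (u x + w x)" for x using nonneg pos[of x] by simp
  show "u x * inverse (u x + w x) = 1" if "x \<in> cball a r" for x
  proof -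
    have "s x \<le> r\<^sup>2" using that assms by (simp add: s_norm power_mono)
    then have "w x = 0" by (simp add: w_def flat_exp_def)
    then show ?thesis using pos[of x] by simp
  qed
  show "u x * inverse (u x + w x) = 0" if "x \<notin> ball a R" for x
  proof -
    have "s x \<ge> R\<^sup>2" using that assms by (simp add: s_norm power_mono)
    then show ?thesis by (simp add: u_def flat_exp_def)
  qed
qed

section \<open>Smooth functions and tangent vectors on a manifold\<close>

text \<open>A chart is a pair \<open>c\<close> of its domain \<open>fst c\<close> and its coordinate map \<open>snd c\<close>.\<close>

locale smooth_manifold =
  fixes A :: "('a::{t2_space,second_countable_topology}, 'e::euclidean_space) chart set"
  assumes atlas: "smooth_atlas A"
begin

abbreviation TM :: "'a \<Rightarrow> 'a tvec set" where
  "TM \<equiv> tangent_space A"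

abbreviation SF :: "('a \<Rightarrow> real) set" where
  "SF \<equiv> smooth_functions A"

abbreviation VF :: "'a vfield set" where
  "VF \<equiv> vector_fields A"

abbreviation cinv :: "('a, 'e) chart \<Rightarrow> 'e \<Rightarrow> 'a" where
  "cinv c \<equiv> inv_into (fst c) (snd c)"

abbreviation cimg :: "('a, 'e) chart \<Rightarrow> 'e set" where
  "cimg c \<equiv> snd c ` fst c"

lemma exists_chart: obtains c where "c \<in> A" "p \<in> fst c"
proof -
  have "p \<in> (\<Union>(U, \<phi>)\<in>A. U)" using atlas by (simp add: smooth_atlas_def)
  then show thesis using that by fastforce
qed

context
  fixes c assumes c: "c \<in> A"
begin

lemma chart_homeomorphism:
  shows open_chart_domain: "open (fst c)" and open_chart_image: "open (cimg c)"
    and continuous_on_chart: "continuous_on (fst c) (snd c)"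
    and continuous_on_cinv: "continuous_on (cimg c) (cinv c)"
    and cinv_chart: "\<And>p. p \<in> fst c \<Longrightarrow> cinv c (snd c p) = p"
  using atlas c unfolding smooth_atlas_def homeomorphism_def by (auto simp: split_beta)

lemma chart_cinv: "x \<in> cimg c \<Longrightarrow> snd c (cinv c x) = x"
  by (rule f_inv_into_f)

lemma cinv_in_domain: "x \<in> cimg c \<Longrightarrow> cinv c x \<in> fst c"
  by (rule inv_into_into)

lemma inj_on_chart: "inj_on (snd c) (fst c)"
  using cinv_chart by (metis inj_onI)

lemma open_chart_of_open:
  assumes "open W" "W \<subseteq> fst c"
  shows "open (snd c ` W)"
proof -
  have "snd c ` W = cimg c \<inter> cinv c -` W"
    using assms(2) by (force simp: cinv_chart)
  then show ?thesis
    using continuous_open_preimage[OF continuous_on_cinv open_chart_image assms(1)] by simp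
qed

lemma open_cinv_of_open:
  assumes "open W" "W \<subseteq> cimg c"
  shows "open (cinv c ` W)"
proof -
  have "cinv c ` W = fst c \<inter> snd c -` W"
  proof (intro equalityI subsetI)
    fix q assume "q \<in> cinv c ` W"
    then obtain x where "x \<in> W" "q = cinv c x" by auto
    then show "q \<in> fst c \<inter> snd c -` W" using assms(2) chart_cinv cinv_in_domain by auto
  next
    fix q assume "q \<in> fst c \<inter> snd c -` W"
    then show "q \<in> cinv c ` W" using cinv_chart[of q] by (intro image_eqI[of _ _ "snd c q"]) auto
  qed
  then show ?thesis
    using continuous_open_preimage[OF continuous_on_chart open_chart_domain assms(1)] by simp
qed

lemma smooth_functions_in_chart: "f \<in> SF \<Longrightarrow> smooth_on (cimg c) (f \<circ> cinv c)"
  using c unfolding smooth_functions_def by (auto simp: split_beta)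

lemma transition_smooth:
  assumes "d \<in> A"
  shows "smooth_on (snd c ` (fst c \<inter> fst d)) (snd d \<circ> cinv c)"
  using atlas c assms unfolding smooth_atlas_def by (fastforce simp: split_beta)

end

text \<open>It suffices to test smoothness near each point in one chart, since transition maps are smooth.\<close>

lemma smooth_functions_localI:
  assumes "\<And>p. \<exists>c\<in>A. \<exists>W. open W \<and> p \<in> W \<and> W \<subseteq> fst c \<and> smooth_on (snd c ` W) (f \<circ> cinv c)"
  shows "f \<in> SF"
proof -
  have "smooth_on (cimg d) (f \<circ> cinv d)" if d: "d \<in> A" for d
  proof (rule smooth_on_local)
    fix x assume x: "x \<in> cimg d"
    define p where "p = cinv d x"
    have p: "p \<in> fst d" using cinv_in_domain[OF d x] by (simp add: p_def)
    obtain c W where c: "c \<in> A" and W: "open W" "p \<in> W" "W \<subseteq> fst c" "smooth_on (snd c ` W) (f \<circ> cinv c)"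
      using assms by meson
    let ?T = "snd d ` (fst d \<inter> W)"
    have T: "open ?T" using W open_chart_domain[OF d] by (intro open_chart_of_open[OF d]) auto
    have "smooth_on ?T (\<lambda>y. (f \<circ> cinv c) ((snd c \<circ> cinv d) y))"
    proof (rule smooth_on_compose[OF T open_chart_of_open[OF c W(1,3)]])
      show "smooth_on ?T (snd c \<circ> cinv d)"
        by (rule smooth_on_subset[OF transition_smooth[OF d c]]) (use W in auto)
      show "smooth_on (snd c ` W) (f \<circ> cinv c)" by (rule W(4))
    qed (use W cinv_chart[OF d] in auto)
    then have "smooth_on ?T (f \<circ> cinv d)"
      by (rule smooth_on_cong[OF T]) (use W cinv_chart[OF d] cinv_chart[OF c] in auto)
    moreover have "x \<in> ?T"
      using p W chart_cinv[OF d x] unfolding p_def by (metis IntI image_eqI)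
    ultimately show "\<exists>T. open T \<and> x \<in> T \<and> smooth_on T (f \<circ> cinv d)" using T by blast
  qed
  then show ?thesis unfolding smooth_functions_def by (auto simp: split_beta)
qed

lemma smooth_functionsI:
  assumes "\<And>c. c \<in> A \<Longrightarrow> smooth_on (cimg c) (f \<circ> cinv c)"
  shows "f \<in> SF"
  using assms unfolding smooth_functions_def by (auto simp: split_beta)

lemma smooth_functions_const: "(\<lambda>p. a) \<in> SF"
  by (rule smooth_functionsI) (simp add: o_def smooth_on_const)

lemma smooth_functions_add:
  "f \<in> SF \<Longrightarrow> h \<in> SF \<Longrightarrow> (\<lambda>p. f p + h p) \<in> SF"
  by (rule smooth_functionsI)
    (use smooth_on_add[OF open_chart_image smooth_functions_in_chart smooth_functions_in_chart] in \<open>fastforce simp: o_def\<close>)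

lemma smooth_functions_mult:
  "f \<in> SF \<Longrightarrow> h \<in> SF \<Longrightarrow> (\<lambda>p. f p * h p) \<in> SF"
  by (rule smooth_functionsI)
    (use smooth_on_mult[OF open_chart_image smooth_functions_in_chart smooth_functions_in_chart] in \<open>fastforce simp: o_def\<close>)

lemma smooth_functions_sum:
  "(\<And>i. i \<in> I \<Longrightarrow> f i \<in> SF) \<Longrightarrow> (\<lambda>p. \<Sum>i\<in>I. f i p) \<in> SF"
  by (induction I rule: infinite_finite_induct) (auto intro: smooth_functions_const smooth_functions_add)

lemma smooth_functions_inverse:
  assumes "f \<in> SF" "\<And>p. f p \<noteq> 0"
  shows "(\<lambda>p. inverse (f p)) \<in> SF"
proof (rule smooth_functionsI)
  fix c assume c: "c \<in> A"
  show "smooth_on (cimg c) ((\<lambda>p. inverse (f p)) \<circ> cinv c)"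
    using smooth_on_inverse[OF open_chart_image[OF c] smooth_functions_in_chart[OF c assms(1)]] assms(2)
    by (simp add: o_def)
qed

lemma smooth_functions_lincomb:
  "f \<in> SF \<Longrightarrow> h \<in> SF \<Longrightarrow> (\<lambda>p. a * f p + b * h p) \<in> SF"
  by (intro smooth_functions_add smooth_functions_mult smooth_functions_const)

lemma smooth_functions_diff:
  "f \<in> SF \<Longrightarrow> h \<in> SF \<Longrightarrow> (\<lambda>p. f p - h p) \<in> SF"
  using smooth_functions_lincomb[of f h 1 "-1"] by simp

lemma smooth_functions_extend_by_0:
  assumes c: "c \<in> A" and W: "open W" "W \<subseteq> fst c" and K: "closed K" "K \<subseteq> W"
    and h: "smooth_on (snd c ` W) (h \<circ> cinv c)"
    and f: "\<And>p. p \<notin> K \<Longrightarrow> f p = 0" "\<And>p. p \<in> W \<Longrightarrow> f p = h p"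
  shows "f \<in> SF"
proof (rule smooth_functions_localI)
  fix p
  show "\<exists>c\<in>A. \<exists>W. open W \<and> p \<in> W \<and> W \<subseteq> fst c \<and> smooth_on (snd c ` W) (f \<circ> cinv c)"
  proof (cases "p \<in> W")
    case True
    have "smooth_on (snd c ` W) (f \<circ> cinv c)"
      by (rule smooth_on_cong[OF open_chart_of_open[OF c W] h])
        (use f(2) W(2) cinv_chart[OF c] in auto)
    then show ?thesis using True W c by blast
  next
    case False
    obtain d where d: "d \<in> A" "p \<in> fst d" using exists_chart .
    let ?W = "fst d - K"
    have o: "open ?W" using open_chart_domain[OF d(1)] K(1) by auto
    have "smooth_on (snd d ` ?W) (f \<circ> cinv d)"
      by (rule smooth_on_cong[OF open_chart_of_open[OF d(1) o] smooth_on_const[of _ 0]])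
        (use f(1) cinv_chart[OF d(1)] in auto)
    then show ?thesis using o d False K(2) by blast
  qed
qed

definition bump :: "'a set \<Rightarrow> 'a set \<Rightarrow> ('a \<Rightarrow> real) \<Rightarrow> bool" where
  "bump N K \<psi> \<longleftrightarrow> \<psi> \<in> SF \<and> open N \<and> compact K \<and> N \<subseteq> K \<and>
     (\<forall>q. 0 \<le> \<psi> q) \<and> (\<forall>q\<in>N. \<psi> q = 1) \<and> (\<forall>q. q \<notin> K \<longrightarrow> \<psi> q = 0)"

text \<open>Pull back a bump function of the model space, centred at the image of \<open>p\<close>. The result extends by
  zero because a compact subset of the domain is closed in the whole Hausdorff space.\<close>

lemma exists_bump:
  assumes c: "c \<in> A" "p \<in> fst c" and Q: "open Q" "p \<in> Q"
  obtains N K \<psi> where "bump N K \<psi>" "p \<in> N" "K \<subseteq> fst c" "K \<subseteq> Q"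
proof -
  let ?a = "snd c p"
  have "open (snd c ` (fst c \<inter> Q))"
    using open_chart_domain[OF c(1)] Q by (intro open_chart_of_open[OF c(1)]) auto
  then obtain R where R: "R > 0" "cball ?a R \<subseteq> snd c ` (fst c \<inter> Q)"
    using c Q open_contains_cball by (metis IntI image_eqI)
  then have cb: "cball ?a R \<subseteq> cimg c" by auto
  obtain B :: "'e \<Rightarrow> real" where B: "smooth_on UNIV B" "\<And>x. 0 \<le> B x"
      "\<And>x. x \<in> cball ?a (R/2) \<Longrightarrow> B x = 1" "\<And>x. x \<notin> ball ?a R \<Longrightarrow> B x = 0"
    using exists_smooth_bump[of "R/2" R ?a] R by auto
  define K where "K = cinv c ` cball ?a R"
  define N where "N = cinv c ` ball ?a (R/2)"
  define \<psi> where "\<psi> = (\<lambda>q. if q \<in> fst c then B (snd c q) else 0)"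
  have K: "compact K" unfolding K_def
    by (intro compact_continuous_image continuous_on_subset[OF continuous_on_cinv[OF c(1)] cb]) auto
  have Kc: "K \<subseteq> fst c" using cb cinv_in_domain[OF c(1)] by (auto simp: K_def)
  have KQ: "K \<subseteq> Q" using R(2) cinv_chart[OF c(1)] by (fastforce simp: K_def)
  have bb: "ball ?a (R/2) \<subseteq> cball ?a R" using R(1) by auto
  have N: "open N" unfolding N_def by (rule open_cinv_of_open[OF c(1)]) (use bb cb in auto)
  have NK: "N \<subseteq> K" using bb by (auto simp: N_def K_def)
  have pN: "p \<in> N" unfolding N_def using R(1) cinv_chart[OF c] by (intro image_eqI[of _ _ ?a]) auto
  have 0: "\<psi> q = 0" if "q \<notin> K" for q
  proof (cases "q \<in> fst c")
    case True
    then have "snd c q \<notin> cball ?a R" using that cinv_chart[OF c(1) True] by (metis K_def image_eqI)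
    then show ?thesis using B(4) True by (auto simp: \<psi>_def)
  qed (simp add: \<psi>_def)
  have 1: "\<psi> q = 1" if q: "q \<in> N" for q
  proof -
    obtain x where x: "x \<in> ball ?a (R/2)" "q = cinv c x" using q unfolding N_def by blast
    then have "x \<in> cimg c" using bb cb by blast
    then have "q \<in> fst c" "snd c q = x" using x chart_cinv[OF c(1)] cinv_in_domain[OF c(1)] by auto
    then show ?thesis using B(3) x by (auto simp: \<psi>_def)
  qed
  have "\<psi> \<in> SF"
  proof (rule smooth_functions_extend_by_0[OF c(1) open_chart_domain[OF c(1)] order_refl compact_imp_closed[OF K] Kc _ 0])
    show "smooth_on (cimg c) ((\<lambda>q. B (snd c q)) \<circ> cinv c)"
      by (rule smooth_on_cong[OF open_chart_image[OF c(1)] smooth_on_subset[OF B(1)]])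
        (auto simp: chart_cinv[OF c(1)])
  qed (simp_all add: \<psi>_def)
  then have "bump N K \<psi>" using K N NK 0 1 B(2) by (auto simp: bump_def \<psi>_def)
  then show thesis using that pN Kc KQ by blast
qed

lemma smooth_functions_bump_mult:
  assumes c: "c \<in> A" and W: "open W" "W \<subseteq> fst c" and \<psi>: "bump N K \<psi>" "K \<subseteq> W"
    and F: "smooth_on (snd c ` W) F"
  shows "(\<lambda>q. if q \<in> fst c then \<psi> q * F (snd c q) else 0) \<in> SF"
proof (rule smooth_functions_extend_by_0[OF c W])
  show "closed K" using \<psi> by (simp add: bump_def compact_imp_closed)
  have "smooth_on (snd c ` W) (\<psi> \<circ> cinv c)"
    using \<psi>(1) W by (intro smooth_on_subset[OF smooth_functions_in_chart[OF c]]) (auto simp: bump_def)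
  then have "smooth_on (snd c ` W) (\<lambda>x. (\<psi> \<circ> cinv c) x * F x)"
    by (intro smooth_on_mult open_chart_of_open[OF c W] F)
  then show "smooth_on (snd c ` W) ((\<lambda>q. \<psi> q * F (snd c q)) \<circ> cinv c)"
    by (rule smooth_on_cong[OF open_chart_of_open[OF c W]]) (use W cinv_chart[OF c] in auto)
qed (use \<psi> W in \<open>auto simp: bump_def\<close>)

lemma tangent_space_nonsmooth: "D \<in> TM p \<Longrightarrow> f \<notin> SF \<Longrightarrow> D f = 0"
  by (simp add: tangent_space_def)

lemma tangent_space_lincomb:
  "D \<in> TM p \<Longrightarrow> f \<in> SF \<Longrightarrow> h \<in> SF
    \<Longrightarrow> D (\<lambda>x. a * f x + b * h x) = a * D f + b * D h"
  by (simp add: tangent_space_def)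

lemma tangent_space_Leibniz:
  "D \<in> TM p \<Longrightarrow> f \<in> SF \<Longrightarrow> h \<in> SF
    \<Longrightarrow> D (\<lambda>x. f x * h x) = f p * D h + h p * D f"
  by (simp add: tangent_space_def)

lemma tangent_space_on_add:
  "D \<in> TM p \<Longrightarrow> f \<in> SF \<Longrightarrow> h \<in> SF
    \<Longrightarrow> D (\<lambda>x. f x + h x) = D f + D h"
  using tangent_space_lincomb[of D p f h 1 1] by simp

lemma tangent_space_on_diff:
  "D \<in> TM p \<Longrightarrow> f \<in> SF \<Longrightarrow> h \<in> SF
    \<Longrightarrow> D (\<lambda>x. f x - h x) = D f - D h"
  using tangent_space_lincomb[of D p f h 1 "-1"] by simp

lemma tangent_space_on_const:
  assumes "D \<in> TM p"
  shows "D (\<lambda>x. a) = 0"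
proof -
  have "D (\<lambda>x. 1 * 1) = 1 * D (\<lambda>x. 1) + 1 * D (\<lambda>x. 1)"
    by (rule tangent_space_Leibniz[OF assms smooth_functions_const smooth_functions_const])
  then have "D (\<lambda>x. 1) = 0" by simp
  then show ?thesis
    using tangent_space_lincomb[OF assms smooth_functions_const[of 1] smooth_functions_const[of 0], of a 0] by simp
qed

lemma tangent_space_on_sum:
  assumes "D \<in> TM p" "finite I" "\<And>i. i \<in> I \<Longrightarrow> f i \<in> SF"
  shows "D (\<lambda>x. \<Sum>i\<in>I. f i x) = (\<Sum>i\<in>I. D (f i))"
  using assms(2,3)
proof (induction I)
  case empty
  then show ?case using tangent_space_on_const[OF assms(1)] by simp
next
  case (insert i I)
  then show ?case
    using tangent_space_on_add[OF assms(1), of "f i" "\<lambda>x. \<Sum>i\<in>I. f i x"] smooth_functions_sum[of I f] by simp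
qed

text \<open>If \<open>f - h\<close> vanishes near \<open>p\<close>, then so does its product with a bump function supported there, and
  the Leibniz rule at \<open>p\<close> leaves only the value on \<open>f - h\<close>.\<close>

lemma tangent_space_local:
  assumes D: "D \<in> TM p" and f: "f \<in> SF" and h: "h \<in> SF"
    and Q: "open Q" "p \<in> Q" "\<And>q. q \<in> Q \<Longrightarrow> f q = h q"
  shows "D f = D h"
proof -
  obtain c where c: "c \<in> A" "p \<in> fst c" using exists_chart .
  obtain N K \<psi> where \<psi>: "bump N K \<psi>" "p \<in> N" "K \<subseteq> Q" using exists_bump[OF c Q(1,2)] .
  have s: "(\<lambda>x. f x - h x) \<in> SF" by (rule smooth_functions_diff[OF f h])
  have "(\<lambda>x. \<psi> x * (f x - h x)) = (\<lambda>x. 0)"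
    using \<psi> Q(3) by (auto simp: bump_def fun_eq_iff)
  then have "0 = \<psi> p * D (\<lambda>x. f x - h x) + (f p - h p) * D \<psi>"
    using tangent_space_Leibniz[OF D _ s, of \<psi>] \<psi>(1) tangent_space_on_const[OF D, of 0] by (simp add: bump_def)
  moreover have "\<psi> p = 1" "f p = h p" using \<psi> Q by (auto simp: bump_def)
  ultimately have "D (\<lambda>x. f x - h x) = 0" by simp
  then show ?thesis using tangent_space_on_diff[OF D f h] by simp
qed

lemma tangent_space_vector_lincomb:
  assumes "u \<in> TM p" "w \<in> TM p"
  shows "(\<lambda>f. a * u f + b * w f) \<in> TM p"
  using assms unfolding tangent_space_def by (auto simp: algebra_simps)

lemma tangent_space_vector_0: "(\<lambda>f. 0) \<in> TM p"
  unfolding tangent_space_def by auto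

lemma tangent_space_vector_sum:
  assumes "\<And>i. i \<in> I \<Longrightarrow> u i \<in> TM p"
  shows "(\<lambda>f. \<Sum>i\<in>I. a i * u i f) \<in> TM p"
  using assms
proof (induction I rule: infinite_finite_induct)
  case (insert i I)
  then show ?case
    using tangent_space_vector_lincomb[of "u i" p "\<lambda>f. \<Sum>i\<in>I. a i * u i f" "a i" 1] by simp
qed (simp_all add: tangent_space_vector_0)

subsection \<open>Coordinate vectors\<close>

definition coord_vec :: "('a, 'e) chart \<Rightarrow> 'e \<Rightarrow> 'a \<Rightarrow> 'a tvec" where
  "coord_vec c i p = (\<lambda>f. if f \<in> SF
     then Df (f \<circ> cinv c) (snd c p) i else 0)"

lemma differentiable_in_chart:
  "c \<in> A \<Longrightarrow> p \<in> fst c \<Longrightarrow> f \<in> SF \<Longrightarrow> (f \<circ> cinv c) differentiable (at (snd c p))"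
  by (rule smooth_on_imp_differentiable[OF smooth_functions_in_chart]) auto

lemma coord_vec_in_tangent_space:
  assumes c: "c \<in> A" "p \<in> fst c"
  shows "coord_vec c i p \<in> TM p"
proof -
  have lin: "coord_vec c i p (\<lambda>x. a * f x + b * h x) = a * coord_vec c i p f + b * coord_vec c i p h"
    if f: "f \<in> SF" and h: "h \<in> SF" for f h a b
  proof -
    note d = differentiable_in_chart[OF c f] differentiable_in_chart[OF c h]
    have "((\<lambda>x. a * (f \<circ> cinv c) x + b * (h \<circ> cinv c) x) has_derivative
      (\<lambda>k. a * Df (f \<circ> cinv c) (snd c p) k + b * Df (h \<circ> cinv c) (snd c p) k)) (at (snd c p))"
      by (intro has_derivative_add has_derivative_mult_right d[unfolded frechet_derivative_works])
    from fun_cong[OF frechet_derivative_at[OF this], of i]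
    show ?thesis using smooth_functions_lincomb[OF f h] f h by (simp add: coord_vec_def o_def)
  qed
  have leib: "coord_vec c i p (\<lambda>x. f x * h x) = f p * coord_vec c i p h + h p * coord_vec c i p f"
    if f: "f \<in> SF" and h: "h \<in> SF" for f h
    using frechet_derivative_mult_real[OF differentiable_in_chart[OF c f] differentiable_in_chart[OF c h], of i]
      smooth_functions_mult[OF f h] f h cinv_chart[OF c]
    by (simp add: coord_vec_def o_def mult.commute)
  show ?thesis
    unfolding tangent_space_def using lin leib by (simp add: coord_vec_def)
qed

definition cut_coord :: "('a \<Rightarrow> real) \<Rightarrow> ('a, 'e) chart \<Rightarrow> 'e \<Rightarrow> 'a \<Rightarrow> real" where
  "cut_coord \<psi> c i = (\<lambda>q. if q \<in> fst c then \<psi> q * (snd c q \<bullet> i) else 0)"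

lemma cut_coord_smooth:
  assumes c: "c \<in> A" and \<psi>: "bump N K \<psi>" "K \<subseteq> fst c"
  shows "cut_coord \<psi> c i \<in> SF"
  unfolding cut_coord_def
  by (rule smooth_functions_bump_mult[OF c open_chart_domain[OF c] order_refl \<psi>])
    (intro smooth_on_inner_Basis open_chart_image[OF c] smooth_on_ident)

text \<open>Near \<open>p\<close> Hadamard's lemma writes \<open>f\<close> as \<open>f p\<close> plus a sum of products of \<open>x\<^sub>i - x\<^sub>i(p)\<close> with smooth
  functions whose values at \<open>p\<close> are the partial derivatives of \<open>f\<close>. After multiplication of the
  factors by bump functions this is an identity between global smooth functions near \<open>p\<close>, to which
  the Leibniz rule applies.\<close>

lemma tangent_vector_in_coordinates:
  assumes c: "c \<in> A" "p \<in> fst c" and \<psi>: "bump N K \<psi>" "K \<subseteq> fst c" "p \<in> N"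
    and D: "D \<in> TM p"
  shows "D = (\<lambda>f. \<Sum>i\<in>Basis. D (cut_coord \<psi> c i) * coord_vec c i p f)"
proof
  fix f
  show "D f = (\<Sum>i\<in>Basis. D (cut_coord \<psi> c i) * coord_vec c i p f)"
  proof (cases "f \<in> SF")
    case False
    then show ?thesis using D by (simp add: tangent_space_nonsmooth coord_vec_def)
  next
    case f: True
    let ?a = "snd c p"
    have N: "open N" using \<psi> by (simp add: bump_def)
    have "open (snd c ` (fst c \<inter> N))"
      using open_chart_domain[OF c(1)] N by (intro open_chart_of_open[OF c(1)]) auto
    then obtain r where r: "r > 0" "ball ?a r \<subseteq> snd c ` (fst c \<inter> N)"
      using c \<psi>(3) open_contains_ball by (metis IntI image_eqI)
    have br: "ball ?a r \<subseteq> cimg c" using r by auto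
    obtain H where Hadamard: "\<forall>i\<in>Basis. smooth_on (ball ?a r) (H i) \<and>
        H i ?a = Df (f \<circ> cinv c) ?a i"
      "\<forall>x\<in>ball ?a r. (f \<circ> cinv c) x = (f \<circ> cinv c) ?a + (\<Sum>i\<in>Basis. (x \<bullet> i - ?a \<bullet> i) * H i x)"
      using Hadamard_lemma[OF smooth_on_subset[OF smooth_functions_in_chart[OF c(1) f] br] r(1)] by blast
    then have H: "\<And>i. i \<in> Basis \<Longrightarrow> smooth_on (ball ?a r) (H i)"
      "\<And>i. i \<in> Basis \<Longrightarrow> H i ?a = Df (f \<circ> cinv c) ?a i"
      "\<And>x. x \<in> ball ?a r \<Longrightarrow> (f \<circ> cinv c) x = (f \<circ> cinv c) ?a + (\<Sum>i\<in>Basis. (x \<bullet> i - ?a \<bullet> i) * H i x)"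
      by blast+
    define W where "W = cinv c ` ball ?a r"
    have W: "open W" "W \<subseteq> fst c" "snd c ` W = ball ?a r"
      using br open_cinv_of_open[OF c(1) open_ball br] cinv_in_domain[OF c(1)] chart_cinv[OF c(1)]
      by (auto simp: W_def image_image subset_iff)
    have WN: "W \<subseteq> N"
    proof
      fix q assume q: "q \<in> W"
      then have "snd c q \<in> snd c ` (fst c \<inter> N)" using W r by blast
      then obtain q' where "q' \<in> fst c \<inter> N" "snd c q = snd c q'" by blast
      moreover have "q \<in> fst c" using q W by blast
      ultimately show "q \<in> N" using inj_on_chart[OF c(1)] by (metis IntD1 IntD2 inj_onD)
    qed
    have pW: "p \<in> W" unfolding W_def using r(1) cinv_chart[OF c] by (intro image_eqI[of _ _ ?a]) auto
    obtain N' K' \<eta> where \<eta>: "bump N' K' \<eta>" "p \<in> N'" "K' \<subseteq> W" using exists_bump[OF c W(1) pW] .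
    have N'W: "N' \<subseteq> W" using \<eta> by (auto simp: bump_def)
    define X where "X = (\<lambda>i q. if q \<in> fst c then \<eta> q * (snd c q \<bullet> i - ?a \<bullet> i) else 0)"
    define Y where "Y = (\<lambda>i q. if q \<in> fst c then \<eta> q * H i (snd c q) else 0)"
    have X: "X i \<in> SF" for i
      unfolding X_def
      by (rule smooth_functions_bump_mult[OF c(1) W(1,2) \<eta>(1,3)])
        (use W in \<open>auto intro!: smooth_on_diff smooth_on_inner_Basis smooth_on_ident smooth_on_const\<close>)
    have Y: "Y i \<in> SF" if "i \<in> Basis" for i
      unfolding Y_def
      by (rule smooth_functions_bump_mult[OF c(1) W(1,2) \<eta>(1,3)]) (use W H(1)[OF that] in auto)
    have XY: "(\<lambda>q. \<Sum>i\<in>Basis. X i q * Y i q) \<in> SF"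
      by (intro smooth_functions_sum smooth_functions_mult X Y)
    have "D f = D (\<lambda>q. f p + (\<Sum>i\<in>Basis. X i q * Y i q))"
    proof (rule tangent_space_local[OF D f])
      fix q assume q: "q \<in> N'"
      then have qW: "q \<in> W" and qc: "\<eta> q = 1" "q \<in> fst c" using N'W W(2) \<eta> by (auto simp: bump_def)
      have "snd c q \<in> ball ?a r" using imageI[OF qW, of "snd c"] W(3) by simp
      with qc have qc: "q \<in> fst c" "snd c q \<in> ball ?a r" "\<eta> q = 1" by auto
      then show "f q = f p + (\<Sum>i\<in>Basis. X i q * Y i q)"
        using H(3)[OF qc(2)] cinv_chart[OF c(1) qc(1)] cinv_chart[OF c] by (simp add: X_def Y_def)
    qed (use \<eta> in \<open>auto simp: bump_def intro!: smooth_functions_add smooth_functions_const XY\<close>)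
    also have "\<dots> = D (\<lambda>q. f p) + D (\<lambda>q. \<Sum>i\<in>Basis. X i q * Y i q)"
      by (rule tangent_space_on_add[OF D smooth_functions_const XY])
    also have "\<dots> = (\<Sum>i\<in>Basis. D (\<lambda>q. X i q * Y i q))"
      using tangent_space_on_sum[OF D finite_Basis, of "\<lambda>i q. X i q * Y i q"] X Y
      by (simp add: tangent_space_on_const[OF D] smooth_functions_mult)
    also have "\<dots> = (\<Sum>i\<in>Basis. D (cut_coord \<psi> c i) * coord_vec c i p f)"
    proof (rule sum.cong[OF refl])
      fix i :: 'e assume i: "i \<in> Basis"
      have "D (X i) = D (\<lambda>q. cut_coord \<psi> c i q - ?a \<bullet> i)"
      proof (rule tangent_space_local[OF D X])
        fix q assume q: "q \<in> N'"
        then have "q \<in> fst c" "\<psi> q = 1" "\<eta> q = 1" using N'W W WN \<eta> \<psi> by (auto simp: bump_def)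
        then show "X i q = cut_coord \<psi> c i q - ?a \<bullet> i" by (simp add: X_def cut_coord_def)
      qed (use \<eta> in \<open>auto simp: bump_def intro!: smooth_functions_diff smooth_functions_const
            cut_coord_smooth[OF c(1) \<psi>(1,2)]\<close>)
      also have "\<dots> = D (cut_coord \<psi> c i)"
        by (simp add: tangent_space_on_diff[OF D cut_coord_smooth[OF c(1) \<psi>(1,2)] smooth_functions_const]
            tangent_space_on_const[OF D])
      finally have DX: "D (X i) = D (cut_coord \<psi> c i)" .
      have "\<eta> p = 1" using \<eta> by (auto simp: bump_def)
      then have "X i p = 0" "Y i p = coord_vec c i p f"
        using c f H(2)[OF i] by (auto simp: X_def Y_def coord_vec_def)
      then show "D (\<lambda>q. X i q * Y i q) = D (cut_coord \<psi> c i) * coord_vec c i p f"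
        using tangent_space_Leibniz[OF D X Y[OF i], of i] DX by simp
    qed
    finally show ?thesis .
  qed
qed

lemma coord_vec_cut_coord:
  assumes c: "c \<in> A" "p \<in> fst c" and \<psi>: "bump N K \<psi>" "K \<subseteq> fst c" "p \<in> N"
  shows "coord_vec c j p (cut_coord \<psi> c i) = j \<bullet> i"
proof -
  have N: "open (snd c ` N)" "N \<subseteq> fst c" using \<psi> by (auto simp: bump_def intro!: open_chart_of_open[OF c(1)])
  have "((\<lambda>x. x \<bullet> i) has_derivative (\<lambda>x. x \<bullet> i)) (at (snd c p))"
    by (rule bounded_linear_imp_has_derivative[OF bounded_linear_inner_left])
  then have "((cut_coord \<psi> c i \<circ> cinv c) has_derivative (\<lambda>x. x \<bullet> i)) (at (snd c p))"
    by (rule has_derivative_transform_within_open[OF _ N(1)])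
      (use \<psi> N(2) cinv_chart[OF c(1)] in \<open>auto simp: cut_coord_def bump_def\<close>)
  from fun_cong[OF frechet_derivative_at[OF this], of j] show ?thesis
    using cut_coord_smooth[OF c(1) \<psi>(1,2)] by (simp add: coord_vec_def)
qed

lemma coord_vec_change_chart:
  assumes c: "c \<in> A" "p \<in> fst c" and d: "d \<in> A" "p \<in> fst d"
  shows "coord_vec c i p = (\<lambda>f. \<Sum>j\<in>Basis.
    (Df (snd d \<circ> cinv c) (snd c p) i \<bullet> j) * coord_vec d j p f)"
proof
  fix f
  show "coord_vec c i p f = (\<Sum>j\<in>Basis.
    (Df (snd d \<circ> cinv c) (snd c p) i \<bullet> j) * coord_vec d j p f)"
  proof (cases "f \<in> SF")
    case f: True
    let ?T = "snd c ` (fst c \<inter> fst d)" and ?\<tau> = "snd d \<circ> cinv c"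
    have T: "open ?T" using open_chart_domain[OF c(1)] open_chart_domain[OF d(1)]
      by (intro open_chart_of_open[OF c(1)]) auto
    have pT: "snd c p \<in> ?T" using c d by auto
    have d\<tau>: "?\<tau> differentiable (at (snd c p))"
      by (rule smooth_on_imp_differentiable[OF transition_smooth[OF c(1) d(1)] pT])
    have \<tau>p: "?\<tau> (snd c p) = snd d p" using cinv_chart[OF c] by simp
    have df: "(f \<circ> cinv d) differentiable (at (?\<tau> (snd c p)))"
      unfolding \<tau>p by (rule differentiable_in_chart[OF d f])
    have "Df (f \<circ> cinv c) (snd c p) = Df (\<lambda>x. (f \<circ> cinv d) (?\<tau> x)) (snd c p)"
      by (rule frechet_derivative_transform_within_open[OF differentiable_in_chart[OF c f] T pT])
        (use cinv_chart[OF c(1)] cinv_chart[OF d(1)] in auto)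
    then have "Df (f \<circ> cinv c) (snd c p) i
        = (\<Sum>j\<in>Basis. (Df ?\<tau> (snd c p) i \<bullet> j) *\<^sub>R Df (f \<circ> cinv d) (?\<tau> (snd c p)) j)"
      using chain_rule_Basis[OF d\<tau> df, of i] by (simp only: real_scaleR_def)
    then show ?thesis using f by (simp add: coord_vec_def \<tau>p[simplified])
  qed (simp add: coord_vec_def)
qed

subsection \<open>Vector fields\<close>

definition local_frame :: "('a \<Rightarrow> real) \<Rightarrow> ('a, 'e) chart \<Rightarrow> 'e \<Rightarrow> 'a vfield" where
  "local_frame \<psi> c i = (\<lambda>q f. if q \<in> fst c then \<psi> q * coord_vec c i q f else 0)"

lemma local_frame_vector_field:
  assumes c: "c \<in> A" and \<psi>: "bump N K \<psi>" "K \<subseteq> fst c" and i: "i \<in> Basis"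
  shows "local_frame \<psi> c i \<in> VF"
proof -
  have "local_frame \<psi> c i p \<in> TM p" for p
  proof (cases "p \<in> fst c")
    case True
    then show ?thesis
      using tangent_space_vector_lincomb[OF coord_vec_in_tangent_space[OF c True] tangent_space_vector_0, of "\<psi> p" i 0]
      by (simp add: local_frame_def)
  qed (simp add: local_frame_def tangent_space_vector_0)
  moreover have "(\<lambda>p. local_frame \<psi> c i p f) \<in> SF" if f: "f \<in> SF" for f
  proof -
    have "(\<lambda>q. if q \<in> fst c then \<psi> q * Df (f \<circ> cinv c) (snd c q) i else 0) \<in> SF"
      by (rule smooth_functions_bump_mult[OF c open_chart_domain[OF c] order_refl \<psi>])
        (rule smooth_on_frechet_derivative[OF smooth_functions_in_chart[OF c f] i])
    moreover have "(\<lambda>p. local_frame \<psi> c i p f)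
        = (\<lambda>q. if q \<in> fst c then \<psi> q * Df (f \<circ> cinv c) (snd c q) i else 0)"
      using f by (auto simp: local_frame_def coord_vec_def fun_eq_iff)
    ultimately show ?thesis by simp
  qed
  ultimately show ?thesis by (simp add: vector_fields_def)
qed

lemma local_frame_eq_coord_vec:
  "bump N K \<psi> \<Longrightarrow> K \<subseteq> fst c \<Longrightarrow> p \<in> N \<Longrightarrow> local_frame \<psi> c i p = coord_vec c i p"
  by (auto simp: local_frame_def bump_def fun_eq_iff)

lemma vector_fields_tangent: "X \<in> VF \<Longrightarrow> X p \<in> TM p"
  by (simp add: vector_fields_def)

lemma vector_fields_smooth:
  "X \<in> VF \<Longrightarrow> f \<in> SF \<Longrightarrow> (\<lambda>p. X p f) \<in> SF"
  by (simp add: vector_fields_def)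

lemma vector_fields_0: "(\<lambda>p f. 0) \<in> VF"
  by (simp add: vector_fields_def tangent_space_vector_0 smooth_functions_const)

lemma vector_fields_lincomb:
  "X \<in> VF \<Longrightarrow> Y \<in> VF \<Longrightarrow> (\<lambda>p f. a * X p f + b * Y p f) \<in> VF"
  by (auto simp: vector_fields_def intro!: tangent_space_vector_lincomb smooth_functions_lincomb)

lemma vector_fields_sum:
  "(\<And>i. i \<in> I \<Longrightarrow> X i \<in> VF) \<Longrightarrow> (\<lambda>p f. \<Sum>i\<in>I. a i * X i p f) \<in> VF"
proof (induction I rule: infinite_finite_induct)
  case (insert i I)
  then show ?case
    using vector_fields_lincomb[of "X i" "\<lambda>p f. \<Sum>i\<in>I. a i * X i p f" "a i" 1] by simp
qed (simp_all add: vector_fields_0)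

lemma exists_vector_field_extension:
  assumes "u \<in> TM p"
  obtains X where "X \<in> VF" "X p = u"
proof -
  obtain c where c: "c \<in> A" "p \<in> fst c" using exists_chart .
  obtain N K \<psi> where \<psi>: "bump N K \<psi>" "p \<in> N" "K \<subseteq> fst c" using exists_bump[OF c open_UNIV UNIV_I] by metis
  let ?X = "\<lambda>q f. \<Sum>i\<in>Basis. u (cut_coord \<psi> c i) * local_frame \<psi> c i q f"
  have "?X \<in> VF" by (intro vector_fields_sum local_frame_vector_field[OF c(1) \<psi>(1,3)])
  moreover have "?X p = u"
    using tangent_vector_in_coordinates[OF c \<psi>(1,3,2) assms] local_frame_eq_coord_vec[OF \<psi>(1,3,2)]
    by simp
  ultimately show thesis using that by blast
qed

text \<open>Where the cut-off function is \<open>1\<close> the bracket is the commutator of two partial derivatives.\<close>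

lemma lie_bracket_local_frames:
  assumes c: "c \<in> A" "p \<in> fst c" and \<psi>: "bump N K \<psi>" "K \<subseteq> fst c" "p \<in> N" and i: "i \<in> Basis" and j: "j \<in> Basis"
  shows "lie_bracket (local_frame \<psi> c i) (local_frame \<psi> c j) p = (\<lambda>f. 0)"
proof
  fix f
  have N: "open N" "N \<subseteq> fst c" using \<psi> by (auto simp: bump_def)
  show "lie_bracket (local_frame \<psi> c i) (local_frame \<psi> c j) p f = 0"
  proof (cases "f \<in> SF")
    case False
    then have "(\<lambda>q. local_frame \<psi> c k q f) = (\<lambda>q. 0)" for k by (simp add: local_frame_def coord_vec_def fun_eq_iff)
    moreover have "local_frame \<psi> c k p (\<lambda>q. 0) = 0" if "k \<in> Basis" for k
      using tangent_space_on_const[OF vector_fields_tangent[OF local_frame_vector_field[OF c(1) \<psi>(1,2) that]]] .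
    ultimately show ?thesis using i j by (simp add: lie_bracket_def)
  next
    case f: True
    let ?F = "f \<circ> cinv c"
    note F = smooth_functions_in_chart[OF c(1) f]
    have *: "local_frame \<psi> c k p (\<lambda>q. local_frame \<psi> c l q f)
        = Df (\<lambda>y. Df ?F y l) (snd c p) k"
      if k: "k \<in> Basis" and l: "l \<in> Basis" for k l
    proof -
      have s: "(\<lambda>q. local_frame \<psi> c l q f) \<in> SF"
        by (rule vector_fields_smooth[OF local_frame_vector_field[OF c(1) \<psi>(1,2) l] f])
      have "local_frame \<psi> c k p (\<lambda>q. local_frame \<psi> c l q f)
          = Df ((\<lambda>q. local_frame \<psi> c l q f) \<circ> cinv c) (snd c p) k"
        using s by (simp add: local_frame_eq_coord_vec[OF \<psi>] coord_vec_def)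
      also have "Df ((\<lambda>q. local_frame \<psi> c l q f) \<circ> cinv c) (snd c p)
          = Df (\<lambda>y. Df ?F y l) (snd c p)"
        by (rule frechet_derivative_transform_within_open[OF differentiable_in_chart[OF c s]
              open_chart_of_open[OF c(1) N]])
          (use \<psi> N(2) f cinv_chart[OF c(1)] in \<open>auto simp: local_frame_def coord_vec_def bump_def\<close>)
      finally show ?thesis .
    qed
    show ?thesis unfolding lie_bracket_def
      using mixed_partial_derivatives_commute[OF open_chart_image[OF c(1)] F i j] c
      by (simp add: *[OF i j] *[OF j i])
  qed
qed

end

section \<open>Skew forms and complex orientation in dimension four\<close>

lemma det_4:
  fixes A :: "'a::comm_ring_1^4^4"
  shows "det A =
     A$1$1 * A$2$2 * A$3$3 * A$4$4 + A$1$1 * A$2$3 * A$3$4 * A$4$2 + A$1$1 * A$2$4 * A$3$2 *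
     A$4$3 + A$1$2 * A$2$1 * A$3$4 * A$4$3 + A$1$2 * A$2$3 * A$3$1 * A$4$4 + A$1$2 * A$2$4 *
     A$3$3 * A$4$1 + A$1$3 * A$2$1 * A$3$2 * A$4$4 + A$1$3 * A$2$2 * A$3$4 * A$4$1 + A$1$3 *
     A$2$4 * A$3$1 * A$4$2 + A$1$4 * A$2$1 * A$3$3 * A$4$2 + A$1$4 * A$2$2 * A$3$1 * A$4$3 +
     A$1$4 * A$2$3 * A$3$2 * A$4$1 - A$1$1 * A$2$2 * A$3$4 * A$4$3 - A$1$1 * A$2$3 * A$3$2 *
     A$4$4 - A$1$1 * A$2$4 * A$3$3 * A$4$2 - A$1$2 * A$2$1 * A$3$3 * A$4$4 - A$1$2 * A$2$3 *
     A$3$4 * A$4$1 - A$1$2 * A$2$4 * A$3$1 * A$4$3 - A$1$3 * A$2$1 * A$3$4 * A$4$2 - A$1$3 *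
     A$2$2 * A$3$1 * A$4$4 - A$1$3 * A$2$4 * A$3$2 * A$4$1 - A$1$4 * A$2$1 * A$3$2 * A$4$3 -
     A$1$4 * A$2$2 * A$3$3 * A$4$1 - A$1$4 * A$2$3 * A$3$1 * A$4$2"
proof -
  have f1: "finite {2::4, 3, 4}" "1 \<notin> {2::4, 3, 4}" by auto
  have f2: "finite {3::4, 4}" "2 \<notin> {3::4, 4}" by auto
  have f3: "finite {4::4}" "3 \<notin> {4::4}" by auto
  show ?thesis
    unfolding det_def UNIV_4
    unfolding sum_over_permutations_insert[OF f1]
    unfolding sum_over_permutations_insert[OF f2]
    unfolding sum_over_permutations_insert[OF f3]
    unfolding permutes_sing
    by (simp add: sign_swap_id permutation_swap_id permutation_compose sign_compose sign_id swap_id_eq)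
qed

definition pfaffian :: "real^4^4 \<Rightarrow> real" where
  "pfaffian a = a$1$2 * a$3$4 - a$1$3 * a$2$4 + a$1$4 * a$2$3"

text \<open>Both sides are quadratic in the six components of \<open>a\<close>. The coefficients on the left are quadratic
  expressions in the two-by-two minors of \<open>M\<close>: those of monomials that share an index are Pluecker-type
  relations and vanish, the three others are Laplace expansions of the determinant.\<close>

lemma pfaffian_congruence:
  assumes skew: "\<And>i j. a$j$i = - a$i$j"
  shows "pfaffian (M ** a ** transpose M) = det M * pfaffian a"
proof -
  have diag: "a$i$i = 0" for i using skew[of i i] by simp
  note s = skew[of 2 1] skew[of 3 1] skew[of 4 1] skew[of 3 2] skew[of 4 2] skew[of 4 3]
  define m where "m = (\<lambda>k l i j. M$k$i * M$l$j - M$k$j * M$l$i)"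
  have e: "(M ** a ** transpose M)$k$l = a$1$2 * m k l 1 2 + a$1$3 * m k l 1 3 + a$1$4 * m k l 1 4
      + a$2$3 * m k l 2 3 + a$2$4 * m k l 2 4 + a$3$4 * m k l 3 4" for k l
    by (simp add: matrix_matrix_mult_def transpose_def sum_4 diag s m_def algebra_simps)
  \<comment> \<open>\<open>C i j i' j'\<close> is the coefficient of the product of the components \<open>(i, j)\<close> and \<open>(i', j')\<close> of \<open>a\<close>,
    counted twice when the two pairs coincide.\<close>
  define C where "C = (\<lambda>i j i' j'. m 1 2 i j * m 3 4 i' j' + m 1 2 i' j' * m 3 4 i j
    - m 1 3 i j * m 2 4 i' j' - m 1 3 i' j' * m 2 4 i j + m 1 4 i j * m 2 3 i' j' + m 1 4 i' j' * m 2 3 i j)"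
  have C: "C i j i k = 0" "C i k j k = 0" "C i j j k = 0" for i j k
    unfolding C_def m_def by algebra+
  have Cdet: "C 1 2 3 4 = det M" "C 1 3 2 4 = - det M" "C 1 4 2 3 = det M"
    unfolding C_def m_def det_4 by algebra+
  have "pfaffian (M ** a ** transpose M) =
      a$1$2 * a$1$2 * C 1 2 1 2 / 2
      + a$1$2 * a$1$3 * C 1 2 1 3
      + a$1$2 * a$1$4 * C 1 2 1 4
      + a$1$2 * a$2$3 * C 1 2 2 3
      + a$1$2 * a$2$4 * C 1 2 2 4
      + a$1$2 * a$3$4 * C 1 2 3 4
      + a$1$3 * a$1$3 * C 1 3 1 3 / 2
      + a$1$3 * a$1$4 * C 1 3 1 4
      + a$1$3 * a$2$3 * C 1 3 2 3
      + a$1$3 * a$2$4 * C 1 3 2 4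
      + a$1$3 * a$3$4 * C 1 3 3 4
      + a$1$4 * a$1$4 * C 1 4 1 4 / 2
      + a$1$4 * a$2$3 * C 1 4 2 3
      + a$1$4 * a$2$4 * C 1 4 2 4
      + a$1$4 * a$3$4 * C 1 4 3 4
      + a$2$3 * a$2$3 * C 2 3 2 3 / 2
      + a$2$3 * a$2$4 * C 2 3 2 4
      + a$2$3 * a$3$4 * C 2 3 3 4
      + a$2$4 * a$2$4 * C 2 4 2 4 / 2
      + a$2$4 * a$3$4 * C 2 4 3 4
      + a$3$4 * a$3$4 * C 3 4 3 4 / 2"
    unfolding pfaffian_def e C_def by (simp add: field_simps)
  also have "\<dots> = det M * pfaffian a"
    by (simp add: C Cdet pfaffian_def algebra_simps)
  finally show ?thesis .
qed

lemma matrix_eq_4: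
  fixes A B :: "real^4^4"
  shows "A = B \<longleftrightarrow> (\<forall>i j. A$i$j = B$i$j)"
  by (simp add: vec_eq_iff)

text \<open>The action of \<open>J\<close> on a frame \<open>u, Ju, w, Jw\<close>. As everywhere below, the rows of a matrix that
  represents a frame or an endomorphism are the components of the vectors or of the images of the
  basis vectors.\<close>

definition std_complex :: "real^4^4" where
  "std_complex = (\<chi> i j. if i = 1 \<and> j = 2 \<or> i = 3 \<and> j = 4 then 1
     else if i = 2 \<and> j = 1 \<or> i = 4 \<and> j = 3 then - 1 else 0)"

definition complex_frame :: "real^4^4 \<Rightarrow> real^4^4 \<Rightarrow> bool" where
  "complex_frame Jm P \<longleftrightarrow> P ** Jm = std_complex ** P"

text \<open>A matrix commuting with the standard complex structure is a complex two-by-two matrix, and its real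
  determinant is the squared modulus of the complex one.\<close>

lemma det_commuting_std_complex_nonneg:
  assumes "R ** std_complex = std_complex ** R"
  shows "det R \<ge> 0"
proof -
  have e: "(R ** std_complex)$i$j = (std_complex ** R)$i$j" for i j using assms by simp
  have r2: "R$2$1 = - R$1$2" "R$2$2 = R$1$1" "R$2$3 = - R$1$4" "R$2$4 = R$1$3"
    and r4: "R$4$1 = - R$3$2" "R$4$2 = R$3$1" "R$4$3 = - R$3$4" "R$4$4 = R$3$3"
    using e[of 1 1] e[of 1 2] e[of 1 3] e[of 1 4] e[of 3 1] e[of 3 2] e[of 3 3] e[of 3 4]
    by (simp_all add: matrix_matrix_mult_def sum_4 std_complex_def)
  have "det R = (R$1$1 * R$3$3 - R$1$2 * R$3$4 - R$1$3 * R$3$1 + R$1$4 * R$3$2)\<^sup>2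
      + (R$1$1 * R$3$4 + R$1$2 * R$3$3 - R$1$3 * R$3$2 - R$1$4 * R$3$1)\<^sup>2"
    unfolding det_4 r2 r4 by algebra
  then show ?thesis by simp
qed

lemma complex_frames_same_orientation:
  assumes "complex_frame Jm P" "complex_frame Jm P'" "det P \<noteq> 0"
  shows "det P * det P' \<ge> 0"
proof -
  obtain Q where Q: "P ** Q = mat 1" "Q ** P = mat 1"
    using assms(3) unfolding invertible_det_nz[symmetric] invertible_def by blast
  \<comment> \<open>The change between two complex frames is complex linear.\<close>
  define R where "R = P' ** Q"
  have P': "P' = R ** P" by (simp add: R_def matrix_mul_assoc[symmetric] Q)
  have Jm: "Jm = Q ** std_complex ** P"
  proof -
    have "Q ** (P ** Jm) = Q ** (std_complex ** P)" using assms(1) by (simp add: complex_frame_def)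
    then show ?thesis by (simp add: matrix_mul_assoc Q)
  qed
  have "R ** std_complex = R ** std_complex ** P ** Q" by (simp add: matrix_mul_assoc[symmetric] Q)
  also have "\<dots> = P' ** Jm ** Q" by (simp add: R_def Jm matrix_mul_assoc)
  also have "\<dots> = std_complex ** R" using assms(2) by (simp add: complex_frame_def R_def matrix_mul_assoc)
  finally have "det R \<ge> 0" by (rule det_commuting_std_complex_nonneg)
  moreover have "det P * det P' = det R * (det P)\<^sup>2" by (simp add: P' det_mul power2_eq_square)
  ultimately show ?thesis by simp
qed

definition rows_frame :: "real^4^4 \<Rightarrow> real^4 \<Rightarrow> real^4 \<Rightarrow> real^4^4" where
  "rows_frame Jm u w = (\<chi> i. if i = 1 then u else if i = 2 then u v* Jm else if i = 3 then w else w v* Jm)"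

lemma row_matrix_mult: "(P ** B)$i = P$i v* (B :: real^4^4)" for P :: "real^4^4"
  by (simp add: matrix_matrix_mult_def vector_matrix_mult_def vec_eq_iff mult.commute)

lemma std_complex_mult_rows:
  "(std_complex ** P)$1 = P$2" "(std_complex ** P)$2 = - P$1"
  "(std_complex ** P)$3 = P$4" "(std_complex ** P)$4 = - P$3"
  by (simp_all add: vec_eq_iff matrix_matrix_mult_def sum_4 std_complex_def)

lemma vector_matrix_mult_uminus_mat: "x v* (- mat 1) = - (x :: real^4)"
  by (simp add: vec_eq_iff forall_4 vector_matrix_mult_def sum_4 mat_def)

lemma complex_frame_rows_frame:
  assumes "Jm ** Jm = - mat 1"
  shows "complex_frame Jm (rows_frame Jm u w)"
proof -
  have J2: "(x v* Jm) v* Jm = - x" for x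
    unfolding vector_matrix_mul_assoc assms by (rule vector_matrix_mult_uminus_mat)
  have r: "rows_frame Jm u w$1 = u" "rows_frame Jm u w$2 = u v* Jm" "rows_frame Jm u w$3 = w"
    "rows_frame Jm u w$4 = w v* Jm"
    by (simp_all add: rows_frame_def)
  have "\<forall>i. (rows_frame Jm u w ** Jm)$i = (std_complex ** rows_frame Jm u w)$i"
    unfolding forall_4 std_complex_mult_rows unfolding row_matrix_mult r J2 by (intro conjI refl)
  then show ?thesis unfolding complex_frame_def vec_eq_iff[of "_ ** Jm"] .
qed

text \<open>Take any \<open>u \<noteq> 0\<close> and any \<open>w\<close> outside the span of \<open>u\<close> and \<open>Ju\<close>. This span is \<open>J\<close>-invariant, so
  it contains no nonzero combination of \<open>w\<close> and \<open>Jw\<close>.\<close>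

lemma exists_complex_frame:
  assumes J: "Jm ** Jm = - mat 1"
  obtains u w where "det (rows_frame Jm u w) \<noteq> 0"
proof -
  define f where "f = (\<lambda>x. x v* Jm)"
  have f2: "f (f x) = - x" for x
    unfolding f_def vector_matrix_mul_assoc J by (rule vector_matrix_mult_uminus_mat)
  have flin: "f (a *\<^sub>R x + b *\<^sub>R y) = a *\<^sub>R f x + b *\<^sub>R f y" for a b x y
    by (simp add: f_def vector_matrix_mult_def vec_eq_iff sum.distrib sum_distrib_left algebra_simps)
  define u :: "real^4" where "u = axis 1 1"
  have u0: "u \<noteq> 0" by (simp add: u_def axis_eq_0_iff)
  have "span {u, f u} \<noteq> UNIV"
  proof
    assume "span {u, f u} = UNIV"
    then have "dim {u, f u} = dim (UNIV :: (real^4) set)" by (metis dim_span)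
    moreover have "dim {u, f u} \<le> card {u, f u}" by (rule dim_le_card') simp
    moreover have "card {u, f u} \<le> 2" by (simp add: card_insert_if)
    ultimately show False by simp
  qed
  then obtain w where w: "w \<notin> span {u, f u}" by blast
  have zero: "a = 0 \<and> b = 0" if "(a\<^sup>2 + b\<^sup>2) *\<^sub>R x = 0" "x \<noteq> 0" for a b :: real and x :: "real^4"
    using that by (simp add: sum_power2_eq_zero_iff)
  have ind: "c1 = 0 \<and> c2 = 0 \<and> c3 = 0 \<and> c4 = 0"
    if c: "c1 *\<^sub>R u + c2 *\<^sub>R f u + c3 *\<^sub>R w + c4 *\<^sub>R f w = 0" for c1 c2 c3 c4
  proof -
    have y: "c3 *\<^sub>R w + c4 *\<^sub>R f w = (- c1) *\<^sub>R u + (- c2) *\<^sub>R f u"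
    proof -
      have "c3 *\<^sub>R w + c4 *\<^sub>R f w = (c1 *\<^sub>R u + c2 *\<^sub>R f u + c3 *\<^sub>R w + c4 *\<^sub>R f w) - (c1 *\<^sub>R u + c2 *\<^sub>R f u)"
        by simp
      then show ?thesis unfolding c by simp
    qed
    have "f (c3 *\<^sub>R w + c4 *\<^sub>R f w) = f ((- c1) *\<^sub>R u + (- c2) *\<^sub>R f u)" using y by simp
    then have fy: "c3 *\<^sub>R f w - c4 *\<^sub>R w = (- c1) *\<^sub>R f u + c2 *\<^sub>R u" unfolding flin f2 by simp
    have "(c3\<^sup>2 + c4\<^sup>2) *\<^sub>R w = c3 *\<^sub>R (c3 *\<^sub>R w + c4 *\<^sub>R f w) - c4 *\<^sub>R (c3 *\<^sub>R f w - c4 *\<^sub>R w)"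
      by (simp add: algebra_simps power2_eq_square)
    also have "\<dots> \<in> span {u, f u}" unfolding y fy
      by (intro span_diff span_scale span_add) (auto intro: span_base)
    finally have in_span: "(c3\<^sup>2 + c4\<^sup>2) *\<^sub>R w \<in> span {u, f u}" .
    have "c3\<^sup>2 + c4\<^sup>2 = 0"
    proof (rule ccontr)
      assume "c3\<^sup>2 + c4\<^sup>2 \<noteq> 0"
      then have "w = inverse (c3\<^sup>2 + c4\<^sup>2) *\<^sub>R ((c3\<^sup>2 + c4\<^sup>2) *\<^sub>R w)" by simp
      then show False using w span_scale[OF in_span] by metis
    qed
    then have c34: "c3 = 0" "c4 = 0" by (simp_all add: sum_power2_eq_zero_iff)
    then have z: "c1 *\<^sub>R u + c2 *\<^sub>R f u = 0" using c by simp
    then have "f (c1 *\<^sub>R u + c2 *\<^sub>R f u) = f (0 *\<^sub>R u + 0 *\<^sub>R u)" by simp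
    then have fz: "c1 *\<^sub>R f u - c2 *\<^sub>R u = 0" unfolding flin f2 by simp
    have "(c1\<^sup>2 + c2\<^sup>2) *\<^sub>R u = c1 *\<^sub>R (c1 *\<^sub>R u + c2 *\<^sub>R f u) - c2 *\<^sub>R (c1 *\<^sub>R f u - c2 *\<^sub>R u)"
      by (simp add: algebra_simps power2_eq_square)
    also have "\<dots> = 0" unfolding z fz by simp
    finally show ?thesis using zero[OF _ u0] c34 by blast
  qed
  have "\<exists>B. rows_frame Jm u w ** B = mat 1"
    unfolding matrix_right_invertible_independent_rows
  proof (intro allI impI)
    fix c :: "4 \<Rightarrow> real" and i
    assume "(\<Sum>i\<in>UNIV. c i *s row i (rows_frame Jm u w)) = 0"
    moreover have "row 1 (rows_frame Jm u w) = u" "row 2 (rows_frame Jm u w) = f u"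
      "row 3 (rows_frame Jm u w) = w" "row 4 (rows_frame Jm u w) = f w"
      by (simp_all add: row_def rows_frame_def f_def vec_eq_iff)
    ultimately have "c 1 *\<^sub>R u + c 2 *\<^sub>R f u + c 3 *\<^sub>R w + c 4 *\<^sub>R f w = 0"
      unfolding sum_4 scalar_mult_eq_scaleR by simp
    from ind[OF this] show "c i = 0" using exhaust_4[of i] by auto
  qed
  then have "det (rows_frame Jm u w) \<noteq> 0"
    unfolding invertible_det_nz[symmetric] invertible_right_inverse .
  then show thesis by (rule that)
qed

lemma matrix_mult_uminus:
  fixes A B :: "real^4^4"
  shows "A ** (- B) = - (A ** B)" "(- A) ** B = - (A ** B)"
  by (simp_all add: vec_eq_iff matrix_matrix_mult_def sum_negf)

text \<open>In a frame \<open>u, Ju, w, Jw\<close> the anti-invariance leaves only \<open>b = a(u, w) = -a(Ju, Jw)\<close> and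
  \<open>c = a(u, Jw) = a(Ju, w)\<close>, and the Pfaffian of the matrix of \<open>a\<close> in this frame is \<open>b\<^sup>2 + c\<^sup>2\<close>.\<close>

lemma pfaffian_complex_frame:
  assumes J: "complex_frame Jm P" and skew: "\<And>i j. a$j$i = - a$i$j"
    and anti: "Jm ** a ** transpose Jm = - a"
  shows "\<exists>b c. det P * pfaffian a = b\<^sup>2 + c\<^sup>2 \<and> (det P \<noteq> 0 \<longrightarrow> b = 0 \<longrightarrow> c = 0 \<longrightarrow> a = 0)"
proof -
  define B where "B = P ** a ** transpose P"
  have "transpose a $ i $ j = (- a) $ i $ j" for i j
    unfolding transpose_def vec_lambda_beta vector_uminus_component by (rule skew)
  then have skewt: "transpose a = - a" unfolding matrix_eq_4 by blast
  have Bs: "B$j$i = - B$i$j" for i j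
  proof -
    have "transpose B = P ** (- a) ** transpose P"
      unfolding B_def matrix_transpose_mul transpose_transpose skewt matrix_mul_assoc ..
    also have "\<dots> = - B" unfolding B_def matrix_mult_uminus ..
    finally have "transpose B $ i $ j = (- B) $ i $ j" by simp
    then show ?thesis by (simp add: transpose_def)
  qed
  have "std_complex ** B ** transpose std_complex = (std_complex ** P) ** a ** transpose (std_complex ** P)"
    by (simp add: B_def matrix_transpose_mul matrix_mul_assoc)
  also have "\<dots> = P ** (Jm ** a ** transpose Jm) ** transpose P"
    unfolding J[unfolded complex_frame_def, symmetric] matrix_transpose_mul by (simp only: matrix_mul_assoc)
  also have "\<dots> = - B"
    unfolding anti B_def matrix_mult_uminus ..
  finally have e: "(std_complex ** B ** transpose std_complex)$i$j = - B$i$j" for i j by simp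
  have B: "B$2$4 = - B$1$3" "B$2$3 = B$1$4" "B$1$2 = 0" "B$3$4 = 0"
    using e[of 1 3] e[of 1 4] e[of 1 2] e[of 3 4] Bs[of 1 2] Bs[of 3 4]
    by (simp_all add: matrix_matrix_mult_def transpose_def sum_4 std_complex_def)
  have B0: "B = 0" if "B$1$3 = 0" "B$1$4 = 0"
    unfolding matrix_eq_4 forall_4
    using that B Bs[of 1 1] Bs[of 2 2] Bs[of 3 3] Bs[of 4 4] Bs[of 1 2] Bs[of 1 3] Bs[of 1 4] Bs[of 2 3] Bs[of 2 4] Bs[of 3 4]
    by simp
  show ?thesis
  proof (intro exI conjI impI)
    have "pfaffian B = det P * pfaffian a" unfolding B_def by (rule pfaffian_congruence[OF skew])
    then show "det P * pfaffian a = (B$1$3)\<^sup>2 + (B$1$4)\<^sup>2"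
      by (simp add: pfaffian_def B power2_eq_square)
  next
    assume "det P \<noteq> 0" "B$1$3 = 0" "B$1$4 = 0"
    then obtain Q where Q: "P ** Q = mat 1" "Q ** P = mat 1"
      unfolding invertible_det_nz[symmetric] invertible_def by blast
    have "transpose P ** transpose Q = mat 1"
      by (metis Q(2) matrix_transpose_mul transpose_mat)
    then have "a = (Q ** P) ** a ** (transpose P ** transpose Q)" by (simp add: Q)
    also have "\<dots> = Q ** B ** transpose Q" by (simp add: B_def matrix_mul_assoc)
    also have "\<dots> = 0" using B0[OF \<open>B$1$3 = 0\<close> \<open>B$1$4 = 0\<close>]
      by (simp add: matrix_eq_4 matrix_matrix_mult_def)
    finally show "a = 0" .
  qed
qed

text \<open>The sign of the given basis with respect to the orientation by frames \<open>u, Ju, w, Jw\<close>, where \<open>Jm\<close>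
  is the matrix of \<open>J\<close> in the given basis.\<close>

definition complex_orientation :: "real^4^4 \<Rightarrow> real" where
  "complex_orientation Jm = sgn (det (SOME P. complex_frame Jm P \<and> det P \<noteq> 0))"

lemma complex_orientation_eq:
  assumes "complex_frame Jm P" "det P \<noteq> 0"
  shows "complex_orientation Jm = sgn (det P)"
proof -
  let ?Q = "SOME P. complex_frame Jm P \<and> det P \<noteq> 0"
  have Q: "complex_frame Jm ?Q \<and> det ?Q \<noteq> 0" by (rule someI) (use assms in auto)
  have "det P * det ?Q \<ge> 0" using complex_frames_same_orientation assms Q by blast
  then show ?thesis
    using Q assms(2) by (auto simp: complex_orientation_def sgn_if zero_le_mult_iff)
qed

lemma complex_orientation_pfaffian:
  assumes J: "Jm ** Jm = - mat 1" and skew: "\<And>i j. a$j$i = - a$i$j"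
    and anti: "Jm ** a ** transpose Jm = - a"
  shows complex_orientation_pfaffian_nonneg: "complex_orientation Jm * pfaffian a \<ge> 0"
    and complex_orientation_pfaffian_eq_0: "complex_orientation Jm * pfaffian a = 0 \<Longrightarrow> a = 0"
proof -
  obtain u w where d: "det (rows_frame Jm u w) \<noteq> 0" using exists_complex_frame[OF J] .
  define P where "P = rows_frame Jm u w"
  have P: "complex_frame Jm P" "det P \<noteq> 0" using d complex_frame_rows_frame[OF J] by (auto simp: P_def)
  obtain b c where bc: "det P * pfaffian a = b\<^sup>2 + c\<^sup>2" "b = 0 \<longrightarrow> c = 0 \<longrightarrow> a = 0"
    using pfaffian_complex_frame[OF P(1) skew anti] P(2) by blast
  have "complex_orientation Jm * pfaffian a = (b\<^sup>2 + c\<^sup>2) / \<bar>det P\<bar>"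
    unfolding bc(1)[symmetric] complex_orientation_eq[OF P] using P(2) by (simp add: sgn_if)
  then show "complex_orientation Jm * pfaffian a \<ge> 0"
    and "complex_orientation Jm * pfaffian a = 0 \<Longrightarrow> a = 0"
    using P(2) bc(2) by (auto simp: sum_power2_eq_zero_iff)
qed

lemma complex_orientation_change_frame:
  assumes J: "Jm ** Jm = - mat 1" and T: "Jm ** T = T ** Jm'" "det T \<noteq> 0"
  shows "complex_orientation Jm' = sgn (det T) * complex_orientation Jm"
proof -
  obtain u w where d: "det (rows_frame Jm u w) \<noteq> 0" using exists_complex_frame[OF J] .
  define P where "P = rows_frame Jm u w"
  have P: "complex_frame Jm P" "det P \<noteq> 0" using d complex_frame_rows_frame[OF J] by (auto simp: P_def)
  have "complex_frame Jm' (P ** T)"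
    using P(1) T(1) unfolding complex_frame_def by (metis matrix_mul_assoc)
  then have "complex_orientation Jm' = sgn (det (P ** T))"
    using P T by (intro complex_orientation_eq) (simp_all add: det_mul)
  then show ?thesis using complex_orientation_eq[OF P] by (simp add: det_mul sgn_mult mult.commute)
qed

text \<open>Keep \<open>u\<close> and \<open>w\<close> fixed: then the determinant of \<open>u, Ju, w, Jw\<close> depends continuously on \<open>J\<close>.\<close>

lemma complex_orientation_locally_constant:
  fixes Jm :: "'x::t2_space \<Rightarrow> real^4^4"
  assumes "open S" "x \<in> S" and cont: "\<And>i j. continuous_on S (\<lambda>y. Jm y $ i $ j)"
    and J: "\<And>y. y \<in> S \<Longrightarrow> Jm y ** Jm y = - mat 1"
  obtains T where "open T" "x \<in> T" "T \<subseteq> S"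
    "\<And>y. y \<in> T \<Longrightarrow> complex_orientation (Jm y) = complex_orientation (Jm x)"
proof -
  obtain u w where d: "det (rows_frame (Jm x) u w) \<noteq> 0" using exists_complex_frame[OF J[OF assms(2)]] .
  define h where "h = (\<lambda>y. det (rows_frame (Jm y) u w))"
  have v: "continuous_on S (\<lambda>y. (z v* Jm y) $ j)" for z j
    unfolding vector_matrix_mult_def vec_lambda_beta by (intro continuous_intros cont)
  have "continuous_on S (\<lambda>y. rows_frame (Jm y) u w $ i $ j)" for i j
    using exhaust_4[of i] v[of u j] v[of w j] by (auto simp: rows_frame_def)
  then have "continuous_on S h"
    unfolding h_def det_4 by (intro continuous_on_add continuous_on_diff continuous_on_mult)
  then have c: "isCont h x" using assms(1,2) continuous_on_eq_continuous_at by blast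
  define s where "s = sgn (h x)"
  have "isCont (\<lambda>y. s * h y) x" using c by (intro continuous_intros)
  then have "((\<lambda>y. s * h y) \<longlongrightarrow> s * h x) (nhds x)"
    using tendsto_at_iff_tendsto_nhds[of "\<lambda>y. s * h y" x] by (simp add: isCont_def)
  moreover have "s * h x > 0" using d by (simp add: s_def h_def sgn_if)
  ultimately have "\<forall>\<^sub>F y in nhds x. 0 < s * h y"
    by (rule order_tendstoD(1))
  then obtain U where U: "open U" "x \<in> U" "\<And>y. y \<in> U \<Longrightarrow> 0 < s * h y"
    unfolding eventually_nhds by blast
  show thesis
  proof (rule that[of "S \<inter> U"])
    fix y assume y: "y \<in> S \<inter> U"
    have "h y \<noteq> 0" "sgn (h y) = s" using U(3)[of y] y by (auto simp: s_def sgn_if split: if_splits)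
    then show "complex_orientation (Jm y) = complex_orientation (Jm x)"
      using complex_orientation_eq[OF complex_frame_rows_frame[OF J]] y assms(2) d
      by (simp add: h_def s_def)
  qed (use U assms in auto)
qed

section \<open>Stokes' theorem for the wedge of two exact two-forms\<close>

abbreviation pd :: "4 \<Rightarrow> (real^4 \<Rightarrow> real) \<Rightarrow> real^4 \<Rightarrow> real" where
  "pd k f x \<equiv> Df f x (axis k 1)"

definition ext_deriv :: "(4 \<Rightarrow> real^4 \<Rightarrow> real) \<Rightarrow> real^4 \<Rightarrow> real^4^4" where
  "ext_deriv \<beta> x = (\<chi> k l. pd k (\<beta> l) x - pd l (\<beta> k) x)"

text \<open>The coefficient of \<open>m \<and> a\<close>, which is the polarization of the Pfaffian.\<close>

definition wedge :: "real^4^4 \<Rightarrow> real^4^4 \<Rightarrow> real" where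
  "wedge m a = m$1$2 * a$3$4 - m$1$3 * a$2$4 + m$1$4 * a$2$3 + m$3$4 * a$1$2 - m$2$4 * a$1$3 + m$2$3 * a$1$4"

lemma wedge_self: "wedge a a = 2 * pfaffian a"
  by (simp add: wedge_def pfaffian_def)

lemma wedge_congruence:
  assumes "\<And>i j. m$j$i = - m$i$j" "\<And>i j. a$j$i = - a$i$j"
  shows "wedge (M ** m ** transpose M) (M ** a ** transpose M) = det M * wedge m a"
proof -
  have polar: "wedge m a = pfaffian (m + a) - pfaffian m - pfaffian a" for m a
    by (simp add: wedge_def pfaffian_def algebra_simps)
  have "M ** m ** transpose M + M ** a ** transpose M = M ** (m + a) ** transpose M"
    unfolding matrix_add_ldistrib
    by (simp add: vec_eq_iff matrix_matrix_mult_def sum.distrib distrib_right)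
  moreover have "pfaffian (M ** (m + a) ** transpose M) = det M * pfaffian (m + a)"
  proof (rule pfaffian_congruence)
    show "(m + a)$j$i = - (m + a)$i$j" for i j using assms(1)[of i j] assms(2)[of i j] by simp
  qed
  ultimately show ?thesis
    unfolding polar pfaffian_congruence[OF assms(1)] pfaffian_congruence[OF assms(2)] by (simp add: right_diff_distrib)
qed

lemma axis_Basis [simp]: "axis k (1::real) \<in> Basis"
  by (simp add: axis_in_Basis_iff)

definition locally_constant_on :: "'x::topological_space set \<Rightarrow> ('x \<Rightarrow> 'y) \<Rightarrow> bool" where
  "locally_constant_on S s \<longleftrightarrow> (\<forall>x\<in>S. \<exists>T. open T \<and> x \<in> T \<and> (\<forall>y\<in>T. s y = s x))"

lemma locally_constant_mult_smooth:
  fixes G :: "'e::euclidean_space \<Rightarrow> real"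
  assumes V: "open V" and s: "locally_constant_on V s" and G: "smooth_on V G"
    and K: "closed K" "K \<subseteq> V" "\<And>x. x \<in> V - K \<Longrightarrow> G x = 0"
  shows "smooth_on UNIV (\<lambda>x. if x \<in> V then s x * G x else 0)" (is "smooth_on UNIV ?F")
    and "x \<in> V \<Longrightarrow> Df (\<lambda>x. if x \<in> V then s x * G x else 0) x i = s x * Df G x i"
proof -
  have loc: "\<exists>T. open T \<and> x \<in> T \<and> T \<subseteq> V \<and> (\<forall>y\<in>T. ?F y = s x * G y)" if x: "x \<in> V" for x
  proof -
    obtain T where T: "open T" "x \<in> T" "\<forall>y\<in>T. s y = s x" using s x unfolding locally_constant_on_def by blast
    show ?thesis
    proof (intro exI[of _ "T \<inter> V"] conjI ballI)
      fix y assume "y \<in> T \<inter> V"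
      then show "?F y = s x * G y" using bspec[OF T(3), of y] by simp
    qed (use T(1,2) V x in auto)
  qed
  show "smooth_on UNIV ?F"
  proof (rule smooth_on_local)
    fix x :: 'e
    show "\<exists>T. open T \<and> x \<in> T \<and> smooth_on T ?F"
    proof (cases "x \<in> V")
      case True
      from loc[OF this] obtain T where T: "open T" "x \<in> T" "T \<subseteq> V" "\<forall>y\<in>T. ?F y = s x * G y"
        by (elim exE conjE) (rule that)
      have "smooth_on T (\<lambda>y. s x * G y)"
        by (intro smooth_on_mult smooth_on_const T smooth_on_subset[OF G])
      then have "smooth_on T ?F" by (rule smooth_on_cong[OF T(1)]) (use T(4) in auto)
      then show ?thesis using T by blast
    next
      case False
      have o: "open (- K)" using K(1) by auto
      have "smooth_on (- K) ?F" by (rule smooth_on_cong[OF o smooth_on_const[of _ 0]]) (use K in auto)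
      then show ?thesis using o False K(2) by blast
    qed
  qed
  show "Df ?F x i = s x * Df G x i" if x: "x \<in> V"
  proof -
    from loc[OF x] obtain T where T: "open T" "x \<in> T" "T \<subseteq> V" "\<forall>y\<in>T. ?F y = s x * G y"
      by (elim exE conjE) (rule that)
    have "(G has_derivative Df G x) (at x)"
      using smooth_on_imp_differentiable[OF G x] by (simp add: frechet_derivative_works[symmetric])
    then have "((\<lambda>y. s x * G y) has_derivative (\<lambda>h. s x * Df G x h)) (at x)"
      by (rule has_derivative_mult_right)
    then have "(?F has_derivative (\<lambda>h. s x * Df G x h)) (at x)"
      by (rule has_derivative_transform_within_open[OF _ T(1,2)]) (use T(4) in auto)
    from fun_cong[OF frechet_derivative_at[OF this], of i] show ?thesis by simp
  qed
qed

lemma smooth_on_ext_deriv: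
  "open V \<Longrightarrow> (\<And>k. smooth_on V (\<beta> k)) \<Longrightarrow> smooth_on V (\<lambda>x. ext_deriv \<beta> x $ k $ l)"
  by (simp add: ext_deriv_def) (intro smooth_on_diff smooth_on_frechet_derivative axis_Basis)

text \<open>The components of the three-form \<open>\<xi> \<and> d\<beta>\<close>, as a vector field.\<close>

definition flux :: "(4 \<Rightarrow> real^4 \<Rightarrow> real) \<Rightarrow> (4 \<Rightarrow> real^4 \<Rightarrow> real) \<Rightarrow> 4 \<Rightarrow> real^4 \<Rightarrow> real" where
  "flux \<xi> \<beta> k = (\<lambda>x. let a = ext_deriv \<beta> x in
     if k = 1 then (\<xi> 2 x * a$3$4 + \<xi> 4 x * a$2$3) - \<xi> 3 x * a$2$4
     else if k = 2 then \<xi> 3 x * a$1$4 - (\<xi> 1 x * a$3$4 + \<xi> 4 x * a$1$3)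
     else if k = 3 then (\<xi> 1 x * a$2$4 + \<xi> 4 x * a$1$2) - \<xi> 2 x * a$1$4
     else \<xi> 2 x * a$1$3 - (\<xi> 1 x * a$2$3 + \<xi> 3 x * a$1$2))"

lemma smooth_on_flux:
  assumes V: "open V" and \<beta>: "\<And>k. smooth_on V (\<beta> k)" and \<xi>: "\<And>k. smooth_on V (\<xi> k)"
  shows "smooth_on V (flux \<xi> \<beta> k)"
  unfolding flux_def Let_def using exhaust_4[of k]
  by (elim disjE; simp; intro smooth_on_add smooth_on_diff smooth_on_mult smooth_on_ext_deriv V \<beta> \<xi>)

text \<open>The derivatives of \<open>\<xi>\<close> contribute \<open>d\<xi> \<and> d\<beta>\<close>; the second derivatives of \<open>\<beta>\<close> cancel since mixed partial
  derivatives commute, which says that \<open>dd\<beta> = 0\<close>.\<close>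

lemma divergence_flux:
  assumes V: "open V" and \<beta>: "\<And>k. smooth_on V (\<beta> k)" and \<xi>: "\<And>k. smooth_on V (\<xi> k)" and x: "x \<in> V"
  shows "(\<Sum>k\<in>UNIV. pd k (flux \<xi> \<beta> k) x) = wedge (ext_deriv \<xi> x) (ext_deriv \<beta> x)"
proof -
  define H where "H = (\<lambda>m k l. pd m (\<lambda>y. pd k (\<beta> l) y) x)"
  have sym: "H m k l = H k m l" for m k l
    unfolding H_def by (rule mixed_partial_derivatives_commute[OF V \<beta> axis_Basis axis_Basis x])
  note dd = smooth_on_imp_differentiable[OF _ x]
  have da: "(\<lambda>y. ext_deriv \<beta> y $ k $ l) differentiable (at x)" for k l
    by (intro dd smooth_on_ext_deriv V \<beta>)
  have d\<xi>: "\<xi> k differentiable (at x)" for k by (intro dd \<xi>)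
  have pa: "pd m (\<lambda>y. ext_deriv \<beta> y $ k $ l) x = H m k l - H m l k" for m k l
    unfolding H_def ext_deriv_def vec_lambda_beta
    by (intro frechet_derivative_diff_at dd smooth_on_frechet_derivative \<beta> axis_Basis)
  have pm: "pd m (\<lambda>y. \<xi> j y * ext_deriv \<beta> y $ k $ l) x
      = \<xi> j x * (H m k l - H m l k) + pd m (\<xi> j) x * ext_deriv \<beta> x $ k $ l" for m j k l
    using frechet_derivative_mult_real[OF d\<xi> da] by (simp add: pa)
  have dm: "(\<lambda>y. \<xi> j y * ext_deriv \<beta> y $ k $ l) differentiable (at x)" for j k l
    by (intro differentiable_mult d\<xi> da)
  show ?thesis
    unfolding sum_4 flux_def Let_def wedge_def ext_deriv_def[of \<xi>] vec_lambda_beta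
    by (simp add: frechet_derivative_add_at frechet_derivative_diff_at dm pm differentiable_add)
      (simp add: algebra_simps sym[of 1 2 3] sym[of 1 2 4] sym[of 1 3 2] sym[of 1 3 4] sym[of 1 4 2] sym[of 1 4 3]
        sym[of 2 3 1] sym[of 2 3 4] sym[of 2 4 1] sym[of 2 4 3] sym[of 3 4 1] sym[of 3 4 2])
qed

text \<open>The form \<open>d\<xi> \<and> d\<beta> = d(\<xi> \<and> d\<beta>)\<close> is the divergence of a vector field with compact support in \<open>V\<close>.
  The factor \<open>s\<close>, later the orientation sign of a chart, can be taken inside the divergence since it
  is locally constant.\<close>

lemma Stokes_wedge:
  fixes \<beta> \<xi> :: "4 \<Rightarrow> real^4 \<Rightarrow> real"
  assumes V: "open V" and \<beta>: "\<And>k. smooth_on V (\<beta> k)" and \<xi>: "\<And>k. smooth_on V (\<xi> k)"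
    and s: "locally_constant_on V s"
    and K: "compact K" "K \<subseteq> V" "\<And>k x. x \<in> V - K \<Longrightarrow> \<xi> k x = 0"
  shows "((\<lambda>x. if x \<in> V then s x * wedge (ext_deriv \<xi> x) (ext_deriv \<beta> x) else 0) has_integral 0) UNIV"
proof -
  define F where "F = (\<lambda>k x. if x \<in> V then s x * flux \<xi> \<beta> k x else 0)"
  have z: "flux \<xi> \<beta> k x = 0" if "x \<in> V - K" for k x using K(3)[OF that] by (simp add: flux_def Let_def)
  note F' = locally_constant_mult_smooth[OF V s smooth_on_flux[OF V \<beta> \<xi>] compact_imp_closed[OF K(1)] K(2) z]
  have F1: "smooth_on UNIV (F k)" for k unfolding F_def by (rule F'(1))
  have F2: "x \<in> V \<Longrightarrow> pd i (F k) x = s x * pd i (flux \<xi> \<beta> k) x" for k x i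
    unfolding F_def by (rule F'(2))
  have F0: "F k x = 0" if "x \<notin> K" for k x using z that by (auto simp: F_def)
  have "((\<lambda>x. pd k (F k) x) has_integral 0) UNIV" for k
  proof (rule directional_derivative_has_integral_0[OF _ _ K(1) F0])
    show "F k differentiable (at x)" for x by (rule smooth_on_imp_differentiable[OF F1 UNIV_I])
    show "continuous_on UNIV (pd k (F k))"
      by (intro smooth_on_imp_continuous_on smooth_on_frechet_derivative[OF F1] axis_Basis)
  qed
  then have "((\<lambda>x. \<Sum>k\<in>UNIV. pd k (F k) x) has_integral (\<Sum>k\<in>(UNIV::4 set). 0)) UNIV"
    by (intro has_integral_sum) auto
  moreover have "(\<lambda>x. \<Sum>k\<in>UNIV. pd k (F k) x)
      = (\<lambda>x. if x \<in> V then s x * wedge (ext_deriv \<xi> x) (ext_deriv \<beta> x) else 0)"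
  proof
    fix x
    show "(\<Sum>k\<in>UNIV. pd k (F k) x) = (if x \<in> V then s x * wedge (ext_deriv \<xi> x) (ext_deriv \<beta> x) else 0)"
    proof (cases "x \<in> V")
      case True
      have "(\<Sum>k\<in>UNIV. pd k (F k) x) = s x * (\<Sum>k\<in>UNIV. pd k (flux \<xi> \<beta> k) x)"
        by (simp add: F2[OF True] sum_distrib_left)
      then show ?thesis using divergence_flux[OF V \<beta> \<xi> True] True by simp
    next
      case False
      then have "Df (F k) x = (\<lambda>h. 0)" for k
        using frechet_derivative_eq_0_outside[of K "F k" x] compact_imp_closed[OF K(1)] F0 K(2) by blast
      then show ?thesis using False by simp
    qed
  qed
  ultimately show ?thesis by simp
qed

lemma continuous_on_extend_by_0:
  fixes h :: "'e::euclidean_space \<Rightarrow> real"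
  assumes V: "open V" and K: "closed K" "K \<subseteq> V" and h: "continuous_on V h" "\<And>x. x \<in> V - K \<Longrightarrow> h x = 0"
  shows "continuous_on UNIV (\<lambda>x. if x \<in> V then h x else 0)"
proof -
  have "continuous_on (V \<union> - K) (\<lambda>x. if x \<in> V then h x else 0)"
  proof (rule continuous_on_open_Un)
    show "continuous_on V (\<lambda>x. if x \<in> V then h x else 0)"
      by (rule continuous_on_eq[OF h(1)]) simp
    show "continuous_on (- K) (\<lambda>x. if x \<in> V then h x else 0)"
      by (rule continuous_on_eq[OF continuous_on_const[of _ 0]]) (use h(2) in auto)
  qed (use V K in auto)
  moreover have "V \<union> - K = UNIV" using K by auto
  ultimately show ?thesis by simp
qed

lemma absolutely_integrable_compact_support:
  fixes f :: "'e::euclidean_space \<Rightarrow> real"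
  assumes f: "continuous_on UNIV f" and K: "compact K" "\<And>x. x \<notin> K \<Longrightarrow> f x = 0" and S: "K \<subseteq> S"
  shows "f absolutely_integrable_on S"
proof -
  obtain c where c: "K \<subseteq> cbox (-c) c"
    using K(1) bounded_subset_cbox_symmetric compact_imp_bounded by blast
  have eq: "(\<lambda>x. if x \<in> T then f x else 0) = f" if "K \<subseteq> T" for T
    using K(2) that by (auto simp: fun_eq_iff)
  have "f absolutely_integrable_on cbox (-c) c"
    by (rule absolutely_integrable_continuous[OF continuous_on_subset[OF f]]) auto
  then have "f absolutely_integrable_on UNIV"
    using absolutely_integrable_restrict_UNIV[of "cbox (-c) c" f] by (simp add: eq[OF c])
  then show ?thesis using absolutely_integrable_restrict_UNIV[of S f] by (simp add: eq[OF S])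
qed

lemma continuous_nonneg_integral_0:
  fixes f :: "'e::euclidean_space \<Rightarrow> real"
  assumes f: "continuous_on UNIV f" "\<And>x. f x \<ge> 0" and K: "compact K" "\<And>x. x \<notin> K \<Longrightarrow> f x = 0"
    and i: "integral UNIV f = 0"
  shows "f x = 0"
proof -
  have "bounded (insert x K)" using K(1) by (simp add: compact_imp_bounded)
  then obtain c where c: "insert x K \<subseteq> cbox (-c) c" using bounded_subset_cbox_symmetric by blast
  obtain d where d: "cbox (-c) c \<subseteq> box (-d) d"
    using bounded_subset_box_symmetric bounded_cbox by blast
  have x: "x \<in> box (-d) d" using c d by auto
  have Kd: "K \<subseteq> cbox (-d) d" using c d box_subset_cbox by blast
  have "integral (cbox (-d) d) f = 0" using integral_eq_on_supersets[of K f, OF K(2) Kd] i by simp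
  moreover have "f integrable_on cbox (-d) d"
    by (intro integrable_continuous continuous_on_subset[OF f(1)]) auto
  ultimately have "(f has_integral 0) (cbox (-d) d)" by (metis integrable_integral)
  then show ?thesis
    using has_integral_0_cbox_imp_0[of "-d" d f x] continuous_on_subset[OF f(1)] f(2) x box_subset_cbox by blast
qed

lemma integral_change_of_variables_real:
  fixes g :: "real^4 \<Rightarrow> real^4" and f :: "real^4 \<Rightarrow> real"
  assumes S: "open S" and g: "\<And>x. x \<in> S \<Longrightarrow> (g has_derivative g' x) (at x)" "inj_on g S"
    and f: "f absolutely_integrable_on (g ` S)"
  shows "integral S (\<lambda>x. \<bar>det (matrix (g' x))\<bar> * f (g x)) = integral (g ` S) f"
proof -
  let ?f = "\<lambda>y. vec (f y) :: real^1"
  have "?f absolutely_integrable_on (g ` S) \<and> integral (g ` S) ?f = vec (integral (g ` S) f)"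
    using f by (simp add: absolutely_integrable_on_1_iff integral_on_1_eq)
  then have "integral S (\<lambda>x. \<bar>det (matrix (g' x))\<bar> *\<^sub>R ?f (g x)) = vec (integral (g ` S) f)"
    using has_absolute_integral_change_of_variables[of S g g' ?f "vec (integral (g ` S) f)"] S g
    by (metis has_derivative_at_withinI borel_open sets_completionI_sets sets_lborel)
  then show ?thesis by (simp add: integral_on_1_eq vec_eq_iff)
qed

section \<open>Partitions of unity and integration in charts\<close>

context smooth_manifold
begin

lemma linear_functional_sum:
  assumes L: "\<And>u w s t. u \<in> TM p \<Longrightarrow> w \<in> TM p \<Longrightarrow>
      L (\<lambda>f. s * u f + t * w f) = s * L u + t * (L w :: real)"
    and I: "finite I" and u: "\<And>i. i \<in> I \<Longrightarrow> u i \<in> TM p"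
  shows "L (\<lambda>f. \<Sum>i\<in>I. s i * u i f) = (\<Sum>i\<in>I. s i * L (u i))"
  using I u
proof (induction I)
  case empty
  show ?case using L[OF tangent_space_vector_0 tangent_space_vector_0, of 0 0] by simp
next
  case (insert i I)
  have "L (\<lambda>f. s i * u i f + 1 * (\<Sum>i\<in>I. s i * u i f)) = s i * L (u i) + 1 * L (\<lambda>f. \<Sum>i\<in>I. s i * u i f)"
    using insert.prems by (intro L tangent_space_vector_sum) auto
  then show ?case using insert by simp
qed

text \<open>Finitely many bump functions have a positive sum by compactness; divide by the sum.\<close>

lemma exists_partition_of_unity:
  assumes "compact (UNIV :: 'a set)"
  shows "\<exists>I C K \<eta>. finite I \<and> (\<forall>p\<in>I. C p \<in> A \<and> \<eta> p \<in> SF \<and> compact (K p) \<and> K p \<subseteq> fst (C p) \<and>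
     (\<forall>q. 0 \<le> \<eta> p q) \<and> (\<forall>q. q \<notin> K p \<longrightarrow> \<eta> p q = 0)) \<and> (\<forall>q. (\<Sum>p\<in>(I :: 'a set). \<eta> p q) = 1)"
proof -
  have "\<exists>c N K \<psi>. c \<in> A \<and> bump N K \<psi> \<and> p \<in> N \<and> K \<subseteq> fst c" for p
  proof -
    obtain c where c: "c \<in> A" "p \<in> fst c" using exists_chart .
    obtain N K \<psi> where "bump N K \<psi>" "p \<in> N" "K \<subseteq> fst c" using exists_bump[OF c open_UNIV UNIV_I] .
    then show ?thesis using c by blast
  qed
  then obtain C N K \<psi> where C: "\<And>p. C p \<in> A" "\<And>p. bump (N p) (K p) (\<psi> p)" "\<And>p. p \<in> N p" "\<And>p. K p \<subseteq> fst (C p)"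
    by metis
  have oN: "open (N p)" for p using C(2) by (simp add: bump_def)
  have cover: "UNIV \<subseteq> (\<Union>p\<in>UNIV. N p)" using C(3) by blast
  obtain I where I: "finite I" "UNIV \<subseteq> (\<Union>p\<in>I. N p)"
    using compactE_image[OF assms, of UNIV N] oN cover by metis
  define s where "s = (\<lambda>q. \<Sum>p\<in>I. \<psi> p q)"
  have nn: "0 \<le> \<psi> p q" for p q using C(2)[of p] by (simp add: bump_def)
  have sm: "\<psi> p \<in> SF" for p using C(2)[of p] by (simp add: bump_def)
  have spos: "s q > 0" for q
  proof -
    obtain p where p: "p \<in> I" "q \<in> N p" using I(2) by blast
    then have "\<psi> p q = 1" using C(2)[of p] by (simp add: bump_def)
    then show ?thesis unfolding s_def using sum_pos2[OF I(1) p(1), of "\<lambda>p. \<psi> p q"] nn by simp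
  qed
  have ssm: "(\<lambda>q. inverse (s q)) \<in> SF"
    by (rule smooth_functions_inverse) (use spos in \<open>auto simp: s_def less_le intro!: smooth_functions_sum sm\<close>)
  show ?thesis
  proof (intro exI conjI ballI allI impI)
    show "finite I" by fact
    fix p
    show "C p \<in> A" "K p \<subseteq> fst (C p)" by (rule C)+
    show "compact (K p)" using C(2)[of p] by (simp add: bump_def)
    show "(\<lambda>q. \<psi> p q * inverse (s q)) \<in> SF" by (rule smooth_functions_mult[OF sm ssm])
    show "0 \<le> \<psi> p q * inverse (s q)" for q using nn[of p q] spos[of q] by simp
    show "\<psi> p q * inverse (s q) = 0" if "q \<notin> K p" for q using C(2)[of p] that by (simp add: bump_def)
  next
    fix q
    show "(\<Sum>p\<in>I. \<psi> p q * inverse (s q)) = 1"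
      using spos[of q] by (simp add: sum_distrib_right[symmetric] s_def)
  qed
qed

end

lemma sum_Basis_axis:
  fixes h :: "real^4 \<Rightarrow> 'b::comm_monoid_add"
  shows "(\<Sum>i\<in>Basis. h i) = (\<Sum>k\<in>UNIV. h (axis k 1))"
proof -
  have B: "(Basis :: (real^4) set) = (\<lambda>k. axis k 1) ` UNIV" by (auto simp: Basis_vec_def)
  have inj: "inj_on (\<lambda>k. axis k 1 :: real^4) UNIV" by (auto simp: inj_def axis_eq_axis)
  show ?thesis unfolding B using sum.reindex[OF inj, of h] by (simp only: o_def)
qed

locale smooth_manifold4 = smooth_manifold A
  for A :: "('a::{t2_space,second_countable_topology}, real^4) chart set"
begin

abbreviation E :: "('a, real^4) chart \<Rightarrow> 4 \<Rightarrow> 'a \<Rightarrow> 'a tvec" where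
  "E c k p \<equiv> coord_vec c (axis k 1) p"

lemma bump_in_chart:
  assumes "c \<in> A" "p \<in> fst c"
  obtains N K \<psi> where "bump N K \<psi>" "K \<subseteq> fst c" "p \<in> N" "open N" "N \<subseteq> fst c"
proof -
  obtain N K \<psi> where "bump N K \<psi>" "p \<in> N" "K \<subseteq> fst c" using exists_bump[OF assms open_UNIV UNIV_I] .
  moreover from this have "open N" "N \<subseteq> fst c" by (auto simp: bump_def)
  ultimately show thesis using that by blast
qed

text \<open>By \<open>coords_eq\<close> below the choice of the cut-off function is immaterial.\<close>

definition coords :: "('a, real^4) chart \<Rightarrow> 'a \<Rightarrow> 'a tvec \<Rightarrow> 4 \<Rightarrow> real" where
  "coords c p D k = D (cut_coord (SOME \<psi>. \<exists>N K. bump N K \<psi> \<and> K \<subseteq> fst c \<and> p \<in> N) c (axis k 1))"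

lemma tangent_vector_eq_coords:
  assumes c: "c \<in> A" "p \<in> fst c" and D: "D \<in> TM p"
  shows "D = (\<lambda>f. \<Sum>k\<in>UNIV. coords c p D k * E c k p f)"
proof -
  let ?\<psi> = "SOME \<psi>. \<exists>N K. bump N K \<psi> \<and> K \<subseteq> fst c \<and> p \<in> N"
  obtain N0 K0 \<psi>0 where "bump N0 K0 \<psi>0" "K0 \<subseteq> fst c" "p \<in> N0" using bump_in_chart[OF c] .
  then have "\<exists>\<psi> N K. bump N K \<psi> \<and> K \<subseteq> fst c \<and> p \<in> N" by blast
  from someI_ex[OF this] obtain N K where "bump N K ?\<psi>" "K \<subseteq> fst c" "p \<in> N" by blast
  from tangent_vector_in_coordinates[OF c this D] show ?thesis
    by (simp add: sum_Basis_axis coords_def)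
qed

lemma sum_E_cut_coord:
  assumes c: "c \<in> A" "p \<in> fst c" and \<psi>: "bump N K \<psi>" "K \<subseteq> fst c" "p \<in> N"
  shows "(\<Sum>k\<in>UNIV. t k * E c k p (cut_coord \<psi> c (axis l 1))) = t l"
  by (simp add: coord_vec_cut_coord[OF c \<psi>] inner_axis_axis if_distrib[of "\<lambda>x. _ * x"] cong: if_cong)

lemma coords_eq:
  assumes c: "c \<in> A" "p \<in> fst c" and \<psi>: "bump N K \<psi>" "K \<subseteq> fst c" "p \<in> N" and D: "D \<in> TM p"
  shows "coords c p D l = D (cut_coord \<psi> c (axis l 1))"
  using fun_cong[OF tangent_vector_eq_coords[OF c D], of "cut_coord \<psi> c (axis l 1)"]
  by (simp only: sum_E_cut_coord[OF c \<psi>])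

lemma coords_unique:
  assumes c: "c \<in> A" "p \<in> fst c" and eq: "(\<lambda>f. \<Sum>k\<in>UNIV. t k * E c k p f) = (\<lambda>f. \<Sum>k\<in>UNIV. s k * E c k p f)"
  shows "t l = s l"
proof -
  obtain N K \<psi> where \<psi>: "bump N K \<psi>" "K \<subseteq> fst c" "p \<in> N" using bump_in_chart[OF c] .
  from fun_cong[OF eq, of "cut_coord \<psi> c (axis l 1)"] show ?thesis
    by (simp only: sum_E_cut_coord[OF c \<psi>])
qed

definition transition_matrix :: "('a, real^4) chart \<Rightarrow> ('a, real^4) chart \<Rightarrow> 'a \<Rightarrow> real^4^4" where
  "transition_matrix c d p = transpose (matrix (Df (snd d \<circ> cinv c) (snd c p)))"

lemma E_change_chart:
  assumes c: "c \<in> A" "p \<in> fst c" and d: "d \<in> A" "p \<in> fst d"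
  shows "E c k p = (\<lambda>f. \<Sum>l\<in>UNIV. transition_matrix c d p $ k $ l * E d l p f)"
  using coord_vec_change_chart[OF c d, of "axis k 1"]
  by (simp add: sum_Basis_axis transition_matrix_def transpose_def matrix_def inner_axis)

lemma det_transition_matrix_nonzero:
  assumes c: "c \<in> A" "p \<in> fst c" and d: "d \<in> A" "p \<in> fst d"
  shows "det (transition_matrix c d p) \<noteq> 0"
proof -
  let ?T = "transition_matrix c d p" and ?S = "transition_matrix d c p"
  have "(?T ** ?S)$k$l = (mat 1 :: real^4^4)$k$l" for k l
  proof (rule coords_unique[OF c])
    have "E c k p = (\<lambda>f. \<Sum>j\<in>UNIV. ?T$k$j * (\<Sum>l\<in>UNIV. ?S$j$l * E c l p f))"
      using E_change_chart[OF c d, of k] E_change_chart[OF d c] by simp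
    also have "\<dots> = (\<lambda>f. \<Sum>l\<in>UNIV. (?T ** ?S)$k$l * E c l p f)"
      by (simp add: matrix_matrix_mult_def sum_4 algebra_simps)
    finally have "(\<lambda>f. \<Sum>l\<in>UNIV. (?T ** ?S)$k$l * E c l p f) = E c k p" by simp
    also have "\<dots> = (\<lambda>f. \<Sum>l\<in>UNIV. (mat 1 :: real^4^4)$k$l * E c l p f)"
      by (simp add: mat_def if_distrib[of "\<lambda>x. x * _"] cong: if_cong)
    finally show "(\<lambda>f. \<Sum>l\<in>UNIV. (?T ** ?S)$k$l * E c l p f) = (\<lambda>f. \<Sum>l\<in>UNIV. (mat 1 :: real^4^4)$k$l * E c l p f)" .
  qed
  then have "?T ** ?S = mat 1" unfolding matrix_eq_4 by blast
  then have "det ?T * det ?S = 1" by (metis det_mul det_I)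
  then show ?thesis by auto
qed

subsection \<open>Integrals over charts\<close>

text \<open>Extension by \<open>0\<close> lets all integrals be taken over the whole coordinate space.\<close>

definition in_chart :: "('a, real^4) chart \<Rightarrow> ('a \<Rightarrow> real) \<Rightarrow> real^4 \<Rightarrow> real" where
  "in_chart c h x = (if x \<in> cimg c then h (cinv c x) else 0)"

lemma compact_chart_image:
  assumes c: "c \<in> A" and K: "compact K" "K \<subseteq> fst c"
  shows "compact (snd c ` K)"
  by (rule compact_continuous_image[OF continuous_on_subset[OF continuous_on_chart[OF c] K(2)] K(1)])

lemma in_chart_outside:
  assumes c: "c \<in> A" and K: "K \<subseteq> fst c" "\<And>p. p \<in> fst c - K \<Longrightarrow> h p = 0" and x: "x \<notin> snd c ` K"
  shows "in_chart c h x = 0"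
proof (cases "x \<in> cimg c")
  case True
  then have "cinv c x \<notin> K" using x chart_cinv[OF c True] by (metis image_eqI)
  then show ?thesis using K(2) cinv_in_domain[OF c True] by (simp add: in_chart_def)
qed (simp add: in_chart_def)

lemma in_chart_continuous:
  assumes c: "c \<in> A" and K: "compact K" "K \<subseteq> fst c" "\<And>p. p \<in> fst c - K \<Longrightarrow> h p = 0"
    and h: "continuous_on (cimg c) (h \<circ> cinv c)"
  shows "continuous_on UNIV (in_chart c h)"
proof -
  have "continuous_on UNIV (\<lambda>x. if x \<in> cimg c then (h \<circ> cinv c) x else 0)"
  proof (rule continuous_on_extend_by_0[OF open_chart_image[OF c] _ _ h])
    show "closed (snd c ` K)" by (rule compact_imp_closed[OF compact_chart_image[OF c K(1,2)]])
    show "snd c ` K \<subseteq> cimg c" using K(2) by blast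
    show "(h \<circ> cinv c) x = 0" if "x \<in> cimg c - snd c ` K" for x
      using in_chart_outside[OF c K(2), of h x] K(3) that by (simp add: in_chart_def)
  qed
  then show ?thesis unfolding in_chart_def[abs_def] o_def .
qed

text \<open>The assumption relating \<open>h\<close> and \<open>h'\<close> says that they are the coefficients of one density, supported
  in the overlap of the two charts.\<close>

lemma integral_in_chart_change:
  assumes c: "c \<in> A" and d: "d \<in> A" and K: "compact K" "K \<subseteq> fst c \<inter> fst d"
    and h: "\<And>p. p \<in> fst c - K \<Longrightarrow> h p = 0" and h': "\<And>p. p \<in> fst d - K \<Longrightarrow> h' p = 0"
    and cont: "continuous_on (cimg d) (h' \<circ> cinv d)"
    and eq: "\<And>p. p \<in> fst c \<inter> fst d \<Longrightarrow> h p = \<bar>det (transition_matrix c d p)\<bar> * h' p"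
  shows "integral UNIV (in_chart c h) = integral UNIV (in_chart d h')"
proof -
  let ?S = "snd c ` (fst c \<inter> fst d)" and ?\<tau> = "snd d \<circ> cinv c"
  have S: "open ?S"
    using open_chart_domain[OF c] open_chart_domain[OF d] by (intro open_chart_of_open[OF c]) auto
  have \<tau>S: "?\<tau> ` ?S = snd d ` (fst c \<inter> fst d)"
    by (force simp: image_image cinv_chart[OF c])
  have Kc: "K \<subseteq> fst c" "K \<subseteq> fst d" using K(2) by auto
  have "integral UNIV (in_chart c h) = integral ?S (in_chart c h)"
    by (rule integral_eq_on_supersets[of "snd c ` K", symmetric])
      (use in_chart_outside[OF c Kc(1) h] K(2) in auto)
  also have "\<dots> = integral ?S (\<lambda>x. \<bar>det (matrix (Df ?\<tau> x))\<bar> * in_chart d h' (?\<tau> x))"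
  proof (rule integral_cong)
    fix x assume "x \<in> ?S"
    then obtain p where p: "p \<in> fst c" "p \<in> fst d" "x = snd c p" by auto
    have "in_chart c h x = h p" "in_chart d h' (?\<tau> x) = h' p"
      using p by (auto simp: in_chart_def cinv_chart[OF c] cinv_chart[OF d])
    then show "in_chart c h x = \<bar>det (matrix (Df ?\<tau> x))\<bar> * in_chart d h' (?\<tau> x)"
      using eq[of p] p by (simp add: transition_matrix_def det_transpose)
  qed
  also have "\<dots> = integral (?\<tau> ` ?S) (in_chart d h')"
  proof (rule integral_change_of_variables_real[OF S])
    show "(?\<tau> has_derivative Df ?\<tau> x) (at x)" if "x \<in> ?S" for x
      using smooth_on_imp_differentiable[OF transition_smooth[OF c d] that] frechet_derivative_works by blast
    show "inj_on ?\<tau> ?S"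
    proof (rule inj_onI)
      fix x y assume "x \<in> ?S" "y \<in> ?S" and e: "?\<tau> x = ?\<tau> y"
      then obtain p q where "p \<in> fst c \<inter> fst d" "x = snd c p" "q \<in> fst c \<inter> fst d" "y = snd c q" by blast
      then show "x = y" using e inj_onD[OF inj_on_chart[OF d], of p q] by (simp add: cinv_chart[OF c])
    qed
    show "in_chart d h' absolutely_integrable_on ?\<tau> ` ?S"
      unfolding \<tau>S
      by (rule absolutely_integrable_compact_support[OF in_chart_continuous[OF d K(1) Kc(2) h' cont]
            compact_chart_image[OF d K(1) Kc(2)] in_chart_outside[OF d Kc(2) h']])
        (use K(2) in auto)
  qed
  also have "\<dots> = integral UNIV (in_chart d h')"
    unfolding \<tau>S
    by (rule integral_eq_on_supersets[of "snd d ` K"]) (use in_chart_outside[OF d Kc(2) h'] K(2) in auto)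
  finally show ?thesis .
qed

end

context smooth_manifold
begin

lemma smooth_on_chart_localI:
  assumes c: "c \<in> A"
    and loc: "\<And>p. p \<in> fst c \<Longrightarrow> \<exists>N f. open N \<and> p \<in> N \<and> N \<subseteq> fst c \<and> f \<in> SF \<and> (\<forall>q\<in>N. f q = h q)"
  shows "smooth_on (cimg c) (h \<circ> cinv c)"
proof (rule smooth_on_local)
  fix x assume x: "x \<in> cimg c"
  obtain N f where N: "open N" "cinv c x \<in> N" "N \<subseteq> fst c" and f: "f \<in> SF" "\<forall>q\<in>N. f q = h q"
    using loc[OF cinv_in_domain[OF c x]] by auto
  have o: "open (snd c ` N)" by (rule open_chart_of_open[OF c N(1,3)])
  have "smooth_on (snd c ` N) (f \<circ> cinv c)"
    by (rule smooth_on_subset[OF smooth_functions_in_chart[OF c f(1)]]) (use N(3) in auto)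
  then have "smooth_on (snd c ` N) (h \<circ> cinv c)"
    by (rule smooth_on_cong[OF o]) (use f(2) N(3) cinv_chart[OF c] in auto)
  moreover have "x \<in> snd c ` N" using N(2) chart_cinv[OF c x] by (metis image_eqI)
  ultimately show "\<exists>T. open T \<and> x \<in> T \<and> smooth_on T (h \<circ> cinv c)" using o by blast
qed

end

section \<open>Anti-invariant exact two-forms on compact four-manifolds\<close>

text \<open>A two-form \<open>\<alpha>\<close> with \<open>\<alpha> = d\<beta>\<close> and \<open>\<alpha>(J\<cdot>, J\<cdot>) = -\<alpha>\<close>, given pointwise on tangent vectors; \<open>\<alpha>_exact\<close> is
  the formula for the exterior derivative of a one-form in terms of vector fields.\<close>

locale exact_anti_invariant_form = smooth_manifold4 A
  for A :: "('a::{t2_space,second_countable_topology}, real^4) chart set" +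
  fixes J :: "'a endo_tensor" and \<beta> :: "'a \<Rightarrow> 'a tvec \<Rightarrow> real" and \<alpha> :: "'a \<Rightarrow> 'a tvec \<Rightarrow> 'a tvec \<Rightarrow> real"
  assumes compact_manifold: "compact (UNIV :: 'a set)"
    and J: "almost_complex_structure A J"
    and \<beta>_linear: "\<And>p u w s t. u \<in> TM p \<Longrightarrow> w \<in> TM p \<Longrightarrow>
        \<beta> p (\<lambda>f. s * u f + t * w f) = s * \<beta> p u + t * \<beta> p w"
    and \<beta>_smooth: "\<And>X. X \<in> VF \<Longrightarrow> (\<lambda>p. \<beta> p (X p)) \<in> SF"
    and \<alpha>_linear: "\<And>p u w z s t. u \<in> TM p \<Longrightarrow> w \<in> TM p \<Longrightarrow> z \<in> TM p \<Longrightarrow>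
        \<alpha> p (\<lambda>f. s * u f + t * w f) z = s * \<alpha> p u z + t * \<alpha> p w z"
    and \<alpha>_skew: "\<And>p u w. u \<in> TM p \<Longrightarrow> w \<in> TM p \<Longrightarrow> \<alpha> p u w = - \<alpha> p w u"
    and \<alpha>_exact: "\<And>X Y p. X \<in> VF \<Longrightarrow> Y \<in> VF \<Longrightarrow>
        \<alpha> p (X p) (Y p) = X p (\<lambda>q. \<beta> q (Y q)) - Y p (\<lambda>q. \<beta> q (X q)) - \<beta> p (lie_bracket X Y p)"
    and \<alpha>_anti: "\<And>p u w. u \<in> TM p \<Longrightarrow> w \<in> TM p \<Longrightarrow>
        \<alpha> p (J p u) (J p w) = - \<alpha> p u w"
begin

lemma J_tangent: "u \<in> TM p \<Longrightarrow> J p u \<in> TM p"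
  using J by (simp add: almost_complex_structure_def)

lemma J_J: "u \<in> TM p \<Longrightarrow> J p (J p u) = (\<lambda>f. - u f)"
  using J by (simp add: almost_complex_structure_def)

lemma J_field: "X \<in> VF \<Longrightarrow> (\<lambda>p. J p (X p)) \<in> VF"
  using J by (simp add: almost_complex_structure_def)

lemma J_sum:
  assumes "\<And>i. i \<in> UNIV \<Longrightarrow> u i \<in> TM p"
  shows "J p (\<lambda>f. \<Sum>i\<in>(UNIV :: 4 set). t i * u i f) = (\<lambda>f. \<Sum>i\<in>UNIV. t i * J p (u i) f)"
proof
  fix f
  show "J p (\<lambda>f. \<Sum>i\<in>(UNIV :: 4 set). t i * u i f) f = (\<Sum>i\<in>UNIV. t i * J p (u i) f)"
    by (rule linear_functional_sum[of p "\<lambda>u. J p u f"])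
      (use assms J in \<open>auto simp: almost_complex_structure_def\<close>)
qed

lemma \<alpha>_sum_left:
  assumes "\<And>i. i \<in> UNIV \<Longrightarrow> u i \<in> TM p" "w \<in> TM p"
  shows "\<alpha> p (\<lambda>f. \<Sum>i\<in>(UNIV :: 4 set). t i * u i f) w = (\<Sum>i\<in>UNIV. t i * \<alpha> p (u i) w)"
  by (rule linear_functional_sum[of p "\<lambda>u. \<alpha> p u w"]) (use assms \<alpha>_linear in auto)

lemma \<alpha>_sum_right:
  assumes "\<And>i. i \<in> UNIV \<Longrightarrow> u i \<in> TM p" "w \<in> TM p"
  shows "\<alpha> p w (\<lambda>f. \<Sum>i\<in>(UNIV :: 4 set). t i * u i f) = (\<Sum>i\<in>UNIV. t i * \<alpha> p w (u i))"
proof -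
  have "\<alpha> p w (\<lambda>f. \<Sum>i\<in>(UNIV :: 4 set). t i * u i f) = - (\<Sum>i\<in>UNIV. t i * \<alpha> p (u i) w)"
    using \<alpha>_skew[OF assms(2) tangent_space_vector_sum[of UNIV u p t]] \<alpha>_sum_left[of u p w t] assms by simp
  also have "\<dots> = (\<Sum>i\<in>UNIV. t i * \<alpha> p w (u i))"
    using \<alpha>_skew[OF assms(1) assms(2)] by (simp add: sum_negf)
  finally show ?thesis .
qed

definition one_form_comp :: "('a, real^4) chart \<Rightarrow> 4 \<Rightarrow> 'a \<Rightarrow> real" where
  "one_form_comp c k p = \<beta> p (E c k p)"

definition two_form_mat :: "('a, real^4) chart \<Rightarrow> 'a \<Rightarrow> real^4^4" where
  "two_form_mat c p = (\<chi> k l. \<alpha> p (E c k p) (E c l p))"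

definition J_mat :: "('a, real^4) chart \<Rightarrow> 'a \<Rightarrow> real^4^4" where
  "J_mat c p = (\<chi> k l. coords c p (J p (E c k p)) l)"

context
  fixes c assumes c: "c \<in> A"
begin

lemma E_tangent: "p \<in> fst c \<Longrightarrow> E c k p \<in> TM p"
  by (rule coord_vec_in_tangent_space[OF c])

lemma J_E: "p \<in> fst c \<Longrightarrow> J p (E c k p) = (\<lambda>f. \<Sum>l\<in>UNIV. J_mat c p $ k $ l * E c l p f)"
  using tangent_vector_eq_coords[OF c _ J_tangent[OF E_tangent]] by (simp add: J_mat_def)

lemma \<alpha>_in_coordinates:
  assumes p: "p \<in> fst c"
  shows "\<alpha> p (\<lambda>f. \<Sum>i\<in>UNIV. M$k$i * E c i p f) (\<lambda>f. \<Sum>j\<in>UNIV. M$l$j * E c j p f)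
    = (M ** two_form_mat c p ** transpose M)$k$l"
proof -
  note T = E_tangent[OF p]
  have "\<alpha> p (\<lambda>f. \<Sum>i\<in>UNIV. M$k$i * E c i p f) (\<lambda>f. \<Sum>j\<in>UNIV. M$l$j * E c j p f)
      = (\<Sum>i\<in>UNIV. M$k$i * (\<Sum>j\<in>UNIV. M$l$j * two_form_mat c p $ i $ j))"
    by (simp add: \<alpha>_sum_left \<alpha>_sum_right T tangent_space_vector_sum two_form_mat_def)
  also have "\<dots> = (M ** two_form_mat c p ** transpose M)$k$l"
    by (simp add: matrix_matrix_mult_def transpose_def sum_4 algebra_simps)
  finally show ?thesis .
qed

lemma two_form_mat_skew: "p \<in> fst c \<Longrightarrow> two_form_mat c p $ j $ i = - two_form_mat c p $ i $ j"
  unfolding two_form_mat_def vec_lambda_beta by (intro \<alpha>_skew E_tangent)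

lemma two_form_mat_anti:
  assumes p: "p \<in> fst c"
  shows "J_mat c p ** two_form_mat c p ** transpose (J_mat c p) = - two_form_mat c p"
proof -
  have "(J_mat c p ** two_form_mat c p ** transpose (J_mat c p))$k$l = - two_form_mat c p $k$l" for k l
    using \<alpha>_anti[OF E_tangent[OF p] E_tangent[OF p], of k l]
    by (simp only: J_E[OF p] \<alpha>_in_coordinates[OF p]) (simp add: two_form_mat_def)
  then show ?thesis by (simp add: matrix_eq_4)
qed

lemma J_mat_square:
  assumes p: "p \<in> fst c"
  shows "J_mat c p ** J_mat c p = - mat 1"
proof -
  have "(J_mat c p ** J_mat c p)$k$m = (- mat 1 :: real^4^4)$k$m" for k m
  proof (rule coords_unique[OF c p])
    have "(\<lambda>f. \<Sum>m\<in>UNIV. (J_mat c p ** J_mat c p)$k$m * E c m p f)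
        = (\<lambda>f. \<Sum>l\<in>UNIV. J_mat c p $k$l * J p (E c l p) f)"
      unfolding J_E[OF p] by (simp add: matrix_matrix_mult_def sum_4 algebra_simps)
    also have "\<dots> = J p (J p (E c k p))"
      unfolding J_E[OF p, of k] by (rule J_sum[symmetric]) (rule E_tangent[OF p])
    also have "\<dots> = (\<lambda>f. \<Sum>m\<in>UNIV. (- mat 1 :: real^4^4)$k$m * E c m p f)"
      unfolding J_J[OF E_tangent[OF p]]
      by (simp add: mat_def if_distrib[of "\<lambda>x. x * _"] if_distrib[of uminus] cong: if_cong)
    finally show "(\<lambda>f. \<Sum>m\<in>UNIV. (J_mat c p ** J_mat c p)$k$m * E c m p f)
        = (\<lambda>f. \<Sum>m\<in>UNIV. (- mat 1 :: real^4^4)$k$m * E c m p f)" .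
  qed
  then show ?thesis by (simp add: matrix_eq_4)
qed

lemma one_form_comp_smooth: "smooth_on (cimg c) (one_form_comp c k \<circ> cinv c)"
proof (rule smooth_on_chart_localI[OF c])
  fix p assume p: "p \<in> fst c"
  obtain N K \<psi> where \<psi>: "bump N K \<psi>" "K \<subseteq> fst c" "p \<in> N" "open N" "N \<subseteq> fst c" using bump_in_chart[OF c p] .
  have "(\<lambda>q. \<beta> q (local_frame \<psi> c (axis k 1) q)) \<in> SF"
    by (intro \<beta>_smooth local_frame_vector_field[OF c \<psi>(1,2)] axis_Basis)
  moreover have "\<forall>q\<in>N. \<beta> q (local_frame \<psi> c (axis k 1) q) = one_form_comp c k q"
    by (simp add: local_frame_eq_coord_vec[OF \<psi>(1,2)] one_form_comp_def)
  ultimately show "\<exists>N f. open N \<and> p \<in> N \<and> N \<subseteq> fst c \<and> f \<in> SF \<and> (\<forall>q\<in>N. f q = one_form_comp c k q)"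
    using \<psi> by blast
qed

lemma J_mat_smooth: "smooth_on (cimg c) ((\<lambda>p. J_mat c p $ k $ l) \<circ> cinv c)"
proof (rule smooth_on_chart_localI[OF c])
  fix p assume p: "p \<in> fst c"
  obtain N K \<psi> where \<psi>: "bump N K \<psi>" "K \<subseteq> fst c" "p \<in> N" "open N" "N \<subseteq> fst c" using bump_in_chart[OF c p] .
  let ?f = "\<lambda>q. J q (local_frame \<psi> c (axis k 1) q) (cut_coord \<psi> c (axis l 1))"
  have "?f \<in> SF"
    by (intro vector_fields_smooth[OF J_field[OF local_frame_vector_field[OF c \<psi>(1,2)]]]
        cut_coord_smooth[OF c \<psi>(1,2)] axis_Basis)
  moreover have "?f q = J_mat c q $ k $ l" if q: "q \<in> N" for q
  proof -
    have qc: "q \<in> fst c" using q \<psi>(5) by blast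
    show ?thesis
      using coords_eq[OF c qc \<psi>(1,2) q J_tangent[OF E_tangent[OF qc, of k]], of l]
      by (simp add: J_mat_def local_frame_eq_coord_vec[OF \<psi>(1,2) q])
  qed
  ultimately show "\<exists>N f. open N \<and> p \<in> N \<and> N \<subseteq> fst c \<and> f \<in> SF \<and> (\<forall>q\<in>N. f q = J_mat c q $ k $ l)"
    using \<psi> by (intro exI[of _ N] exI[of _ ?f]) auto
qed

text \<open>Evaluate \<open>\<alpha> = d\<beta>\<close> on local frames, whose brackets vanish near \<open>p\<close>.\<close>

lemma two_form_mat_eq_ext_deriv:
  assumes p: "p \<in> fst c"
  shows "two_form_mat c p = ext_deriv (\<lambda>k. one_form_comp c k \<circ> cinv c) (snd c p)"
proof -
  obtain N K \<psi> where \<psi>: "bump N K \<psi>" "K \<subseteq> fst c" "p \<in> N" "open N" "N \<subseteq> fst c" using bump_in_chart[OF c p] .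
  define X where "X = (\<lambda>k. local_frame \<psi> c (axis k 1))"
  have X: "X k \<in> VF" for k
    unfolding X_def by (rule local_frame_vector_field[OF c \<psi>(1,2) axis_Basis])
  have XE: "X k q = E c k q" if "q \<in> N" for k q
    unfolding X_def by (rule local_frame_eq_coord_vec[OF \<psi>(1,2) that])
  have d: "X k p (\<lambda>q. \<beta> q (X l q)) = pd k (one_form_comp c l \<circ> cinv c) (snd c p)" for k l
  proof -
    let ?f = "\<lambda>q. \<beta> q (X l q)"
    have f: "?f \<in> SF" by (rule \<beta>_smooth[OF X])
    have "Df (?f \<circ> cinv c) (snd c p) = Df (one_form_comp c l \<circ> cinv c) (snd c p)"
      by (rule frechet_derivative_transform_within_open[OF differentiable_in_chart[OF c p f] open_chart_of_open[OF c \<psi>(4,5)]])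
        (use \<psi>(3,5) cinv_chart[OF c] in \<open>auto simp: XE one_form_comp_def\<close>)
    then show ?thesis using f by (simp add: XE[OF \<psi>(3)] coord_vec_def)
  qed
  have \<beta>0: "\<beta> p (\<lambda>f. 0) = 0"
    using \<beta>_linear[OF tangent_space_vector_0 tangent_space_vector_0, of p 0 0] by simp
  have "two_form_mat c p $ k $ l = ext_deriv (\<lambda>k. one_form_comp c k \<circ> cinv c) (snd c p) $ k $ l" for k l
  proof -
    have "two_form_mat c p $ k $ l = \<alpha> p (X k p) (X l p)" by (simp add: two_form_mat_def XE[OF \<psi>(3)])
    also have "\<dots> = pd k (one_form_comp c l \<circ> cinv c) (snd c p) - pd l (one_form_comp c k \<circ> cinv c) (snd c p)"
      unfolding \<alpha>_exact[OF X X] d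
      unfolding X_def lie_bracket_local_frames[OF c p \<psi>(1,2,3) axis_Basis axis_Basis] \<beta>0 by simp
    finally show ?thesis by (simp add: ext_deriv_def)
  qed
  then show ?thesis unfolding matrix_eq_4 by blast
qed

lemma two_form_mat_smooth: "smooth_on (cimg c) ((\<lambda>p. two_form_mat c p $ k $ l) \<circ> cinv c)"
  by (rule smooth_on_cong[OF open_chart_image[OF c]
        smooth_on_ext_deriv[OF open_chart_image[OF c] one_form_comp_smooth]])
    (auto simp: two_form_mat_eq_ext_deriv cinv_chart[OF c])

lemma E_smooth:
  assumes f: "f \<in> SF"
  shows "smooth_on (cimg c) ((\<lambda>p. E c k p f) \<circ> cinv c)"
  by (rule smooth_on_cong[OF open_chart_image[OF c]
        smooth_on_frechet_derivative[OF smooth_functions_in_chart[OF c f] axis_Basis[of k]]])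
    (auto simp: coord_vec_def f cinv_chart[OF c])

end

definition orientation :: "('a, real^4) chart \<Rightarrow> 'a \<Rightarrow> real" where
  "orientation c p = complex_orientation (J_mat c p)"

lemma orientation_locally_constant:
  assumes c: "c \<in> A"
  shows "locally_constant_on (cimg c) (orientation c \<circ> cinv c)"
  unfolding locally_constant_on_def
proof
  fix x assume x: "x \<in> cimg c"
  show "\<exists>T. open T \<and> x \<in> T \<and> (\<forall>y\<in>T. (orientation c \<circ> cinv c) y = (orientation c \<circ> cinv c) x)"
  proof (rule complex_orientation_locally_constant[OF open_chart_image[OF c] x, of "\<lambda>y. J_mat c (cinv c y)"])
    show "continuous_on (cimg c) (\<lambda>y. J_mat c (cinv c y) $ i $ j)" for i j
      using smooth_on_imp_continuous_on[OF J_mat_smooth[OF c, of i j]] by (simp add: o_def)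
    show "J_mat c (cinv c y) ** J_mat c (cinv c y) = - mat 1" if "y \<in> cimg c" for y
      by (rule J_mat_square[OF c cinv_in_domain[OF c that]])
  next
    fix T assume T: "open T" "x \<in> T"
      "\<And>y. y \<in> T \<Longrightarrow> complex_orientation (J_mat c (cinv c y)) = complex_orientation (J_mat c (cinv c x))"
    show "\<exists>T. open T \<and> x \<in> T \<and> (\<forall>y\<in>T. (orientation c \<circ> cinv c) y = (orientation c \<circ> cinv c) x)"
      unfolding o_def orientation_def by (intro exI[of _ T] conjI ballI T)
  qed
qed

lemma orientation_smooth:
  assumes c: "c \<in> A"
  shows "smooth_on (cimg c) (orientation c \<circ> cinv c)"
proof (rule smooth_on_local)
  fix x assume "x \<in> cimg c"
  then obtain T where T: "open T" "x \<in> T" "\<forall>y\<in>T. (orientation c \<circ> cinv c) y = (orientation c \<circ> cinv c) x"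
    using orientation_locally_constant[OF c] unfolding locally_constant_on_def by blast
  have "smooth_on T (orientation c \<circ> cinv c)"
    by (rule smooth_on_cong[OF T(1) smooth_on_const[of _ "(orientation c \<circ> cinv c) x"]]) (rule bspec[OF T(3), symmetric])
  then show "\<exists>T. open T \<and> x \<in> T \<and> smooth_on T (orientation c \<circ> cinv c)" using T by blast
qed

definition df_wedge_\<beta> :: "('a, real^4) chart \<Rightarrow> ('a \<Rightarrow> real) \<Rightarrow> 'a \<Rightarrow> real^4^4" where
  "df_wedge_\<beta> c f p = (\<chi> k l. E c k p f * one_form_comp c l p - E c l p f * one_form_comp c k p)"

text \<open>The density of \<open>df \<and> \<beta> \<and> \<alpha>\<close> and, below, half the density of \<open>\<alpha> \<and> \<alpha>\<close>, with respect to the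
  orientation given by \<open>J\<close>.\<close>

definition cross_density :: "('a, real^4) chart \<Rightarrow> ('a \<Rightarrow> real) \<Rightarrow> 'a \<Rightarrow> real" where
  "cross_density c f p = orientation c p * wedge (df_wedge_\<beta> c f p) (two_form_mat c p)"

definition square_density :: "('a, real^4) chart \<Rightarrow> 'a \<Rightarrow> real" where
  "square_density c p = orientation c p * pfaffian (two_form_mat c p)"

lemma cross_density_smooth:
  assumes c: "c \<in> A" and f: "f \<in> SF"
  shows "smooth_on (cimg c) (cross_density c f \<circ> cinv c)"
proof -
  note o = open_chart_image[OF c]
  have "smooth_on (cimg c) ((\<lambda>p. df_wedge_\<beta> c f p $ k $ l) \<circ> cinv c)" for k l
    using smooth_on_diff[OF o smooth_on_mult[OF o E_smooth[OF c f, of k] one_form_comp_smooth[OF c, of l]]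
        smooth_on_mult[OF o E_smooth[OF c f, of l] one_form_comp_smooth[OF c, of k]]]
    by (simp add: df_wedge_\<beta>_def o_def)
  then have m: "smooth_on (cimg c) (\<lambda>x. df_wedge_\<beta> c f (cinv c x) $ k $ l)" for k l by (simp add: o_def)
  have a: "smooth_on (cimg c) (\<lambda>x. two_form_mat c (cinv c x) $ k $ l)" for k l
    using two_form_mat_smooth[OF c] by (simp add: o_def)
  have s: "smooth_on (cimg c) (\<lambda>x. orientation c (cinv c x))"
    using orientation_smooth[OF c] by (simp add: o_def)
  show ?thesis
    unfolding o_def cross_density_def wedge_def
    by (intro smooth_on_mult smooth_on_add smooth_on_diff o m a s)
qed

lemma square_density_smooth:
  assumes c: "c \<in> A"
  shows "smooth_on (cimg c) (square_density c \<circ> cinv c)"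
proof -
  note o = open_chart_image[OF c]
  have a: "smooth_on (cimg c) (\<lambda>x. two_form_mat c (cinv c x) $ k $ l)" for k l
    using two_form_mat_smooth[OF c] by (simp add: o_def)
  have s: "smooth_on (cimg c) (\<lambda>x. orientation c (cinv c x))"
    using orientation_smooth[OF c] by (simp add: o_def)
  show ?thesis
    unfolding o_def square_density_def pfaffian_def
    by (intro smooth_on_mult smooth_on_add smooth_on_diff o a s)
qed

lemma square_density_nonneg: "c \<in> A \<Longrightarrow> p \<in> fst c \<Longrightarrow> square_density c p \<ge> 0"
  unfolding square_density_def orientation_def
  by (intro complex_orientation_pfaffian_nonneg J_mat_square two_form_mat_skew two_form_mat_anti)

lemma square_density_eq_0:
  assumes c: "c \<in> A" "p \<in> fst c" and 0: "square_density c p = 0"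
    and u: "u \<in> TM p" "w \<in> TM p"
  shows "\<alpha> p u w = 0"
proof -
  have "two_form_mat c p = 0"
    using complex_orientation_pfaffian_eq_0[OF J_mat_square[OF c] two_form_mat_skew[OF c] two_form_mat_anti[OF c]] 0
    by (simp add: square_density_def orientation_def)
  then have z: "\<alpha> p (E c k p) (E c l p) = 0" for k l
    by (simp add: two_form_mat_def vec_eq_iff)
  note T = E_tangent[OF c]
  have "\<alpha> p (\<lambda>f. \<Sum>k\<in>UNIV. coords c p u k * E c k p f) (\<lambda>f. \<Sum>k\<in>UNIV. coords c p w k * E c k p f) = 0"
    by (simp add: \<alpha>_sum_left \<alpha>_sum_right T tangent_space_vector_sum z)
  then show ?thesis
    using tangent_vector_eq_coords[OF c u(1)] tangent_vector_eq_coords[OF c u(2)] by simp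
qed

lemma cross_density_outside:
  assumes c: "c \<in> A" "p \<in> fst c" and f: "f \<in> SF" and K: "closed K" "\<And>q. q \<notin> K \<Longrightarrow> f q = 0" "p \<notin> K"
  shows "cross_density c f p = 0"
proof -
  have "E c k p f = E c k p (\<lambda>q. 0)" for k
    by (rule tangent_space_local[OF E_tangent[OF c] f smooth_functions_const, of "- K"]) (use K in auto)
  then have "E c k p f = 0" for k using tangent_space_on_const[OF E_tangent[OF c]] by simp
  then show ?thesis by (simp add: cross_density_def df_wedge_\<beta>_def wedge_def)
qed

text \<open>The density is linear in \<open>df\<close>, and the differentials of the functions add up to \<open>0\<close>.\<close>

lemma sum_cross_density_partition:
  assumes c: "c \<in> A" "p \<in> fst c" and I: "finite I" and f: "\<And>i. i \<in> I \<Longrightarrow> f i \<in> SF"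
    and one: "\<And>q. (\<Sum>i\<in>I. f i q) = 1"
  shows "(\<Sum>i\<in>I. cross_density c (f i) p) = 0"
proof -
  \<comment> \<open>\<open>W k\<close> is the coefficient of \<open>dx\<^sub>k \<and> \<beta> \<and> \<alpha>\<close>, multiplied by the orientation sign.\<close>
  define W where "W = (\<lambda>k. orientation c p * wedge (\<chi> i j. (if i = k then one_form_comp c j p else 0)
      - (if j = k then one_form_comp c i p else 0)) (two_form_mat c p))"
  have cd: "cross_density c h p = (\<Sum>k\<in>UNIV. E c k p h * W k)" for h
    by (simp add: W_def cross_density_def df_wedge_\<beta>_def wedge_def sum_4 algebra_simps)
  have "(\<Sum>i\<in>I. E c k p (f i)) = 0" for k
  proof -
    have "(\<Sum>i\<in>I. E c k p (f i)) = E c k p (\<lambda>q. \<Sum>i\<in>I. f i q)"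
      by (rule tangent_space_on_sum[OF E_tangent[OF c] I f, symmetric])
    then show ?thesis by (simp add: one tangent_space_on_const[OF E_tangent[OF c]])
  qed
  moreover have "(\<Sum>i\<in>I. cross_density c (f i) p) = (\<Sum>k\<in>UNIV. (\<Sum>i\<in>I. E c k p (f i)) * W k)"
    unfolding cd sum_distrib_right by (rule sum.swap)
  ultimately show ?thesis by simp
qed

text \<open>The coefficient of a four-form changes by the determinant of the transition matrix, and the
  orientation sign changes by the sign of this determinant.\<close>

lemma cross_density_change_chart:
  assumes c: "c \<in> A" "p \<in> fst c" and d: "d \<in> A" "p \<in> fst d"
  shows "cross_density c f p = \<bar>det (transition_matrix c d p)\<bar> * cross_density d f p"
proof -
  let ?T = "transition_matrix c d p"
  note dT = det_transition_matrix_nonzero[OF c d]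
  note Ec = E_change_chart[OF c d]
  have a: "two_form_mat c p = ?T ** two_form_mat d p ** transpose ?T"
  proof -
    have "two_form_mat c p $ k $ l = (?T ** two_form_mat d p ** transpose ?T) $ k $ l" for k l
      using \<alpha>_in_coordinates[OF d, of ?T k l] by (simp only: Ec[symmetric]) (simp add: two_form_mat_def)
    then show ?thesis unfolding matrix_eq_4 by blast
  qed
  have b: "one_form_comp c k p = (\<Sum>l\<in>UNIV. ?T$k$l * one_form_comp d l p)" for k
    unfolding one_form_comp_def Ec[of k]
    by (rule linear_functional_sum[OF \<beta>_linear]) (use E_tangent[OF d] in auto)
  have m: "df_wedge_\<beta> c f p = ?T ** df_wedge_\<beta> d f p ** transpose ?T"
  proof -
    have "df_wedge_\<beta> c f p $ k $ l = (?T ** df_wedge_\<beta> d f p ** transpose ?T) $ k $ l" for k l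
      unfolding df_wedge_\<beta>_def vec_lambda_beta b fun_cong[OF Ec, of k f] fun_cong[OF Ec, of l f]
      by (simp add: matrix_matrix_mult_def transpose_def sum_4 algebra_simps)
    then show ?thesis unfolding matrix_eq_4 by blast
  qed
  have JT: "J_mat c p ** ?T = ?T ** J_mat d p"
  proof -
    have "(J_mat c p ** ?T)$k$m = (?T ** J_mat d p)$k$m" for k m
    proof (rule coords_unique[OF d])
      have "(\<lambda>f. \<Sum>m\<in>UNIV. (J_mat c p ** ?T)$k$m * E d m p f) = (\<lambda>f. \<Sum>l\<in>UNIV. J_mat c p $k$l * E c l p f)"
        unfolding Ec by (simp add: matrix_matrix_mult_def sum_4 algebra_simps)
      also have "\<dots> = J p (E c k p)" using J_E[OF c] by simp
      also have "\<dots> = (\<lambda>f. \<Sum>l\<in>UNIV. ?T$k$l * J p (E d l p) f)"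
        unfolding Ec[of k] by (rule J_sum) (rule E_tangent[OF d])
      also have "\<dots> = (\<lambda>f. \<Sum>m\<in>UNIV. (?T ** J_mat d p)$k$m * E d m p f)"
        unfolding J_E[OF d] by (simp add: matrix_matrix_mult_def sum_4 algebra_simps)
      finally show "(\<lambda>f. \<Sum>m\<in>UNIV. (J_mat c p ** ?T)$k$m * E d m p f)
          = (\<lambda>f. \<Sum>m\<in>UNIV. (?T ** J_mat d p)$k$m * E d m p f)" .
    qed
    then show ?thesis unfolding matrix_eq_4 by blast
  qed
  have or: "orientation d p = sgn (det ?T) * orientation c p"
    unfolding orientation_def by (rule complex_orientation_change_frame[OF J_mat_square[OF c] JT dT])
  have sk: "df_wedge_\<beta> d f p $ j $ i = - df_wedge_\<beta> d f p $ i $ j" for i j by (simp add: df_wedge_\<beta>_def)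
  have "cross_density c f p = orientation c p * (det ?T * wedge (df_wedge_\<beta> d f p) (two_form_mat d p))"
    unfolding cross_density_def a m by (simp only: wedge_congruence[OF sk two_form_mat_skew[OF d]])
  also have "\<dots> = \<bar>det ?T\<bar> * cross_density d f p"
    unfolding cross_density_def or using dT by (simp add: sgn_if)
  finally show ?thesis .
qed

end

context exact_anti_invariant_form
begin

text \<open>The integral of \<open>d(f \<beta> \<and> \<alpha>) = df \<and> \<beta> \<and> \<alpha> + f \<alpha> \<and> \<alpha>\<close>; apply \<open>Stokes_wedge\<close> to \<open>\<xi> = f \<beta>\<close>.\<close>

lemma Stokes_in_chart:
  assumes c: "c \<in> A" and f: "f \<in> SF" and K: "compact K" "K \<subseteq> fst c" "\<And>q. q \<notin> K \<Longrightarrow> f q = 0"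
  shows "integral UNIV (in_chart c (cross_density c f))
    + 2 * integral UNIV (in_chart c (\<lambda>p. f p * square_density c p)) = 0"
proof -
  note o = open_chart_image[OF c]
  let ?f = "f \<circ> cinv c"
  define \<beta>' where "\<beta>' = (\<lambda>k. one_form_comp c k \<circ> cinv c)"
  define \<xi> where "\<xi> = (\<lambda>k x. ?f x * \<beta>' k x)"
  have \<beta>': "smooth_on (cimg c) (\<beta>' k)" for k unfolding \<beta>'_def by (rule one_form_comp_smooth[OF c])
  have f': "smooth_on (cimg c) ?f" by (rule smooth_functions_in_chart[OF c f])
  have \<xi>: "smooth_on (cimg c) (\<xi> k)" for k unfolding \<xi>_def by (intro smooth_on_mult o f' \<beta>')
  have \<xi>0: "\<xi> k x = 0" if "x \<in> cimg c - snd c ` K" for k x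
  proof -
    have "cinv c x \<notin> K" using that chart_cinv[OF c, of x] by (metis DiffD1 DiffD2 image_eqI)
    then show ?thesis using K(3) by (simp add: \<xi>_def)
  qed
  have kK: "snd c ` K \<subseteq> cimg c" using K(2) by blast
  have stokes: "((\<lambda>x. if x \<in> cimg c then (orientation c \<circ> cinv c) x * wedge (ext_deriv \<xi> x) (ext_deriv \<beta>' x) else 0)
      has_integral 0) UNIV"
    by (rule Stokes_wedge[OF o \<beta>' \<xi> orientation_locally_constant[OF c] compact_chart_image[OF c K(1,2)] kK \<xi>0])
  have "(\<lambda>x. if x \<in> cimg c then (orientation c \<circ> cinv c) x * wedge (ext_deriv \<xi> x) (ext_deriv \<beta>' x) else 0)
      = (\<lambda>x. in_chart c (cross_density c f) x + 2 * in_chart c (\<lambda>p. f p * square_density c p) x)" (is "?L = ?R")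
  proof
    fix x
    show "?L x = ?R x"
    proof (cases "x \<in> cimg c")
      case True
      define p where "p = cinv c x"
      have p: "p \<in> fst c" "snd c p = x" using cinv_in_domain[OF c True] chart_cinv[OF c True] by (auto simp: p_def)
      have a: "ext_deriv \<beta>' x = two_form_mat c p"
        using two_form_mat_eq_ext_deriv[OF c p(1)] by (simp add: p(2) \<beta>'_def)
      have pdf: "pd k ?f x = E c k p f" for k using f by (simp add: coord_vec_def p(2))
      have "pd k (\<xi> l) x = f p * pd k (\<beta>' l) x + E c k p f * one_form_comp c l p" for k l
        using frechet_derivative_mult_real[OF smooth_on_imp_differentiable[OF f' True]
            smooth_on_imp_differentiable[OF \<beta>'[of l] True], of "axis k 1"]
        by (simp add: \<xi>_def pdf) (simp add: \<beta>'_def p_def)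
      then have e: "ext_deriv \<xi> x $ k $ l = df_wedge_\<beta> c f p $ k $ l + f p * two_form_mat c p $ k $ l" for k l
        unfolding a[symmetric] by (simp add: ext_deriv_def df_wedge_\<beta>_def algebra_simps)
      have "wedge (ext_deriv \<xi> x) (two_form_mat c p)
          = wedge (df_wedge_\<beta> c f p) (two_form_mat c p) + f p * (2 * pfaffian (two_form_mat c p))"
        unfolding wedge_self[symmetric] unfolding wedge_def e by (simp add: algebra_simps)
      then show ?thesis
        using True by (simp add: in_chart_def cross_density_def square_density_def a p_def[symmetric] algebra_simps)
    qed (simp add: in_chart_def)
  qed
  with stokes have i: "integral UNIV ?R = 0" by (simp add: integral_unique)
  have "in_chart c (cross_density c f) absolutely_integrable_on UNIV"
    "in_chart c (\<lambda>p. f p * square_density c p) absolutely_integrable_on UNIV"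
  proof -
    have 1: "cross_density c f p = 0" if "p \<in> fst c - K" for p
      using cross_density_outside[OF c _ f compact_imp_closed[OF K(1)] K(3)] that by blast
    have 2: "f p * square_density c p = 0" if "p \<in> fst c - K" for p using that K(3) by simp
    have 3: "continuous_on (cimg c) ((\<lambda>p. f p * square_density c p) \<circ> cinv c)"
      using smooth_on_imp_continuous_on[OF smooth_on_mult[OF o f' square_density_smooth[OF c]]] by (simp add: o_def)
    show "in_chart c (cross_density c f) absolutely_integrable_on UNIV"
      by (rule absolutely_integrable_compact_support[OF in_chart_continuous[OF c K(1,2) 1
              smooth_on_imp_continuous_on[OF cross_density_smooth[OF c f]]]
            compact_chart_image[OF c K(1,2)] in_chart_outside[OF c K(2) 1]]) auto
    show "in_chart c (\<lambda>p. f p * square_density c p) absolutely_integrable_on UNIV"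
      by (rule absolutely_integrable_compact_support[OF in_chart_continuous[OF c K(1,2) 2 3]
            compact_chart_image[OF c K(1,2)] in_chart_outside[OF c K(2) 2]]) auto
  qed
  then have "in_chart c (cross_density c f) integrable_on UNIV"
    "in_chart c (\<lambda>p. f p * square_density c p) integrable_on UNIV"
    using absolutely_integrable_on_def by blast+
  then have "integral UNIV ?R = integral UNIV (in_chart c (cross_density c f))
      + integral UNIV (\<lambda>x. 2 * in_chart c (\<lambda>p. f p * square_density c p) x)"
    by (intro integral_add integrable_on_mult_right) auto
  then show ?thesis using i by simp
qed

text \<open>By Stokes' theorem and the cancellation of the cross terms the integrals of \<open>\<eta>\<^sub>i \<alpha> \<and> \<alpha>\<close> have sum
  \<open>0\<close>. They are nonnegative, so each integrand is zero, and \<open>\<alpha> = 0\<close> wherever \<open>\<eta>\<^sub>i > 0\<close>.\<close>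

theorem form_vanishes:
  assumes "u \<in> TM p" "w \<in> TM p"
  shows "\<alpha> p u w = 0"
proof -
  obtain I C K \<eta> where I: "finite I" and all: "\<forall>p\<in>I. C p \<in> A \<and> \<eta> p \<in> SF \<and> compact (K p) \<and>
      K p \<subseteq> fst (C p) \<and> (\<forall>q. 0 \<le> \<eta> p q) \<and> (\<forall>q. q \<notin> K p \<longrightarrow> \<eta> p q = 0)"
    and one: "\<forall>q. (\<Sum>p\<in>(I :: 'a set). \<eta> p q) = 1"
    using exists_partition_of_unity[OF compact_manifold] by blast
  from all have C: "\<And>i. i \<in> I \<Longrightarrow> C i \<in> A" and \<eta>: "\<And>i. i \<in> I \<Longrightarrow> \<eta> i \<in> SF"
    and K: "\<And>i. i \<in> I \<Longrightarrow> compact (K i)" "\<And>i. i \<in> I \<Longrightarrow> K i \<subseteq> fst (C i)"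
    and nn: "\<And>i q. i \<in> I \<Longrightarrow> 0 \<le> \<eta> i q" and z: "\<And>i q. i \<in> I \<Longrightarrow> q \<notin> K i \<Longrightarrow> \<eta> i q = 0"
    by blast+
  \<comment> \<open>The integral of \<open>\<eta>\<^sub>j d\<eta>\<^sub>i \<and> \<beta> \<and> \<alpha>\<close>, computed in the chart \<open>c\<close>; the support lies in the domains of
    both \<open>C i\<close> and \<open>C j\<close>.\<close>
  define D where "D = (\<lambda>c i j. integral UNIV (in_chart c (\<lambda>q. \<eta> j q * cross_density c (\<eta> i) q)))"
  define P where "P = (\<lambda>i. integral UNIV (in_chart (C i) (\<lambda>q. \<eta> i q * square_density (C i) q)))"
  have outside: "\<eta> j q * cross_density c (\<eta> i) q = 0" if "i \<in> I" "j \<in> I" "c \<in> A" "q \<in> fst c - K i \<inter> K j" for i j c q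
    using that z[of j q] cross_density_outside[OF that(3) _ \<eta>[OF that(1)] compact_imp_closed[OF K(1)[OF that(1)]] z[OF that(1)], of q]
    by auto
  have cont: "continuous_on (cimg c) ((\<lambda>q. \<eta> j q * cross_density c (\<eta> i) q) \<circ> cinv c)"
    if "i \<in> I" "j \<in> I" "c \<in> A" for i j c
    using smooth_on_imp_continuous_on[OF smooth_on_mult[OF open_chart_image[OF that(3)]
          smooth_functions_in_chart[OF that(3) \<eta>[OF that(2)]] cross_density_smooth[OF that(3) \<eta>[OF that(1)]]]]
    by (simp add: o_def)
  have cK: "compact (K i \<inter> K j)" if "i \<in> I" "j \<in> I" for i j
    using K(1) that by (simp add: compact_Int compact_imp_closed)
  have int: "in_chart c (\<lambda>q. \<eta> j q * cross_density c (\<eta> i) q) integrable_on UNIV"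
    if ij: "i \<in> I" "j \<in> I" and c: "c \<in> A" "K i \<inter> K j \<subseteq> fst c" for i j c
    using absolutely_integrable_compact_support[OF in_chart_continuous[OF c(1) cK[OF ij] c(2) outside[OF ij c(1)] cont[OF ij c(1)]]
        compact_chart_image[OF c(1) cK[OF ij] c(2)] in_chart_outside[OF c(1,2) outside[OF ij c(1)]], of UNIV]
      absolutely_integrable_on_def by blast
  have change: "D (C i) i j = D (C j) i j" if ij: "i \<in> I" "j \<in> I" for i j
    unfolding D_def
  proof (rule integral_in_chart_change[OF C[OF ij(1)] C[OF ij(2)] cK[OF ij]])
    show "K i \<inter> K j \<subseteq> fst (C i) \<inter> fst (C j)" using K(2) ij by blast
    show "\<eta> j q * cross_density (C i) (\<eta> i) q
        = \<bar>det (transition_matrix (C i) (C j) q)\<bar> * (\<eta> j q * cross_density (C j) (\<eta> i) q)"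
      if "q \<in> fst (C i) \<inter> fst (C j)" for q
      using cross_density_change_chart[OF C[OF ij(1)] _ C[OF ij(2)], of q "\<eta> i"] that by simp
  qed (use outside ij C cont in auto)
  have row: "integral UNIV (in_chart (C i) (cross_density (C i) (\<eta> i))) = (\<Sum>j\<in>I. D (C i) i j)" if i: "i \<in> I" for i
  proof -
    have "in_chart (C i) (cross_density (C i) (\<eta> i))
        = (\<lambda>x. \<Sum>j\<in>I. in_chart (C i) (\<lambda>q. \<eta> j q * cross_density (C i) (\<eta> i) q) x)"
      by (auto simp: fun_eq_iff in_chart_def sum_distrib_right[symmetric] one)
    then show ?thesis unfolding D_def
      using integral_sum[OF I, of "\<lambda>j. in_chart (C i) (\<lambda>q. \<eta> j q * cross_density (C i) (\<eta> i) q)" UNIV] int[OF i _ C[OF i]] K(2)[OF i]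
      by (simp add: le_infI1)
  qed
  have col: "(\<Sum>i\<in>I. D (C j) i j) = 0" if j: "j \<in> I" for j
  proof -
    have "(\<Sum>i\<in>I. D (C j) i j) = integral UNIV (\<lambda>x. \<Sum>i\<in>I. in_chart (C j) (\<lambda>q. \<eta> j q * cross_density (C j) (\<eta> i) q) x)"
      unfolding D_def
      using integral_sum[OF I, of "\<lambda>i. in_chart (C j) (\<lambda>q. \<eta> j q * cross_density (C j) (\<eta> i) q)" UNIV] int[OF _ j C[OF j]] K(2)[OF j]
      by (simp add: le_infI2)
    also have "(\<lambda>x. \<Sum>i\<in>I. in_chart (C j) (\<lambda>q. \<eta> j q * cross_density (C j) (\<eta> i) q) x) = (\<lambda>x. 0)"
    proof
      fix x
      show "(\<Sum>i\<in>I. in_chart (C j) (\<lambda>q. \<eta> j q * cross_density (C j) (\<eta> i) q) x) = 0"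
      proof (cases "x \<in> cimg (C j)")
        case True
        have "(\<Sum>i\<in>I. cross_density (C j) (\<eta> i) (cinv (C j) x)) = 0"
          by (rule sum_cross_density_partition[OF C[OF j] cinv_in_domain[OF C[OF j] True] I \<eta>]) (use one in auto)
        then show ?thesis using True by (simp add: in_chart_def sum_distrib_left[symmetric])
      qed (simp add: in_chart_def)
    qed
    finally show ?thesis by simp
  qed
  have "(\<Sum>i\<in>I. integral UNIV (in_chart (C i) (cross_density (C i) (\<eta> i)))) = (\<Sum>i\<in>I. \<Sum>j\<in>I. D (C j) i j)"
  proof (rule sum.cong[OF refl])
    fix i assume i: "i \<in> I"
    show "integral UNIV (in_chart (C i) (cross_density (C i) (\<eta> i))) = (\<Sum>j\<in>I. D (C j) i j)"
      unfolding row[OF i] by (rule sum.cong[OF refl change[OF i]])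
  qed
  also have "\<dots> = (\<Sum>j\<in>I. \<Sum>i\<in>I. D (C j) i j)" by (rule sum.swap)
  also have "\<dots> = 0" using col by simp
  finally have sum0: "(\<Sum>i\<in>I. integral UNIV (in_chart (C i) (cross_density (C i) (\<eta> i)))) = 0" .
  have "integral UNIV (in_chart (C i) (cross_density (C i) (\<eta> i))) = - 2 * P i" if i: "i \<in> I" for i
    using Stokes_in_chart[OF C[OF i] \<eta>[OF i] K(1)[OF i] K(2)[OF i] z[OF i]] by (simp add: P_def)
  then have "(\<Sum>i\<in>I. - 2 * P i) = 0" using sum0 by simp
  then have P0: "(\<Sum>i\<in>I. P i) = 0" unfolding sum_distrib_left[symmetric] by simp
  have nonneg: "in_chart (C i) (\<lambda>q. \<eta> i q * square_density (C i) q) x \<ge> 0" if i: "i \<in> I" for i x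
    using nn[OF i] square_density_nonneg[OF C[OF i] cinv_in_domain[OF C[OF i]]] by (auto simp: in_chart_def)
  have sqc: "continuous_on UNIV (in_chart (C i) (\<lambda>q. \<eta> i q * square_density (C i) q))" if i: "i \<in> I" for i
  proof (rule in_chart_continuous[OF C[OF i] K(1)[OF i] K(2)[OF i]])
    show "continuous_on (cimg (C i)) ((\<lambda>q. \<eta> i q * square_density (C i) q) \<circ> cinv (C i))"
      using smooth_on_imp_continuous_on[OF smooth_on_mult[OF open_chart_image[OF C[OF i]]
          smooth_functions_in_chart[OF C[OF i] \<eta>[OF i]] square_density_smooth[OF C[OF i]]]]
      by (simp add: o_def)
  qed (use z[OF i] in auto)
  have "P i \<ge> 0" if "i \<in> I" for i unfolding P_def
    by (cases "in_chart (C i) (\<lambda>q. \<eta> i q * square_density (C i) q) integrable_on UNIV")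
      (use nonneg[OF that] in \<open>auto intro: Henstock_Kurzweil_Integration.integral_nonneg simp: not_integrable_integral\<close>)
  with P0 I have Pi0: "P i = 0" if "i \<in> I" for i using sum_nonneg_eq_0_iff[of I P] that by blast
  obtain i where i: "i \<in> I" "\<eta> i p > 0"
  proof -
    have "\<exists>i\<in>I. \<eta> i p \<noteq> 0" using one by (metis sum.neutral zero_neq_one)
    then show thesis using that nn by (metis less_eq_real_def)
  qed
  then have pK: "p \<in> K i" using z by force
  then have p: "p \<in> fst (C i)" using K(2) i by blast
  have "in_chart (C i) (\<lambda>q. \<eta> i q * square_density (C i) q) (snd (C i) p) = 0"
    by (rule continuous_nonneg_integral_0[OF sqc[OF i(1)] nonneg[OF i(1)]
          compact_chart_image[OF C[OF i(1)] K(1)[OF i(1)] K(2)[OF i(1)]]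
          in_chart_outside[OF C[OF i(1)] K(2)[OF i(1)]] Pi0[OF i(1), unfolded P_def]])
      (use z[OF i(1)] in auto)
  then have "square_density (C i) p = 0"
    using i(2) p by (simp add: in_chart_def cinv_chart[OF C[OF i(1)] p])
  then show ?thesis using square_density_eq_0[OF C[OF i(1)] p _ assms] by blast
qed

end

section \<open>Killing fields on pseudo-Kaehler manifolds\<close>

locale kaehler_killing = smooth_manifold A
  for A :: "('a::{t2_space,second_countable_topology}, 'e::euclidean_space) chart set" +
  fixes g :: "'a metric_tensor" and J :: "'a endo_tensor" and nabla :: "'a conn" and v :: "'a vfield"
  assumes metric: "pseudo_riemannian_metric A g"
    and acs: "almost_complex_structure A J"
    and isometry: "\<And>p u w. u \<in> TM p \<Longrightarrow> w \<in> TM p \<Longrightarrow> g p (J p u) (J p w) = g p u w"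
    and levi_civita: "levi_civita_connection A g nabla"
    and parallel: "\<And>X Y. X \<in> VF \<Longrightarrow> Y \<in> VF \<Longrightarrow> cov_derivative_endo nabla J X Y = (\<lambda>p f. 0)"
    and killing: "killing_field A g v"
begin

lemma v_field: "v \<in> VF"
  using killing by (simp add: killing_field_def)

lemma g_lincomb: "u \<in> TM p \<Longrightarrow> w \<in> TM p \<Longrightarrow> z \<in> TM p \<Longrightarrow>
    g p (\<lambda>f. s * u f + t * w f) z = s * g p u z + t * g p w z"
  using metric unfolding pseudo_riemannian_metric_def by blast

lemma g_sym: "u \<in> TM p \<Longrightarrow> w \<in> TM p \<Longrightarrow> g p u w = g p w u"
  using metric unfolding pseudo_riemannian_metric_def by blast

lemma g_nondegenerate:
  "u \<in> TM p \<Longrightarrow> (\<And>w. w \<in> TM p \<Longrightarrow> g p u w = 0) \<Longrightarrow> u = (\<lambda>f. 0)"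
  using metric unfolding pseudo_riemannian_metric_def by blast

lemma g_smooth: "X \<in> VF \<Longrightarrow> Y \<in> VF \<Longrightarrow> (\<lambda>p. g p (X p) (Y p)) \<in> SF"
  using metric unfolding pseudo_riemannian_metric_def by blast

lemma g_diff: "u \<in> TM p \<Longrightarrow> w \<in> TM p \<Longrightarrow> z \<in> TM p \<Longrightarrow>
    g p (\<lambda>f. u f - w f) z = g p u z - g p w z"
  using g_lincomb[of u p w z 1 "-1"] by simp

lemma g_uminus: "u \<in> TM p \<Longrightarrow> z \<in> TM p \<Longrightarrow> g p (\<lambda>f. - u f) z = - g p u z"
  using g_lincomb[of u p u z "-1" 0] by simp

lemma tangent_diff: "u \<in> TM p \<Longrightarrow> w \<in> TM p \<Longrightarrow> (\<lambda>f. u f - w f) \<in> TM p"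
  using tangent_space_vector_lincomb[of u p w 1 "-1"] by simp

lemma tangent_uminus: "u \<in> TM p \<Longrightarrow> (\<lambda>f. - u f) \<in> TM p"
  using tangent_space_vector_lincomb[of u p u "-1" 0] by simp

lemma field_diff: "X \<in> VF \<Longrightarrow> Y \<in> VF \<Longrightarrow> (\<lambda>p f. X p f - Y p f) \<in> VF"
  using vector_fields_lincomb[of X Y 1 "-1"] by simp

lemma J_tangent: "u \<in> TM p \<Longrightarrow> J p u \<in> TM p"
  using acs by (simp add: almost_complex_structure_def)

lemma J_field: "X \<in> VF \<Longrightarrow> (\<lambda>p. J p (X p)) \<in> VF"
  using acs by (simp add: almost_complex_structure_def)

lemma J_J: "u \<in> TM p \<Longrightarrow> J p (J p u) = (\<lambda>f. - u f)"
  using acs by (simp add: almost_complex_structure_def)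

lemma J_lincomb: "u \<in> TM p \<Longrightarrow> w \<in> TM p \<Longrightarrow>
    J p (\<lambda>f. s * u f + t * w f) = (\<lambda>f. s * J p u f + t * J p w f)"
  using acs unfolding almost_complex_structure_def by blast

lemma J_diff: "u \<in> TM p \<Longrightarrow> w \<in> TM p \<Longrightarrow>
    J p (\<lambda>f. u f - w f) = (\<lambda>f. J p u f - J p w f)"
  using J_lincomb[of u p w 1 "-1"] by simp

lemma J_skew_adjoint:
  assumes u: "u \<in> TM p" and w: "w \<in> TM p"
  shows "g p u (J p w) = - g p (J p u) w"
proof -
  have "g p (J p u) (J p (J p w)) = g p u (J p w)" by (rule isometry[OF u J_tangent[OF w]])
  then have "g p u (J p w) = g p (\<lambda>f. - w f) (J p u)"
    using g_sym[OF J_tangent[OF u] tangent_uminus[OF w]] by (simp add: J_J[OF w])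
  also have "\<dots> = - g p (J p u) w"
    using g_uminus[OF w J_tangent[OF u]] g_sym[OF w J_tangent[OF u]] by simp
  finally show ?thesis .
qed

lemma nabla_field: "X \<in> VF \<Longrightarrow> Y \<in> VF \<Longrightarrow> nabla X Y \<in> VF"
  using levi_civita unfolding levi_civita_connection_def affine_connection_def by blast

lemma nabla_tangent: "X \<in> VF \<Longrightarrow> Y \<in> VF \<Longrightarrow> nabla X Y p \<in> TM p"
  by (intro vector_fields_tangent nabla_field)

lemma torsion_free:
  assumes "X \<in> VF" "Y \<in> VF"
  shows "lie_bracket X Y p = (\<lambda>f. nabla X Y p f - nabla Y X p f)"
proof -
  have "(\<lambda>p f. nabla X Y p f - nabla Y X p f) = lie_bracket X Y"
    using levi_civita assms unfolding levi_civita_connection_def by blast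
  from fun_cong[OF this, of p] show ?thesis by simp
qed

lemma metric_compatible:
  "X \<in> VF \<Longrightarrow> Y \<in> VF \<Longrightarrow> Z \<in> VF \<Longrightarrow>
     X p (\<lambda>q. g q (Y q) (Z q)) = g p (nabla X Y p) (Z p) + g p (Y p) (nabla X Z p)"
  using levi_civita unfolding levi_civita_connection_def by blast

lemma nabla_uminus:
  assumes "X \<in> VF" "Y \<in> VF"
  shows "nabla (\<lambda>p f. - X p f) Y p = (\<lambda>f. - nabla X Y p f)"
proof -
  have "\<forall>h\<in>SF. \<forall>X\<in>VF. \<forall>Y\<in>VF.
        nabla (\<lambda>p f. h p * X p f) Y = (\<lambda>p f. h p * nabla X Y p f)"
    using levi_civita unfolding levi_civita_connection_def affine_connection_def by blast
  from this[rule_format, OF smooth_functions_const[of "-1"] assms] show ?thesis by simp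
qed

lemma nabla_J:
  assumes "X \<in> VF" "Y \<in> VF"
  shows "nabla X (\<lambda>q. J q (Y q)) p = J p (nabla X Y p)"
proof
  fix f
  have "cov_derivative_endo nabla J X Y p f = 0" using parallel[OF assms] by simp
  then show "nabla X (\<lambda>q. J q (Y q)) p f = J p (nabla X Y p) f" by (simp add: cov_derivative_endo_def)
qed

text \<open>For a torsion-free metric connection \<open>L\<^sub>v g\<close> is the symmetrization of \<open>\<nabla>v\<close>.\<close>

lemma killing_equation:
  assumes X: "X \<in> VF" and Y: "Y \<in> VF"
  shows "g p (nabla X v p) (Y p) = - g p (nabla Y v p) (X p)"
proof -
  note T = nabla_tangent vector_fields_tangent X Y v_field
  have "lie_derivative_metric v g X Y p = 0" using killing X Y by (simp add: killing_field_def)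
  then have "v p (\<lambda>q. g q (X q) (Y q)) = g p (lie_bracket v X p) (Y p) + g p (lie_bracket v Y p) (X p)"
    using g_sym[of "X p" p "lie_bracket v Y p"] tangent_diff[of "nabla v Y p" p "nabla Y v p"]
    by (simp add: lie_derivative_metric_def torsion_free T)
  then show ?thesis
    using g_sym[of "X p" p "nabla v Y p"] by (simp add: torsion_free metric_compatible g_diff T)
qed

abbreviation LJ :: "'a vfield \<Rightarrow> 'a vfield" where
  "LJ \<equiv> lie_derivative_endo v J"

lemma LJ_eq:
  assumes X: "X \<in> VF"
  shows "LJ X p = (\<lambda>f. J p (nabla X v p) f - nabla (\<lambda>q. J q (X q)) v p f)"
  unfolding lie_derivative_endo_def torsion_free[OF v_field J_field[OF X]] torsion_free[OF v_field X] nabla_J[OF v_field X]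
    J_diff[OF nabla_tangent[OF v_field X] nabla_tangent[OF X v_field]]
  by simp

lemma LJ_field:
  assumes X: "X \<in> VF"
  shows "LJ X \<in> VF"
proof -
  have "LJ X = (\<lambda>p f. J p (nabla X v p) f - nabla (\<lambda>q. J q (X q)) v p f)"
    by (rule ext) (rule LJ_eq[OF X])
  then show ?thesis
    using field_diff[OF J_field[OF nabla_field[OF X v_field]] nabla_field[OF J_field[OF X] v_field]] by simp
qed

text \<open>This is the Lie derivative of the identity \<open>J\<^sup>2 = -1\<close>.\<close>

lemma LJ_J:
  assumes X: "X \<in> VF"
  shows "LJ (\<lambda>q. J q (X q)) p = (\<lambda>f. - J p (LJ X p) f)"
proof -
  have JJ: "(\<lambda>q. J q (J q (X q))) = (\<lambda>q f. - X q f)"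
    using J_J[OF vector_fields_tangent[OF X]] by (simp add: fun_eq_iff)
  show ?thesis
    unfolding LJ_eq[OF J_field[OF X]] LJ_eq[OF X] JJ nabla_uminus[OF X v_field]
      J_diff[OF J_tangent[OF nabla_tangent[OF X v_field]] nabla_tangent[OF J_field[OF X] v_field]]
      J_J[OF nabla_tangent[OF X v_field]]
    by (simp add: fun_eq_iff)
qed

definition omega_v :: "'a \<Rightarrow> 'a tvec \<Rightarrow> real" where
  "omega_v p u = g p (J p (v p)) u"

text \<open>Both sides equal \<open>g(J \<nabla>\<^sub>X v, Y) - g(J \<nabla>\<^sub>Y v, X)\<close>: the left one by the Killing equation applied to
  \<open>JX\<close> and \<open>Y\<close>, the right one because the connection is torsion-free and metric and \<open>J\<close> is parallel.\<close>

lemma LJ_exact: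
  assumes X: "X \<in> VF" and Y: "Y \<in> VF"
  shows "g p (LJ X p) (Y p)
    = X p (\<lambda>q. omega_v q (Y q)) - Y p (\<lambda>q. omega_v q (X q)) - omega_v p (lie_bracket X Y p)"
proof -
  note T = nabla_tangent vector_fields_tangent X Y v_field J_tangent J_field[OF v_field] J_field[OF X]
  have "g p (LJ X p) (Y p) = g p (J p (nabla X v p)) (Y p) - g p (nabla (\<lambda>q. J q (X q)) v p) (Y p)"
    unfolding LJ_eq[OF X] by (rule g_diff) (simp_all add: T)
  also have "g p (nabla (\<lambda>q. J q (X q)) v p) (Y p) = g p (J p (nabla Y v p)) (X p)"
    using killing_equation[OF J_field[OF X] Y] J_skew_adjoint[of "nabla Y v p" p "X p"] by (simp add: T)
  finally have 1: "g p (LJ X p) (Y p) = g p (J p (nabla X v p)) (Y p) - g p (J p (nabla Y v p)) (X p)" .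
  have d: "Z p (\<lambda>q. omega_v q (W q)) = g p (J p (nabla Z v p)) (W p) + g p (J p (v p)) (nabla Z W p)"
    if Z: "Z \<in> VF" and W: "W \<in> VF" for Z W
    unfolding omega_v_def metric_compatible[OF Z J_field[OF v_field] W] nabla_J[OF Z v_field] ..
  have "omega_v p (lie_bracket X Y p) = g p (J p (v p)) (nabla X Y p) - g p (J p (v p)) (nabla Y X p)"
  proof -
    have "omega_v p (lie_bracket X Y p) = g p (\<lambda>f. nabla X Y p f - nabla Y X p f) (J p (v p))"
      unfolding omega_v_def torsion_free[OF X Y]
      by (rule g_sym) (auto intro!: tangent_diff simp: T)
    also have "\<dots> = g p (nabla X Y p) (J p (v p)) - g p (nabla Y X p) (J p (v p))"
      by (rule g_diff) (simp_all add: T)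
    finally show ?thesis
      using g_sym[of "nabla X Y p" p "J p (v p)"] g_sym[of "nabla Y X p" p "J p (v p)"] by (simp add: T)
  qed
  then show ?thesis unfolding 1 d[OF X Y] d[OF Y X] by simp
qed

lemma lie_bracket_skew: "lie_bracket X Y p = (\<lambda>f. - lie_bracket Y X p f)"
  by (simp add: lie_bracket_def fun_eq_iff)

lemma LJ_skew:
  assumes X: "X \<in> VF" and Y: "Y \<in> VF"
  shows "g p (LJ X p) (Y p) = - g p (LJ Y p) (X p)"
proof -
  have T: "lie_bracket Y X p \<in> TM p"
    unfolding torsion_free[OF Y X] by (intro tangent_diff nabla_tangent X Y)
  have Jv: "J p (v p) \<in> TM p" by (intro J_tangent vector_fields_tangent v_field)
  have "omega_v p (lie_bracket X Y p) = - omega_v p (lie_bracket Y X p)"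
    unfolding omega_v_def lie_bracket_skew[of X Y]
    using g_sym[OF Jv tangent_uminus[OF T]] g_uminus[OF T Jv] g_sym[OF Jv T] by simp
  then show ?thesis unfolding LJ_exact[OF X Y] LJ_exact[OF Y X] by simp
qed

definition extension :: "'a \<Rightarrow> 'a tvec \<Rightarrow> 'a vfield" where
  "extension p u = (SOME X. X \<in> VF \<and> X p = u)"

lemma extension:
  assumes "u \<in> TM p"
  shows extension_field: "extension p u \<in> VF" and extension_at: "extension p u p = u"
proof -
  have "\<exists>X. X \<in> VF \<and> X p = u" using exists_vector_field_extension[OF assms] by metis
  from someI_ex[OF this] show "extension p u \<in> VF" "extension p u p = u"
    by (simp_all add: extension_def)
qed

text \<open>Since \<open>LJ\<close> acts on vector fields, the tangent vector \<open>u\<close> is first extended; by \<open>LJ_form_eq\<close> below any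
  extension gives the same value.\<close>

definition LJ_form :: "'a \<Rightarrow> 'a tvec \<Rightarrow> 'a tvec \<Rightarrow> real" where
  "LJ_form p u w = g p (LJ (extension p u) p) w"

text \<open>Skew symmetry moves the vector field whose value at \<open>p\<close> alone is known into the second argument of
  \<open>g\<close>, where only this value matters.\<close>

lemma LJ_form_eq:
  assumes X: "X \<in> VF" and w: "w \<in> TM p"
  shows "LJ_form p (X p) w = g p (LJ X p) w"
proof -
  let ?X = "extension p (X p)" and ?W = "extension p w"
  note eX = extension[OF vector_fields_tangent[OF X, of p]] and eW = extension[OF w]
  have "LJ_form p (X p) w = g p (LJ ?X p) (?W p)" by (simp add: LJ_form_def eW)
  also have "\<dots> = - g p (LJ ?W p) (X p)" using LJ_skew[OF eX(1) eW(1), of p] by (simp add: eX(2))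
  also have "\<dots> = g p (LJ X p) (?W p)" using LJ_skew[OF X eW(1), of p] by simp
  finally show ?thesis by (simp add: eW)
qed

lemma LJ_form_skew:
  assumes u: "u \<in> TM p" and w: "w \<in> TM p"
  shows "LJ_form p u w = - LJ_form p w u"
  using LJ_skew[OF extension_field[OF u] extension_field[OF w], of p]
  by (simp add: LJ_form_def extension_at[OF u] extension_at[OF w])

lemma LJ_form_linear:
  assumes u: "u \<in> TM p" and w: "w \<in> TM p" and z: "z \<in> TM p"
  shows "LJ_form p (\<lambda>f. s * u f + t * w f) z = s * LJ_form p u z + t * LJ_form p w z"
proof -
  let ?u = "\<lambda>f. s * u f + t * w f"
  have uw: "?u \<in> TM p" by (rule tangent_space_vector_lincomb[OF u w])
  have T: "LJ (extension p z) p \<in> TM p"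
    by (intro vector_fields_tangent LJ_field extension_field z)
  have "LJ_form p z y = g p y (LJ (extension p z) p)" if "y \<in> TM p" for y
    unfolding LJ_form_def by (rule g_sym[OF T that])
  then show ?thesis
    using LJ_form_skew[OF uw z] LJ_form_skew[OF u z] LJ_form_skew[OF w z] g_lincomb[OF u w T] u w uw
    by simp
qed

lemma LJ_form_anti_invariant:
  assumes u: "u \<in> TM p" and w: "w \<in> TM p"
  shows "LJ_form p (J p u) (J p w) = - LJ_form p u w"
proof -
  let ?U = "extension p u"
  note U = extension_field[OF u] extension_at[OF u]
  have T: "LJ ?U p \<in> TM p" by (intro vector_fields_tangent LJ_field U)
  have "LJ_form p (J p u) (J p w) = g p (\<lambda>f. - J p (LJ ?U p) f) (J p w)"
    using LJ_form_eq[OF J_field[OF U(1)] J_tangent[OF w]] by (simp add: U(2) LJ_J[OF U(1)])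
  also have "\<dots> = - g p (LJ ?U p) w"
    using g_uminus[OF J_tangent[OF T] J_tangent[OF w]] isometry[OF T w] by simp
  finally show ?thesis by (simp add: LJ_form_def)
qed

lemma omega_v_linear:
  assumes u: "u \<in> TM p" and w: "w \<in> TM p"
  shows "omega_v p (\<lambda>f. s * u f + t * w f) = s * omega_v p u + t * omega_v p w"
proof -
  have Jv: "J p (v p) \<in> TM p" by (intro J_tangent vector_fields_tangent v_field)
  show ?thesis
    unfolding omega_v_def
    using g_lincomb[OF u w Jv] g_sym[OF Jv u] g_sym[OF Jv w] g_sym[OF Jv tangent_space_vector_lincomb[OF u w]]
    by simp
qed

lemma real_holomorphic_if_LJ_form_0:
  assumes 0: "\<And>p u w. u \<in> TM p \<Longrightarrow> w \<in> TM p \<Longrightarrow> LJ_form p u w = 0"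
  shows "real_holomorphic_field A J v"
proof -
  have "LJ X p = (\<lambda>f. 0)" if X: "X \<in> VF" for X p
    by (rule g_nondegenerate[OF vector_fields_tangent[OF LJ_field[OF X]]])
      (use LJ_form_eq[OF X] 0[OF vector_fields_tangent[OF X]] in auto)
  then show ?thesis using v_field by (auto simp: real_holomorphic_field_def fun_eq_iff)
qed

end

theorem theoremB:
  fixes A :: "('a::{t2_space,second_countable_topology}, real^4) chart set"
    and g :: "'a metric_tensor"
    and J :: "'a endo_tensor"
    and v :: "'a vfield"
  assumes "smooth_atlas A"
    and "compact (UNIV :: 'a set)"
    and "pseudo_kaehler A g J"
    and "killing_field A g v"
  shows "real_holomorphic_field A J v"
proof -
  obtain nabla where nabla: "levi_civita_connection A g nabla"
    "\<forall>X\<in>vector_fields A. \<forall>Y\<in>vector_fields A. cov_derivative_endo nabla J X Y = (\<lambda>p f. 0)"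
    using assms(3) unfolding pseudo_kaehler_def by blast
  interpret kaehler_killing A g J nabla v
  proof unfold_locales
    fix p u w assume "u \<in> tangent_space A p" "w \<in> tangent_space A p"
    then show "g p (J p u) (J p w) = g p u w" using assms(3) unfolding pseudo_kaehler_def by blast
  next
    fix X Y assume "X \<in> vector_fields A" "Y \<in> vector_fields A"
    then show "cov_derivative_endo nabla J X Y = (\<lambda>p f. 0)" using nabla(2) by blast
  qed (use assms nabla(1) in \<open>simp_all add: pseudo_kaehler_def\<close>)
  interpret exact_anti_invariant_form A J omega_v LJ_form
  proof unfold_locales
    show "compact (UNIV :: 'a set)" by fact
    show "almost_complex_structure A J" by (rule acs)
    show "(\<lambda>p. omega_v p (X p)) \<in> smooth_functions A" if "X \<in> vector_fields A" for X
      unfolding omega_v_def by (rule g_smooth[OF J_field[OF v_field] that])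
    show "LJ_form p (X p) (Y p) = X p (\<lambda>q. omega_v q (Y q)) - Y p (\<lambda>q. omega_v q (X q)) - omega_v p (lie_bracket X Y p)"
      if "X \<in> vector_fields A" "Y \<in> vector_fields A" for X Y p
      using LJ_form_eq[OF that(1) vector_fields_tangent[OF that(2)]] LJ_exact[OF that] by simp
  qed (fact omega_v_linear LJ_form_linear LJ_form_skew LJ_form_anti_invariant)+
  show ?thesis by (rule real_holomorphic_if_LJ_form_0) (rule form_vanishes)
qed

end
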